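(* Let $G$ be a finite group. Then there exists a finite group $N$ such that: (1) $G \cong \operatorname{Out}(N)$; (2) $Z(N) = 1$; (3) the only subgroup of $\operatorname{Aut}(N)$ isomorphic to $N$ is $\operatorname{Inn}(N)$; (4) there is a group homomorphism $s \colon \operatorname{Out}(N) \to \operatorname{Aut}(N)$ with $q \circ s = \mathrm{id}_{\operatorname{Out}(N)}$, where $q \colon \operatorname{Aut}(N) \to \operatorname{Out}(N)$ is the quotient map; (5) $N$ is supersolvable.
   Context: $\operatorname{Aut}(N)$ is the automorphism group of $N$, $\operatorname{Inn}(N)$ its subgroup of inner automorphisms, $\operatorname{Out}(N) = \operatorname{Aut}(N)/\operatorname{Inn}(N)$, and $Z(N)$ the center of $N$. *)

theory Defs
  imports "HOL-Algebra.Algebra"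
begin

definition center :: "('a, 'b) monoid_scheme \<Rightarrow> 'a set" where
  "center N = {z \<in> carrier N. \<forall>x \<in> carrier N. z \<otimes>\<^bsub>N\<^esub> x = x \<otimes>\<^bsub>N\<^esub> z}"

text \<open>Inn(N): the inner automorphisms (as extensional functions, like the elements of AutoGroup N).\<close>
definition inn :: "('a, 'b) monoid_scheme \<Rightarrow> ('a \<Rightarrow> 'a) set" where
  "inn N = (\<lambda>g. \<lambda>x \<in> carrier N. g \<otimes>\<^bsub>N\<^esub> x \<otimes>\<^bsub>N\<^esub> inv\<^bsub>N\<^esub> g) ` carrier N"

definition OutGroup :: "('a, 'b) monoid_scheme \<Rightarrow> ('a \<Rightarrow> 'a) set monoid" where
  "OutGroup N = AutoGroup N Mod inn N"

definition out_quot :: "('a, 'b) monoid_scheme \<Rightarrow> ('a \<Rightarrow> 'a) \<Rightarrow> ('a \<Rightarrow> 'a) set" where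
  "out_quot N \<phi> = inn N #>\<^bsub>AutoGroup N\<^esub> \<phi>"

definition supersolvable :: "('a, 'b) monoid_scheme \<Rightarrow> bool" where
  "supersolvable N \<longleftrightarrow> (\<exists>(n::nat) (H :: nat \<Rightarrow> 'a set).
      H 0 = {\<one>\<^bsub>N\<^esub>} \<and> H n = carrier N \<and>
      (\<forall>i \<le> n. H i \<lhd> N) \<and>
      (\<forall>i < n. H i \<subseteq> H (Suc i) \<and>
         cyclic_group (subgroup_generated N (H (Suc i)) Mod H i)))"

end

theory Submission
  imports Defs "HOL-Number_Theory.Residue_Primitive_Roots"
begin

text \<open>Let \<open>p\<close> be a prime that is large compared with \<open>|G|\<close>, and give each \<open>x \<in> G\<close> its own colour
  \<open>c x \<ge> 2\<close>. Take \<open>N = (W \<rtimes> U) \<rtimes> T\<close>, where \<open>U\<close> is the \<open>\<int>/p\<close>-space on symbols \<open>x\<^sub>g\<close> (\<open>g \<in> G\<close>),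
  \<open>W\<close> is the \<open>\<int>/p\<close>-space on symbols \<open>y\<^sub>h\<close> (\<open>h \<in> G\<close>) prolonged, for every \<open>g\<close>, by a Jordan chain of \<open>x\<^sub>g\<close>
  of length \<open>c (g\<^sup>-\<^sup>1 h)\<close> starting at \<open>y\<^sub>h\<close>, and the torus \<open>T\<close> scales all \<open>x\<^sub>g\<close> and \<open>y\<^sub>h\<close> independently.
  The weights of \<open>T\<close> on the basis are distinct and \<open>T\<close> is the full group of diagonal automorphisms.
  Up to inner automorphisms an automorphism of \<open>N\<close> preserves \<open>T\<close>, hence permutes the weight lines,
  and may be assumed to permute the \<open>x\<^sub>g\<close> and the \<open>y\<^sub>h\<close> themselves. Comparing weights, it preserves
  the chain lengths, so both permutations are the same left translation of \<open>G\<close>.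
  Thus \<open>Aut N\<close> is the semidirect product of \<open>Inn N\<close> and \<open>G\<close>. For a subgroup \<open>H \<cong> N\<close> of \<open>Aut N\<close>, its Sylow
  \<open>p\<close>-subgroup is that of \<open>Inn N\<close> and the quotient by it is abelian; an element of \<open>H\<close> outside \<open>Inn N\<close> would
  centralise a subgroup of index at most \<open>|G|\<close> in \<open>T\<close>, whereas the fixed points in \<open>T\<close> of a nontrivial
  translation have index at least \<open>p - 1 > |G|\<close>.\<close>

section \<open>Scalars\<close>

text \<open>\<open>N\<close> is generated by the torus and the symbols x_g, y_h alone: the
  commutator of x_g and y_h has every further chain vector as a component, and as their weights
  differ, interpolation in the torus isolates each of them. So an automorphism is known once it is
  known on the torus and on these symbols, and all that it must respect is phrased by powers,
  commutators and weights. The colours are a form of Frucht's device: an edge from g to h is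
  labelled by g^-1 h, and since the labelling is injective, only left translations preserve it. It
  suffices to show that no chain gets shorter, because the total length over all pairs is fixed.
  Lengths start at 2 so that x_g never commutes with its commutators with the y_h; this is how W is
  recognised as a centraliser. The bound on p keeps the exponents occurring in weights below the
  order p - 1 of the multiplicative group. Supersolvability holds because T acts diagonally while
  the unipotent part only pushes vectors further up their chains, so that lines can be added one at
  a time, starting at the ends of the chains.\<close>

typedef residues_prod = "{f :: nat \<Rightarrow> int. \<forall>n. 0 \<le> f n \<and> f n \<le> int n}"
  by (rule exI[of _ "\<lambda>_. 0"]) simp

text \<open>Index \<open>n\<close> carries the modulus \<open>n + 1\<close>, so that no modulus is 0
  and \<open>Z/p\<close> sits at index \<open>p - 1\<close>. The type is the product of all these
  residue rings, with least residues as representatives.\<close>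

lemma residues_prod_mod: "0 \<le> k mod (int n + 1) \<and> k mod (int n + 1) \<le> int n"
  using pos_mod_bound[of "int n + 1" k] by simp

setup_lifting type_definition_residues_prod

instantiation residues_prod :: comm_ring_1
begin

lift_definition zero_residues_prod :: residues_prod is "\<lambda>_. 0" by simp
lift_definition one_residues_prod :: residues_prod is "\<lambda>n. 1 mod (int n + 1)"
  by (rule residues_prod_mod)
lift_definition plus_residues_prod :: "residues_prod \<Rightarrow> residues_prod \<Rightarrow> residues_prod"
  is "\<lambda>f g n. (f n + g n) mod (int n + 1)"
  by (rule residues_prod_mod)
lift_definition times_residues_prod :: "residues_prod \<Rightarrow> residues_prod \<Rightarrow> residues_prod"
  is "\<lambda>f g n. (f n * g n) mod (int n + 1)"
  by (rule residues_prod_mod)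
lift_definition uminus_residues_prod :: "residues_prod \<Rightarrow> residues_prod"
  is "\<lambda>f n. (- f n) mod (int n + 1)"
  by (rule residues_prod_mod)
lift_definition minus_residues_prod :: "residues_prod \<Rightarrow> residues_prod \<Rightarrow> residues_prod"
  is "\<lambda>f g n. (f n - g n) mod (int n + 1)"
  by (rule residues_prod_mod)

instance
proof
  fix a b c :: residues_prod
  show "a * b * c = a * (b * c)" by transfer (simp add: mod_simps mult.assoc)
  show "a * b = b * a" by transfer (simp add: mult.commute)
  show "1 * a = a" by transfer (auto simp: mod_simps fun_eq_iff)
  show "a + b + c = a + (b + c)" by transfer (simp add: mod_simps add.assoc)
  show "a + b = b + a" by transfer (simp add: add.commute)
  show "0 + a = a" by transfer (auto simp: mod_simps fun_eq_iff)
  show "- a + a = 0" by transfer (auto simp: mod_simps fun_eq_iff)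
  show "a - b = a + - b" by transfer (auto simp: mod_simps fun_eq_iff)
  show "(a + b) * c = a * c + b * c" by transfer (auto simp: mod_simps fun_eq_iff algebra_simps)
  \<comment> \<open>Index 1 is the witness: at index 0 the modulus is 1, where both elements
    agree.\<close>
  show "(0::residues_prod) \<noteq> 1" by transfer (auto simp: fun_eq_iff intro!: exI[of _ 1])
qed

end

lift_definition residues_unit :: "nat \<Rightarrow> residues_prod" is
  "\<lambda>p n. if n + 1 = p then 1 mod (int n + 1) else 0"
  using residues_prod_mod[of 1] by simp

lemma of_nat_residues_prod: "Rep_residues_prod (of_nat k) n = int k mod (int n + 1)"
  by (induction k) (auto simp: zero_residues_prod.rep_eq plus_residues_prod.rep_eq
      one_residues_prod.rep_eq mod_simps add.commute)

text \<open>The ring need not be a field: the scalars that matter are those in the corner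
  \<open>F = {x. x * e = x}\<close> cut out by an idempotent \<open>e\<close>, which is a copy of \<open>\<int>/p\<close> with unit \<open>e\<close>.
  This provides all prime fields inside a single type.\<close>

locale prime_corner =
  fixes e :: "'k::comm_ring_1" and p :: nat
  assumes prime_p: "Factorial_Ring.prime p"
    and idem: "e * e = e"
    and of_nat_e_eq_0: "of_nat k * e = 0 \<longleftrightarrow> p dvd k"
    and corner_of_nat: "x * e = x \<Longrightarrow> \<exists>k. x = of_nat k * e"

lemma prime_corner_residues_unit:
  assumes "Factorial_Ring.prime p"
  shows "prime_corner (residues_unit p) p"
proof
  have p1: "p > 1" using assms prime_gt_1_nat by blast
  show "residues_unit p * residues_unit p = residues_unit p"
    by transfer (auto simp: fun_eq_iff mod_simps)
  have rep: "Rep_residues_prod (of_nat k * residues_unit p) n = (if n + 1 = p then int k mod int p else 0)" for k n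
    by (auto simp: times_residues_prod.rep_eq of_nat_residues_prod residues_unit.rep_eq mod_simps add.commute)
  show "of_nat k * residues_unit p = 0 \<longleftrightarrow> p dvd k" for k
  proof -
    have "of_nat k * residues_unit p = 0 \<longleftrightarrow> (\<forall>n. Rep_residues_prod (of_nat k * residues_unit p) n = 0)"
      by (metis Rep_residues_prod_inject zero_residues_prod.rep_eq ext)
    also have "\<dots> \<longleftrightarrow> int k mod int p = 0"
      unfolding rep using p1 by (cases p) auto
    also have "\<dots> \<longleftrightarrow> p dvd k" by (simp add: dvd_eq_mod_eq_0 flip: zmod_int)
    finally show ?thesis .
  qed
  show "\<exists>k. x = of_nat k * residues_unit p" if "x * residues_unit p = x" for x
  proof (intro exI)
    have "Rep_residues_prod (x * residues_unit p) n = (if n + 1 = p then Rep_residues_prod x n mod int p else 0)" for n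
      by (auto simp: times_residues_prod.rep_eq residues_unit.rep_eq mod_simps add.commute)
    then have *: "Rep_residues_prod x n = (if n + 1 = p then Rep_residues_prod x n mod int p else 0)" for n
      using that by simp
    have pos: "Rep_residues_prod x n \<ge> 0" for n
      using Rep_residues_prod[of x] by simp
    let ?k = "nat (Rep_residues_prod x (p - 1))"
    have "Rep_residues_prod x n = Rep_residues_prod (of_nat ?k * residues_unit p) n" for n
      unfolding rep using *[of n] pos by auto
    then show "x = of_nat ?k * residues_unit p"
      by (metis Rep_residues_prod_inject ext)
  qed
qed (fact assms)

section \<open>Arithmetic of the prime field inside the corner\<close>

context prime_corner
begin

definition F :: "'k set" where "F = {x. x * e = x}"

lemma p_gt_1: "p > 1" using prime_p prime_gt_1_nat by blast

lemma mem_F: "x \<in> F \<longleftrightarrow> x * e = x" by (simp add: F_def)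

lemma F_intros [simp]:
  "0 \<in> F" "e \<in> F"
  "x \<in> F \<Longrightarrow> y \<in> F \<Longrightarrow> x + y \<in> F"
  "x \<in> F \<Longrightarrow> y \<in> F \<Longrightarrow> x - y \<in> F"
  "x \<in> F \<Longrightarrow> - x \<in> F"
  "x \<in> F \<Longrightarrow> z * x \<in> F"
  "x \<in> F \<Longrightarrow> x * z \<in> F"
proof -
  show "x \<in> F \<Longrightarrow> z * x \<in> F" for x z
    by (simp add: F_def mult.assoc)
  then show "x \<in> F \<Longrightarrow> x * z \<in> F" for x z
    by (metis mult.commute)
qed (simp_all add: F_def idem distrib_right left_diff_distrib)

lemma F_e [simp]: "x \<in> F \<Longrightarrow> x * e = x" "x \<in> F \<Longrightarrow> e * x = x"
  by (simp_all add: F_def mult.commute)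

lemma F_sum: "(\<And>i. i \<in> A \<Longrightarrow> f i \<in> F) \<Longrightarrow> sum f A \<in> F"
  by (induction A rule: infinite_finite_induct) auto

lemma F_power: "x \<in> F \<Longrightarrow> i > 0 \<Longrightarrow> x ^ i \<in> F"
  by (cases i) auto

lemma e_power [simp]: "i > 0 \<Longrightarrow> e ^ i = e"
  by (induction i rule: nat_induct_non_zero) (auto simp: idem)

text \<open>A zeroth power is the \<open>1\<close> of the ambient ring, which in general differs
  from \<open>e\<close>; a factor from \<open>F\<close> absorbs the difference. The factors
  \<open>e\<close> and the restrictions to positive exponents further on have the same
  origin.\<close>

lemma e_power_mult [simp]: "x \<in> F \<Longrightarrow> e ^ i * x = x" "x \<in> F \<Longrightarrow> x * e ^ i = x"
  by (cases "i = 0"; simp)+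

lemma e_neq_0 [simp]: "e \<noteq> 0" "0 \<noteq> e"
proof -
  show "e \<noteq> 0"
  proof
    assume "e = 0"
    then have "p dvd 1" by (subst of_nat_e_eq_0[symmetric]) simp
    then show False using p_gt_1 by simp
  qed
  then show "0 \<noteq> e" by simp
qed

lemma F_of_nat: "x \<in> F \<Longrightarrow> \<exists>k. x = of_nat k * e"
  by (rule corner_of_nat) (simp only: mem_F)

lemma of_nat_e_eq_iff: "of_nat k * e = of_nat l * e \<longleftrightarrow> [k = l] (mod p)"
proof (induction k l rule: linorder_wlog)
  case (le l k)
  then have "of_nat k = of_nat (k - l) + (of_nat l :: 'k)" by (metis le_add_diff_inverse2 of_nat_add)
  then have "of_nat l * e = of_nat k * e \<longleftrightarrow> of_nat (k - l) * e = 0"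
    by (simp add: distrib_right)
  also have "\<dots> \<longleftrightarrow> [k = l] (mod p)"
    unfolding of_nat_e_eq_0 using le by (rule cong_altdef_nat[symmetric])
  finally show ?case by (simp add: cong_sym_eq[of l])
next
  case (sym k l)
  show ?case by (subst eq_commute, subst cong_sym_eq, rule sym)
qed

lemma F_eq_image: "F = (\<lambda>k. of_nat k * e) ` {..<p}"
proof (intro equalityI subsetI)
  fix x assume "x \<in> F"
  then obtain k where k: "x = of_nat k * e" using F_of_nat by blast
  have "of_nat k * e = of_nat (k mod p) * e"
    unfolding of_nat_e_eq_iff by (simp add: cong_def)
  moreover have "k mod p \<in> {..<p}" using p_gt_1 by simp
  ultimately show "x \<in> (\<lambda>k. of_nat k * e) ` {..<p}"
    unfolding k by (rule image_eqI)
next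
  fix x assume "x \<in> (\<lambda>k. of_nat k * e) ` {..<p}"
  then obtain k where "x = of_nat k * e" by (rule imageE)
  then show "x \<in> F" by simp
qed

lemma finite_F [simp]: "finite F"
  unfolding F_eq_image by (rule finite_imageI) simp

lemma card_F: "card F = p"
proof -
  have "inj_on (\<lambda>k. of_nat k * e) {..<p}"
    unfolding inj_on_def of_nat_e_eq_iff by (auto intro: cong_less_modulus_unique_nat)
  then show ?thesis unfolding F_eq_image by (simp only: card_image card_lessThan)
qed

lemma F_no_zero_div:
  assumes "x \<in> F" "y \<in> F" "x * y = 0"
  shows "x = 0 \<or> y = 0"
proof -
  obtain k l where kl: "x = of_nat k * e" "y = of_nat l * e"
    using F_of_nat[OF assms(1)] F_of_nat[OF assms(2)] by blast
  have "x * y = of_nat k * of_nat l * (e * e)" unfolding kl by (simp only: ac_simps)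
  then have "of_nat (k * l) * e = 0" using assms(3) by (simp add: idem)
  then have "p dvd k \<or> p dvd l"
    unfolding of_nat_e_eq_0 using prime_dvd_mult_iff prime_p by blast
  then show ?thesis unfolding kl of_nat_e_eq_0 .
qed

lemma F_mult_cancel:
  assumes "x \<in> F" "y \<in> F" "z \<in> F" "z \<noteq> 0" "z * x = z * y"
  shows "x = y"
proof -
  have "z * (x - y) = 0" using assms(5) by (simp add: right_diff_distrib)
  then have "x - y = 0" using F_no_zero_div[of z "x - y"] F_intros(4)[OF assms(1,2)] assms by blast
  then show ?thesis by simp
qed

lemma F_power_neq_0: "x \<in> F \<Longrightarrow> x \<noteq> 0 \<Longrightarrow> x ^ i \<noteq> 0"
proof (induction i)
  case (Suc i)
  then have "i = 0 \<or> x ^ i \<in> F" "x ^ i \<noteq> 0" using F_power by auto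
  with Suc.prems show ?case using F_no_zero_div[of x "x ^ i"] by auto
qed auto

definition Finv :: "'k \<Rightarrow> 'k" where "Finv x = (SOME y. y \<in> F \<and> x * y = e)"

text \<open>Multiplication by a nonzero element is an injective self-map of the finite
  \<open>F\<close>, hence onto, and so it hits \<open>e\<close>.\<close>

lemma Finv:
  assumes "x \<in> F" "x \<noteq> 0"
  shows "Finv x \<in> F" "x * Finv x = e" "Finv x * x = e" "Finv x \<noteq> 0"
proof -
  have "inj_on ((*) x) F"
    using F_mult_cancel[OF _ _ assms] by (blast intro: inj_onI)
  moreover have "(*) x ` F \<subseteq> F" by (intro image_subsetI F_intros)
  ultimately have "(*) x ` F = F"
    by (intro endo_inj_surj finite_F)
  then have "e \<in> (*) x ` F" by simp
  then obtain y where "y \<in> F" "x * y = e" by (metis imageE)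
  then have "Finv x \<in> F \<and> x * Finv x = e"
    unfolding Finv_def by (metis (mono_tags, lifting) someI_ex)
  then show "Finv x \<in> F" "x * Finv x = e" "Finv x * x = e" "Finv x \<noteq> 0"
    by (auto simp: mult.commute)
qed

lemma of_nat_mult_neq_0: "0 < k \<Longrightarrow> k < p \<Longrightarrow> x \<in> F \<Longrightarrow> x \<noteq> 0 \<Longrightarrow> of_nat k * x \<noteq> 0"
  using F_no_zero_div[of "of_nat k * e" x] of_nat_e_eq_0[of k]
  by (auto simp: mult.assoc dest: nat_dvd_not_less)

lemma of_nat_p [simp]: "x \<in> F \<Longrightarrow> of_nat p * x = 0"
proof -
  assume "x \<in> F"
  then have "of_nat p * x = (of_nat p * e) * x" by (simp add: mult.assoc)
  also have "of_nat p * e = 0" unfolding of_nat_e_eq_0 by simp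
  finally show ?thesis by simp
qed

lemma of_nat_e_power: "i > 0 \<Longrightarrow> (of_nat k * e) ^ i = of_nat (k ^ i) * e"
  by (simp add: power_mult_distrib)

text \<open>Frobenius is the identity on a prime field. This makes torus components visible in
  powers whose exponent is a power of \<open>p\<close>.\<close>

lemma fermat_F: "x \<in> F \<Longrightarrow> x ^ (p ^ i) = x"
proof (induction i)
  case (Suc i)
  have "x ^ p = x" if x: "x \<in> F" for x
  proof -
    obtain k where k: "x = of_nat k * e" using F_of_nat[OF x] by blast
    have "[k ^ p = k] (mod p)"
    proof (cases "p dvd k")
      case True
      then have "p dvd k ^ p" by (rule dvd_trans[OF _ dvd_power]) (use p_gt_1 in simp)
      with True have "k ^ p mod p = 0" "k mod p = 0" by (simp_all only: dvd_eq_mod_eq_0)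
      then show ?thesis by (simp only: cong_def)
    next
      case False
      then have "[k ^ (p - 1) = 1] (mod p)"
        using fermat_theorem prime_p by blast
      then have "[k * k ^ (p - 1) = k * 1] (mod p)" by (rule cong_scalar_left)
      then show ?thesis using p_gt_1 by (simp flip: power_Suc)
    qed
    then show ?thesis
      unfolding k using p_gt_1 by (subst of_nat_e_power) (auto simp: of_nat_e_eq_iff simp del: of_nat_power)
  qed
  with Suc show ?case by (simp add: power_mult)
qed auto

lemma primitive_root:
  obtains z where "z \<in> F" "z \<noteq> 0" "\<And>i. 0 < i \<Longrightarrow> i < p - 1 \<Longrightarrow> z ^ i \<noteq> e"
    "\<And>x. x \<in> F \<Longrightarrow> x \<noteq> 0 \<Longrightarrow> \<exists>i>0. x = z ^ i"
proof -
  obtain g where g: "residue_primroot p g"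
    using prime_primitive_root_exists[of p] prime_p p_gt_1 by auto
  then have ordg: "ord p g = p - 1" and cop: "coprime p g"
    using prime_p by (auto simp: residue_primroot_def totient_prime)
  let ?z = "of_nat g * e"
  have "?z \<in> F" by auto
  moreover have "?z \<noteq> 0"
    using cop p_gt_1 by (auto simp: of_nat_e_eq_0)
  moreover have "?z ^ i \<noteq> e" if "0 < i" "i < p - 1" for i
  proof
    assume "?z ^ i = e"
    then have "of_nat (g ^ i) * e = of_nat 1 * e"
      using that by (simp add: of_nat_e_power)
    then have "[g ^ i = 1] (mod p)" by (subst (asm) of_nat_e_eq_iff)
    then have "ord p g dvd i" by (simp only: ord_divides)
    then show False using that ordg nat_dvd_not_less[of i "p - 1"] by simp
  qed
  moreover have "\<exists>i>0. x = ?z ^ i" if x: "x \<in> F" "x \<noteq> 0" for x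
  proof -
    obtain k where k: "x = of_nat k * e" using F_of_nat[OF x(1)] by blast
    have "\<not> p dvd k" using x(2) unfolding k of_nat_e_eq_0 .
    then have "coprime p k" by (rule prime_imp_coprime[OF prime_p])
    then have "coprime (k mod p) p" using p_gt_1 by (simp add: coprime_commute)
    moreover have "k mod p > 0"
      using \<open>\<not> p dvd k\<close> by (simp add: mod_greater_zero_iff_not_dvd)
    moreover have "k mod p \<le> p" using p_gt_1 by (simp add: less_imp_le)
    ultimately have "k mod p \<in> totatives p"
      by (simp add: totatives_def)
    then obtain i where i: "k mod p = g ^ i mod p"
      using bij_betw_imp_surj_on[OF residue_primroot_is_generator[OF p_gt_1 g]] by blast
    \<comment> \<open>The exponent is shifted by a full period to make it positive, since
      \<open>?z ^ 0\<close> would be \<open>1\<close> instead of \<open>e\<close>.\<close>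
    have "[k = g ^ (i + (p - 1))] (mod p)"
    proof -
      have "[g ^ i * g ^ (p - 1) = g ^ i * 1] (mod p)"
        by (rule cong_scalar_left) (use ord[of g p] ordg in simp)
      then show ?thesis using i by (simp add: cong_def power_add)
    qed
    then have "x = ?z ^ (i + (p - 1))"
      unfolding k using p_gt_1 by (subst of_nat_e_power) (auto simp: of_nat_e_eq_iff simp del: of_nat_power)
    then show ?thesis using p_gt_1 by (intro exI[of _ "i + (p - 1)"]) auto
  qed
  ultimately show ?thesis using that by blast
qed

end

section \<open>The group\<close>

text \<open>Both sides evaluate the functional \<open>w\<close> on the expansion of
  \<open>(u + t * (u' + t' * X)) ^ j\<close> in powers of \<open>X\<close>. After exchanging the
  sums, the inner one is the binomial theorem for \<open>u + t * u'\<close>.\<close>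

lemma binomial_substitution:
  fixes u t u' t' :: "'k::comm_ring_1"
  shows "(\<Sum>i\<le>j. of_nat (j choose i) * u ^ (j - i) * t ^ i *
            (\<Sum>k\<le>i. of_nat (i choose k) * u' ^ (i - k) * t' ^ k * w k))
       = (\<Sum>k\<le>j. of_nat (j choose k) * (u + t * u') ^ (j - k) * (t * t') ^ k * w k)"
proof -
  define f where "f i k = of_nat (j choose i) * u ^ (j - i) * t ^ i *
    (of_nat (i choose k) * u' ^ (i - k) * t' ^ k * w k)" for i k
  have inner: "(\<Sum>i\<in>{i. i \<in> {..j} \<and> k \<le> i}. f i k) =
      of_nat (j choose k) * (u + t * u') ^ (j - k) * (t * t') ^ k * w k" if k: "k \<le> j" for k
  proof -
    have "(\<Sum>i\<in>{i. i \<in> {..j} \<and> k \<le> i}. f i k) = (\<Sum>l\<le>j - k. f (l + k) k)"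
      using k by (intro sum.reindex_bij_witness[of _ "\<lambda>l. l + k" "\<lambda>i. i - k"]) auto
    also have "\<dots> = (\<Sum>l\<le>j - k. of_nat (j choose k) * (t * t') ^ k * w k *
        (of_nat ((j - k) choose l) * (t * u') ^ l * u ^ (j - k - l)))"
    proof (rule sum.cong)
      fix l assume "l \<in> {..j - k}"
      then have l: "l + k \<le> j" using k by auto
      have c: "of_nat (j choose (l + k)) * of_nat ((l + k) choose k) =
          (of_nat (j choose k) * of_nat ((j - k) choose l) :: 'k)"
        using choose_mult[of k "l + k" j] l by (simp flip: of_nat_mult)
      have "f (l + k) k = (of_nat (j choose (l + k)) * of_nat ((l + k) choose k)) *
          (u ^ (j - (l + k)) * t ^ l * t ^ k * u' ^ l * t' ^ k * w k)"
        by (simp add: f_def power_add mult_ac)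
      also have "j - (l + k) = j - k - l" by simp
      finally show "f (l + k) k = of_nat (j choose k) * (t * t') ^ k * w k *
        (of_nat ((j - k) choose l) * (t * u') ^ l * u ^ (j - k - l))"
        unfolding c by (simp add: power_mult_distrib mult_ac)
    qed simp
    also have "\<dots> = of_nat (j choose k) * (t * t') ^ k * w k * (t * u' + u) ^ (j - k)"
      by (simp add: binomial_ring sum_distrib_left)
    finally show ?thesis by (simp add: mult_ac add.commute)
  qed
  have "(\<Sum>i\<le>j. of_nat (j choose i) * u ^ (j - i) * t ^ i *
            (\<Sum>k\<le>i. of_nat (i choose k) * u' ^ (i - k) * t' ^ k * w k))
      = (\<Sum>i\<le>j. sum (f i) {k. k \<in> {..j} \<and> k \<le> i})"
    unfolding f_def sum_distrib_left by (intro sum.cong) auto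
  also have "\<dots> = (\<Sum>k\<le>j. \<Sum>i\<in>{i. i \<in> {..j} \<and> k \<le> i}. f i k)"
    by (rule sum.swap_restrict) auto
  also have "\<dots> = (\<Sum>k\<le>j. of_nat (j choose k) * (u + t * u') ^ (j - k) * (t * t') ^ k * w k)"
    by (rule sum.cong) (use inner in auto)
  finally show ?thesis .
qed

text \<open>The \<open>|G|\<close> colours just fit into the range from 2 to \<open>|G| + 1\<close>.
  The lower bound gives every chain a second vector. With the upper bound, the condition on
  \<open>p\<close> leaves room for exponents up to one more than a chain length below
  \<open>p - 1\<close>, which makes the corresponding powers of a primitive root nontrivial.\<close>

locale coloured_group = prime_corner e p + G: group G
  for e :: "'k::comm_ring_1" and p :: nat and G :: "('a, 'b) monoid_scheme" (structure) +
  fixes c :: "'a \<Rightarrow> nat"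
  assumes fin_G: "finite (carrier G)"
    and c_inj: "inj_on c (carrier G)"
    and c_ge_2: "x \<in> carrier G \<Longrightarrow> 2 \<le> c x"
    and c_le: "x \<in> carrier G \<Longrightarrow> c x \<le> Suc (card (carrier G))"
    and p_large: "p > card (carrier G) + 4"
begin

abbreviation C where "C \<equiv> carrier G"

text \<open>The length of the chain of x_g on y_h. As \<open>c\<close> is injective on
  \<open>C\<close>, it encodes the full invariant of the pair under left translation.\<close>

definition m :: "'a \<Rightarrow> 'a \<Rightarrow> nat" where "m g h = c (inv g \<otimes> h)"

text \<open>For every \<open>g\<close>, the index \<open>(h, g, 0)\<close> stands for the same basis vector \<open>y\<^sub>h\<close>; hence the last condition.\<close>
definition Wc :: "('a \<times> 'a \<times> nat \<Rightarrow> 'k) set" where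
  "Wc = {w. (\<forall>i. w i \<in> F) \<and> (\<forall>h g j. w (h, g, j) \<noteq> 0 \<longrightarrow> h \<in> C \<and> g \<in> C \<and> j \<le> m g h) \<and>
            (\<forall>h. \<forall>g\<in>C. w (h, g, 0) = w (h, \<one>, 0))}"

definition Uc :: "('a \<Rightarrow> 'k) set" where
  "Uc = {u. \<forall>g. u g \<in> F \<and> (u g \<noteq> 0 \<longrightarrow> g \<in> C)}"

text \<open>The padding outside \<open>C\<close> is \<open>e\<close> because \<open>e\<close> is the
  unit of \<open>F\<close>; it makes torus elements comparable as plain functions.\<close>

definition Tc :: "('a \<Rightarrow> 'k) set" where
  "Tc = {t. \<forall>g. t g \<in> F \<and> t g \<noteq> 0 \<and> (g \<notin> C \<longrightarrow> t g = e)}"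

text \<open>Reading \<open>w (h, g, j)\<close> as the value at \<open>X\<^sup>j\<close> of a functional on polynomials in \<open>X = X\<^sub>g\<close>,
  this is the action by the substitution \<open>X\<^sub>g \<mapsto> u\<^sub>g + t\<^sub>g X\<^sub>g\<close>, scaled by \<open>s\<^sub>h\<close>.\<close>
definition act :: "('a \<Rightarrow> 'k) \<Rightarrow> ('a \<Rightarrow> 'k) \<Rightarrow> ('a \<Rightarrow> 'k) \<Rightarrow> ('a \<times> 'a \<times> nat \<Rightarrow> 'k) \<Rightarrow> 'a \<times> 'a \<times> nat \<Rightarrow> 'k" where
  "act u t s w = (\<lambda>(h, g, j). if j \<le> m g h then
     s h * (\<Sum>i\<le>j. of_nat (j choose i) * u g ^ (j - i) * t g ^ i * w (h, g, i)) else 0)"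

text \<open>The tuple \<open>(w, u, t, s)\<close> stands for the affine map
  \<open>v \<mapsto> w + act u t s v\<close> and the product for composition; the parts
  \<open>u\<close> and \<open>t\<close> compose like the substitutions
  \<open>X \<mapsto> u + t X\<close>.\<close>

definition N :: "(('a \<times> 'a \<times> nat \<Rightarrow> 'k) \<times> ('a \<Rightarrow> 'k) \<times> ('a \<Rightarrow> 'k) \<times> ('a \<Rightarrow> 'k)) monoid" where
  "N = \<lparr>carrier = Wc \<times> Uc \<times> Tc \<times> Tc,
        monoid.mult = \<lambda>(w, u, t, s) (w', u', t', s').
          (\<lambda>i. w i + act u t s w' i, \<lambda>g. u g + t g * u' g, \<lambda>g. t g * t' g, \<lambda>h. s h * s' h),
        one = (\<lambda>_. 0, \<lambda>_. 0, \<lambda>_. e, \<lambda>_. e)\<rparr>"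

lemma WcD:
  assumes "w \<in> Wc"
  shows "w i \<in> F" "w (h, g, j) \<noteq> 0 \<Longrightarrow> h \<in> C \<and> g \<in> C \<and> j \<le> m g h"
    "g \<in> C \<Longrightarrow> w (h, g, 0) = w (h, \<one>, 0)"
  using assms unfolding Wc_def by blast+

lemma WcI:
  assumes "\<And>i. w i \<in> F" "\<And>h g j. w (h, g, j) \<noteq> 0 \<Longrightarrow> h \<in> C \<and> g \<in> C \<and> j \<le> m g h"
    "\<And>h g. g \<in> C \<Longrightarrow> w (h, g, 0) = w (h, \<one>, 0)"
  shows "w \<in> Wc"
  using assms unfolding Wc_def by blast

lemma UcD: "u \<in> Uc \<Longrightarrow> u g \<in> F" "u \<in> Uc \<Longrightarrow> g \<notin> C \<Longrightarrow> u g = 0"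
  unfolding Uc_def by blast+

lemma UcI: "(\<And>g. u g \<in> F) \<Longrightarrow> (\<And>g. g \<notin> C \<Longrightarrow> u g = 0) \<Longrightarrow> u \<in> Uc"
  unfolding Uc_def by blast

lemma TcD: "t \<in> Tc \<Longrightarrow> t g \<in> F" "t \<in> Tc \<Longrightarrow> t g \<noteq> 0" "t \<in> Tc \<Longrightarrow> g \<notin> C \<Longrightarrow> t g = e"
  unfolding Tc_def by blast+

lemma TcI: "(\<And>g. t g \<in> F) \<Longrightarrow> (\<And>g. t g \<noteq> 0) \<Longrightarrow> (\<And>g. g \<notin> C \<Longrightarrow> t g = e) \<Longrightarrow> t \<in> Tc"
  unfolding Tc_def by blast

lemma m_ge_2: "g \<in> C \<Longrightarrow> h \<in> C \<Longrightarrow> 2 \<le> m g h"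
  unfolding m_def by (intro c_ge_2) auto

lemma m_less_p: "g \<in> C \<Longrightarrow> h \<in> C \<Longrightarrow> m g h + 3 < p"
  using c_le[of "inv g \<otimes> h"] p_large unfolding m_def by auto

lemma Wc_zero [simp]: "(\<lambda>_. 0) \<in> Wc" by (rule WcI) auto
lemma Uc_zero [simp]: "(\<lambda>_. 0) \<in> Uc" by (rule UcI) auto
lemma Tc_one [simp]: "(\<lambda>_. e) \<in> Tc" by (rule TcI) auto

lemma Wc_add [simp]: "w \<in> Wc \<Longrightarrow> w' \<in> Wc \<Longrightarrow> (\<lambda>i. w i + w' i) \<in> Wc"
proof (rule WcI)
  fix h g j assume *: "w \<in> Wc" "w' \<in> Wc" "w (h, g, j) + w' (h, g, j) \<noteq> 0"
  then have "w (h, g, j) \<noteq> 0 \<or> w' (h, g, j) \<noteq> 0" by auto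
  then show "h \<in> C \<and> g \<in> C \<and> j \<le> m g h" using WcD(2)[OF *(1)] WcD(2)[OF *(2)] by blast
next
  fix h g assume "w \<in> Wc" "w' \<in> Wc" "g \<in> C"
  then show "w (h, g, 0) + w' (h, g, 0) = w (h, \<one>, 0) + w' (h, \<one>, 0)"
    using WcD(3)[of w g h] WcD(3)[of w' g h] by simp
qed (simp_all add: WcD(1))

lemma Wc_scale [simp]:
  assumes "w \<in> Wc" shows "(\<lambda>i. a * w i) \<in> Wc"
proof (rule WcI)
  fix h g j assume "a * w (h, g, j) \<noteq> 0"
  then have "w (h, g, j) \<noteq> 0" by auto
  then show "h \<in> C \<and> g \<in> C \<and> j \<le> m g h" using WcD(2)[OF assms] by blast
next
  fix h g assume "g \<in> C"
  then show "a * w (h, g, 0) = a * w (h, \<one>, 0)"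
    using WcD(3)[OF assms, of g h] by simp
qed (simp add: WcD(1)[OF assms])

lemma Uc_add [simp]: "u \<in> Uc \<Longrightarrow> u' \<in> Uc \<Longrightarrow> (\<lambda>g. u g + a g * u' g) \<in> Uc"
  by (rule UcI) (simp_all add: UcD)

lemma Tc_mult [simp]: "t \<in> Tc \<Longrightarrow> t' \<in> Tc \<Longrightarrow> (\<lambda>g. t g * t' g) \<in> Tc"
  using F_no_zero_div[of "t _" "t' _"] by (intro TcI) (auto simp: TcD idem)

lemma Tc_Finv [simp]: "t \<in> Tc \<Longrightarrow> (\<lambda>g. Finv (t g)) \<in> Tc"
proof (rule TcI)
  assume t: "t \<in> Tc"
  then show "Finv (t g) \<in> F" "Finv (t g) \<noteq> 0" for g using Finv TcD by blast+
  fix g assume "g \<notin> C"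
  with t have "t g = e" by (simp add: TcD)
  moreover have "e * Finv e = e" "Finv e \<in> F" using Finv[of e] by simp_all
  ultimately show "Finv (t g) = e" by simp
qed

lemma Uc_mult [simp]: "u \<in> Uc \<Longrightarrow> (\<lambda>g. a g * u g) \<in> Uc"
  by (rule UcI) (simp_all add: UcD)

lemma Uc_uminus [simp]: "u \<in> Uc \<Longrightarrow> (\<lambda>g. - u g) \<in> Uc"
  by (rule UcI) (simp_all add: UcD)

lemma Wc_uminus [simp]: "w \<in> Wc \<Longrightarrow> (\<lambda>i. - w i) \<in> Wc"
  using Wc_scale[of w "-1"] by simp

lemma act_apply: "act u t s w (h, g, j) = (if j \<le> m g h then
     s h * (\<Sum>i\<le>j. of_nat (j choose i) * u g ^ (j - i) * t g ^ i * w (h, g, i)) else 0)"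
  by (simp add: act_def)

lemma act_Wc [simp]:
  assumes "w \<in> Wc" shows "act u t s w \<in> Wc"
proof (rule WcI)
  fix i show "act u t s w i \<in> F"
    by (cases i) (simp add: act_apply F_sum WcD(1)[OF assms])
next
  fix h g j assume nz: "act u t s w (h, g, j) \<noteq> 0"
  then have j: "j \<le> m g h" by (auto simp: act_apply split: if_splits)
  have "\<exists>i. w (h, g, i) \<noteq> 0"
  proof (rule ccontr)
    assume "\<not> ?thesis"
    then have "act u t s w (h, g, j) = 0" by (simp add: act_apply)
    with nz show False by simp
  qed
  with j show "h \<in> C \<and> g \<in> C \<and> j \<le> m g h" using WcD(2)[OF assms] by blast
next
  fix h g assume "g \<in> C"
  then show "act u t s w (h, g, 0) = act u t s w (h, \<one>, 0)"
    using WcD(3)[OF assms, of g h] by (simp add: act_apply)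
qed

lemma act_add: "act u t s (\<lambda>i. w i + w' i) = (\<lambda>i. act u t s w i + act u t s w' i)"
  by (auto simp: act_def fun_eq_iff distrib_left sum.distrib)

lemma act_scale: "act u t s (\<lambda>i. a * w i) = (\<lambda>i. a * act u t s w i)"
  by (auto simp: act_def fun_eq_iff sum_distrib_left mult_ac intro!: sum.cong)

lemma act_zero [simp]: "act u t s (\<lambda>_. 0) = (\<lambda>_. 0)"
  by (auto simp: act_def fun_eq_iff)

lemma act_act: "act u t s (act u' t' s' w) =
  act (\<lambda>g. u g + t g * u' g) (\<lambda>g. t g * t' g) (\<lambda>h. s h * s' h) w"
proof (rule ext)
  fix i :: "'a \<times> 'a \<times> nat"
  obtain h g j where i: "i = (h, g, j)" by (cases i)
  show "act u t s (act u' t' s' w) i = act (\<lambda>g. u g + t g * u' g) (\<lambda>g. t g * t' g) (\<lambda>h. s h * s' h) w i"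
  proof (cases "j \<le> m g h")
    case True
    have "act u t s (act u' t' s' w) i = s h * (\<Sum>i\<le>j. of_nat (j choose i) * u g ^ (j - i) * t g ^ i *
        (s' h * (\<Sum>k\<le>i. of_nat (i choose k) * u' g ^ (i - k) * t' g ^ k * w (h, g, k))))"
      unfolding i using True by (simp add: act_apply)
    also have "\<dots> = s h * s' h * (\<Sum>i\<le>j. of_nat (j choose i) * u g ^ (j - i) * t g ^ i *
        (\<Sum>k\<le>i. of_nat (i choose k) * u' g ^ (i - k) * t' g ^ k * w (h, g, k)))"
      unfolding sum_distrib_left mult.assoc by (simp only: mult.left_commute)
    also have "\<dots> = act (\<lambda>g. u g + t g * u' g) (\<lambda>g. t g * t' g) (\<lambda>h. s h * s' h) w i"
      unfolding i using True by (simp add: act_apply binomial_substitution)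
    finally show ?thesis .
  qed (simp add: i act_apply)
qed

text \<open>For \<open>u = 0\<close> only the top binomial term \<open>i = j\<close> survives. So
  the index \<open>(h, g, j)\<close> carries the weight \<open>s h * t g ^ j\<close>, on which the
  whole analysis of automorphisms rests.\<close>

lemma act_torus:
  assumes "w \<in> Wc"
  shows "act (\<lambda>_. 0) t s w (h, g, j) = s h * t g ^ j * w (h, g, j)"
proof (cases "j \<le> m g h")
  case True
  have "(\<Sum>i\<le>j. of_nat (j choose i) * 0 ^ (j - i) * t g ^ i * w (h, g, i))
      = (\<Sum>i\<le>j. if i = j then t g ^ j * w (h, g, j) else 0)"
    by (rule sum.cong) (auto simp: power_0_left)
  then show ?thesis using True by (simp add: act_apply mult.assoc)
next
  case False
  then have "w (h, g, j) = 0" using WcD(2)[OF assms] by blast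
  with False show ?thesis by (simp add: act_apply)
qed

lemma act_one [simp]: "w \<in> Wc \<Longrightarrow> act (\<lambda>_. 0) (\<lambda>_. e) (\<lambda>_. e) w = w"
  by (rule ext, clarify) (simp add: act_torus WcD(1) mult.assoc)

lemma carrier_N: "carrier N = Wc \<times> Uc \<times> Tc \<times> Tc" by (simp add: N_def)

lemma mem_N [simp]: "(w, u, t, s) \<in> carrier N \<longleftrightarrow> w \<in> Wc \<and> u \<in> Uc \<and> t \<in> Tc \<and> s \<in> Tc"
  by (simp add: N_def)

lemma one_N: "\<one>\<^bsub>N\<^esub> = (\<lambda>_. 0, \<lambda>_. 0, \<lambda>_. e, \<lambda>_. e)" by (simp add: N_def)

abbreviation mult_in_N (infixl "\<bullet>" 70) where "x \<bullet> y \<equiv> x \<otimes>\<^bsub>N\<^esub> y"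

lemma mult_N [simp]: "(w, u, t, s) \<bullet> (w', u', t', s') =
  (\<lambda>i. w i + act u t s w' i, \<lambda>g. u g + t g * u' g, \<lambda>g. t g * t' g, \<lambda>h. s h * s' h)"
  by (simp add: N_def)

lemma group_N: "group N"
proof (rule groupI)
  fix x y assume "x \<in> carrier N" "y \<in> carrier N"
  then show "x \<bullet> y \<in> carrier N"
    by (cases x; cases y) (simp add: F_intros)
next
  show "\<one>\<^bsub>N\<^esub> \<in> carrier N" by (simp add: one_N)
next
  fix x y z assume "x \<in> carrier N" "y \<in> carrier N" "z \<in> carrier N"
  then show "x \<bullet> y \<bullet> z = x \<bullet> (y \<bullet> z)"
    by (cases x; cases y; cases z) (simp add: act_add act_act fun_eq_iff algebra_simps)
next
  fix x assume "x \<in> carrier N"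
  then show "\<one>\<^bsub>N\<^esub> \<bullet> x = x"
    by (cases x) (simp add: one_N UcD TcD)
next
  fix x assume x: "x \<in> carrier N"
  obtain w u t s where xe: "x = (w, u, t, s)" by (cases x)
  have mem: "w \<in> Wc" "u \<in> Uc" "t \<in> Tc" "s \<in> Tc" using x unfolding xe by auto
  \<comment> \<open>Inverse of an affine map: the substitution \<open>X \<mapsto> u + t X\<close> is
    undone by \<open>X \<mapsto> (X - u) / t\<close>, and the translation part becomes the negative
    of the transformed \<open>w\<close>.\<close>
  define t' where "t' g = Finv (t g)" for g
  define s' where "s' g = Finv (s g)" for g
  define u' where "u' g = - (t' g * u g)" for g
  define w' where "w' i = - act u' t' s' w i" for i
  have "t' \<in> Tc" "s' \<in> Tc" unfolding t'_def s'_def using mem by simp_all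
  moreover have "u' \<in> Uc" unfolding u'_def using mem by simp
  moreover have "w' \<in> Wc" unfolding w'_def using mem by simp
  moreover have "t' g * t g = e" "s' g * s g = e" for g
    unfolding t'_def s'_def using mem Finv TcD by auto
  ultimately have "(w', u', t', s') \<in> carrier N" "(w', u', t', s') \<bullet> x = \<one>\<^bsub>N\<^esub>"
    unfolding xe by (simp_all add: one_N w'_def u'_def)
  then show "\<exists>y\<in>carrier N. y \<bullet> x = \<one>\<^bsub>N\<^esub>" by blast
qed

sublocale N: group N by (rule group_N)

lemma finite_Uc: "finite Uc"
proof (rule finite_subset)
  show "Uc \<subseteq> {f. \<forall>x. (x \<in> C \<longrightarrow> f x \<in> F) \<and> (x \<notin> C \<longrightarrow> f x = 0)}"
    using UcD by blast
qed (rule finite_set_of_finite_funs[OF fin_G finite_F])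

lemma finite_Tc: "finite Tc"
proof (rule finite_subset)
  show "Tc \<subseteq> {f. \<forall>x. (x \<in> C \<longrightarrow> f x \<in> F) \<and> (x \<notin> C \<longrightarrow> f x = e)}"
    using TcD by blast
qed (rule finite_set_of_finite_funs[OF fin_G finite_F])

lemma finite_Wc: "finite Wc"
proof (rule finite_subset)
  let ?I = "C \<times> C \<times> {..<p}"
  have "w i = 0" if "w \<in> Wc" "i \<notin> ?I" for w i
  proof (rule ccontr)
    assume nz: "w i \<noteq> 0"
    obtain h g j where i: "i = (h, g, j)" by (cases i)
    have "h \<in> C" "g \<in> C" "j \<le> m g h" using WcD(2)[OF that(1)] nz unfolding i by blast+
    moreover from this have "j < p" using m_less_p[of g h] by linarith
    ultimately show False using that(2) unfolding i by blast
  qed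
  then show "Wc \<subseteq> {f. \<forall>x. (x \<in> ?I \<longrightarrow> f x \<in> F) \<and> (x \<notin> ?I \<longrightarrow> f x = 0)}"
    using WcD(1) by blast
qed (rule finite_set_of_finite_funs[OF _ finite_F], use fin_G in auto)

lemma finite_N: "finite (carrier N)"
  unfolding carrier_N using finite_Wc finite_Uc finite_Tc by blast

section \<open>Embeddings of W, U and T and their basis vectors\<close>

abbreviation zeros :: "'i \<Rightarrow> 'k" where "zeros \<equiv> (\<lambda>_. 0)"
abbreviation ones :: "'i \<Rightarrow> 'k" where "ones \<equiv> (\<lambda>_. e)"

definition iW :: "('a \<times> 'a \<times> nat \<Rightarrow> 'k) \<Rightarrow> _" where "iW w = (w, zeros :: 'a \<Rightarrow> 'k, ones :: 'a \<Rightarrow> 'k, ones :: 'a \<Rightarrow> 'k)"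
definition iU :: "('a \<Rightarrow> 'k) \<Rightarrow> _" where "iU u = (zeros :: 'a \<times> 'a \<times> nat \<Rightarrow> 'k, u, ones :: 'a \<Rightarrow> 'k, ones :: 'a \<Rightarrow> 'k)"
definition iT :: "('a \<Rightarrow> 'k) \<Rightarrow> ('a \<Rightarrow> 'k) \<Rightarrow> _" where "iT t s = (zeros :: 'a \<times> 'a \<times> nat \<Rightarrow> 'k, zeros :: 'a \<Rightarrow> 'k, t, s)"

definition unit_vec :: "'a \<Rightarrow> 'k \<Rightarrow> 'a \<Rightarrow> 'k" where
  "unit_vec g a = (\<lambda>g'. if g' = g then a else 0)"

text \<open>For \<open>j = 0\<close> the entry is repeated for all \<open>g' \<in> C\<close>,
  because the indices \<open>(h, g', 0)\<close> stand for one and the same vector y_h.\<close>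

definition basis_vec :: "'a \<Rightarrow> 'a \<Rightarrow> nat \<Rightarrow> 'k \<Rightarrow> 'a \<times> 'a \<times> nat \<Rightarrow> 'k" where
  "basis_vec h g j a = (\<lambda>(h', g', j'). if h' = h \<and> j' = j \<and> (g' = g \<or> j = 0 \<and> g' \<in> C) then a else 0)"

definition at_coord :: "'a \<Rightarrow> 'k \<Rightarrow> 'a \<Rightarrow> 'k" where
  "at_coord g a = (\<lambda>g'. if g' = g then a else e)"

definition const_on :: "'k \<Rightarrow> 'a \<Rightarrow> 'k" where
  "const_on a = (\<lambda>g. if g \<in> C then a else e)"

lemma iW_in [simp]: "iW w \<in> carrier N \<longleftrightarrow> w \<in> Wc" by (simp add: iW_def)
lemma iU_in [simp]: "iU u \<in> carrier N \<longleftrightarrow> u \<in> Uc" by (simp add: iU_def)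
lemma iT_in [simp]: "iT t s \<in> carrier N \<longleftrightarrow> t \<in> Tc \<and> s \<in> Tc" by (simp add: iT_def)

lemma iW_eq [simp]: "iW w = iW w' \<longleftrightarrow> w = w'" by (simp add: iW_def)
lemma iU_eq [simp]: "iU u = iU u' \<longleftrightarrow> u = u'" by (simp add: iU_def)
lemma iT_eq [simp]: "iT t s = iT t' s' \<longleftrightarrow> t = t' \<and> s = s'" by (simp add: iT_def)

lemma iW_zero: "iW zeros = \<one>\<^bsub>N\<^esub>" by (simp add: iW_def one_N)
lemma iU_zero: "iU zeros = \<one>\<^bsub>N\<^esub>" by (simp add: iU_def one_N)

lemma unit_vec_in [simp]: "g \<in> C \<Longrightarrow> a \<in> F \<Longrightarrow> unit_vec g a \<in> Uc"
  by (rule UcI) (auto simp: unit_vec_def)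

lemma basis_vec_in [simp]:
  assumes "h \<in> C" "g \<in> C" "j \<le> m g h" "a \<in> F"
  shows "basis_vec h g j a \<in> Wc"
  by (rule WcI) (use assms in \<open>auto simp: basis_vec_def split: if_splits prod.splits\<close>)

lemma at_coord_in [simp]: "g \<in> C \<Longrightarrow> a \<in> F \<Longrightarrow> a \<noteq> 0 \<Longrightarrow> at_coord g a \<in> Tc"
  by (rule TcI) (auto simp: at_coord_def)

lemma const_on_in [simp]: "a \<in> F \<Longrightarrow> a \<noteq> 0 \<Longrightarrow> const_on a \<in> Tc"
  by (rule TcI) (auto simp: const_on_def)

lemma basis_vec_apply: "basis_vec h g j a (h, g, j) = a"
  by (simp add: basis_vec_def)

lemma unit_vec_scale: "(\<lambda>g'. a * unit_vec g b g') = unit_vec g (a * b)"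
  by (auto simp: unit_vec_def fun_eq_iff)

lemma basis_vec_scale: "(\<lambda>i. a * basis_vec h g j b i) = basis_vec h g j (a * b)"
  by (auto simp: basis_vec_def fun_eq_iff)

lemma iT_iW:
  assumes "w \<in> Wc" "t \<in> Tc" "s \<in> Tc"
  shows "iT t s \<bullet> iW w = iW (act zeros t s w) \<bullet> iT t s"
  using assms by (simp add: iT_def iW_def fun_eq_iff TcD)

lemma iT_iU:
  assumes "u \<in> Uc" "t \<in> Tc" "s \<in> Tc"
  shows "iT t s \<bullet> iU u = iU (\<lambda>g. t g * u g) \<bullet> iT t s"
  using assms by (simp add: iT_def iU_def fun_eq_iff TcD)

lemma iT_mult: "iT t s \<bullet> iT t' s' = iT (\<lambda>g. t g * t' g) (\<lambda>g. s g * s' g)"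
  by (simp add: iT_def)

lemma iT_commute: "iT t s \<bullet> iT t' s' = iT t' s' \<bullet> iT t s"
  by (simp add: iT_mult mult.commute)

lemma iW_mult: "w' \<in> Wc \<Longrightarrow> iW w \<bullet> iW w' = iW (\<lambda>i. w i + w' i)"
  by (simp add: iW_def fun_eq_iff idem)

lemma iU_mult: "u' \<in> Uc \<Longrightarrow> iU u \<bullet> iU u' = iU (\<lambda>g. u g + u' g)"
  by (simp add: iU_def fun_eq_iff idem UcD)

lemma decompose:
  assumes "(w, u, t, s) \<in> carrier N"
  shows "(w, u, t, s) = iW w \<bullet> (iU u \<bullet> iT t s)"
  using assms by (simp add: iW_def iU_def iT_def fun_eq_iff UcD TcD idem)

lemma act_basis_vec:
  assumes "h \<in> C" "g \<in> C" "j \<le> m g h" "a \<in> F"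
  shows "act zeros t s (basis_vec h g j a) = basis_vec h g j (s h * t g ^ j * a)"
  by (rule ext, clarify, simp only: act_torus[OF basis_vec_in[OF assms]]) (auto simp: basis_vec_def)

section \<open>Powers and the p-part V\<close>

lemma pow_iW: "w \<in> Wc \<Longrightarrow> iW w [^]\<^bsub>N\<^esub> k = iW (\<lambda>i. of_nat k * w i)" for k :: nat
proof (induction k)
  case (Suc k)
  then show ?case by (simp add: iW_mult distrib_right add.commute)
qed (simp add: iW_zero)

lemma pow_iU: "u \<in> Uc \<Longrightarrow> iU u [^]\<^bsub>N\<^esub> k = iU (\<lambda>i. of_nat k * u i)" for k :: nat
proof (induction k)
  case (Suc k)
  then show ?case by (simp add: iU_mult distrib_right add.commute)
qed (simp add: iU_zero)

text \<open>Modulo W the torus-free elements form the vector space U, so the \<open>u\<close>-part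
  of a power is a multiple; the \<open>w\<close>-part is only recorded to stay in
  \<open>Wc\<close>.\<close>

lemma pow_unipotent:
  fixes k :: nat
  assumes "w \<in> Wc" "u \<in> Uc"
  shows "\<exists>w'\<in>Wc. (w, u, ones, ones) [^]\<^bsub>N\<^esub> k = (w', \<lambda>g. of_nat k * u g, ones, ones)"
proof (induction k)
  case 0
  then show ?case by (auto simp: one_N)
next
  case (Suc k)
  then obtain w' where w': "w' \<in> Wc" "(w, u, ones, ones) [^]\<^bsub>N\<^esub> k = (w', \<lambda>g. of_nat k * u g, ones, ones)"
    by blast
  have "(w, u, ones, ones) [^]\<^bsub>N\<^esub> Suc k =
      (\<lambda>i. w' i + act (\<lambda>g. of_nat k * u g) ones ones w i, \<lambda>g. of_nat (Suc k) * u g, ones, ones)"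
    using w' assms by (simp add: fun_eq_iff UcD idem distrib_right add.commute)
  moreover have "(\<lambda>i. w' i + act (\<lambda>g. of_nat k * u g) ones ones w i) \<in> Wc"
    using w' assms by simp
  ultimately show ?case by blast
qed

lemma pow_torus_part:
  fixes k :: nat
  assumes "(w, u, t, s) \<in> carrier N" "k > 0"
  shows "\<exists>w' u'. (w, u, t, s) [^]\<^bsub>N\<^esub> k = (w', u', \<lambda>g. t g ^ k, \<lambda>g. s g ^ k)"
  using assms(2)
proof (induction k rule: nat_induct_non_zero)
  case 1
  have "(w, u, t, s) [^]\<^bsub>N\<^esub> (1::nat) = (w, u, t, s)"
    using assms(1) by (rule N.nat_pow_eone)
  then show ?case by simp
next
  case (Suc k)
  then obtain w' u' where "(w, u, t, s) [^]\<^bsub>N\<^esub> k = (w', u', \<lambda>g. t g ^ k, \<lambda>g. s g ^ k)"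
    by blast
  then show ?case by (simp add: mult.commute)
qed

definition V where "V = Wc \<times> Uc \<times> {ones} \<times> {ones :: 'a \<Rightarrow> 'k}"

lemma V_subset: "V \<subseteq> carrier N" by (auto simp: V_def carrier_N)

lemma mem_V [simp]: "(w, u, t, s) \<in> V \<longleftrightarrow> w \<in> Wc \<and> u \<in> Uc \<and> t = ones \<and> s = ones"
  by (auto simp: V_def)

text \<open>The exponent 2 reflects two layers: a \<open>p\<close>-th power of an element of
  \<open>V\<close> lies in W, and W has exponent \<open>p\<close>. Conversely the torus components
  of a power are the powers of the components, which \<open>fermat_F\<close> identifies with the
  components themselves.\<close>

lemma V_iff_pow: "x \<in> carrier N \<Longrightarrow> x \<in> V \<longleftrightarrow> x [^]\<^bsub>N\<^esub> (p ^ 2) = \<one>\<^bsub>N\<^esub>"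
proof -
  assume x: "x \<in> carrier N"
  obtain w u t s where xe: "x = (w, u, t, s)" by (cases x)
  show ?thesis
  proof
    assume "x \<in> V"
    then have ts: "t = ones" "s = ones" and mem: "w \<in> Wc" "u \<in> Uc" unfolding xe by auto
    obtain w' where w': "w' \<in> Wc" "x [^]\<^bsub>N\<^esub> p = (w', \<lambda>g. of_nat p * u g, ones, ones)"
      using pow_unipotent[OF mem, of p] unfolding xe ts by blast
    then have "x [^]\<^bsub>N\<^esub> p = iW w'" using mem by (simp add: iW_def UcD)
    then have "x [^]\<^bsub>N\<^esub> (p ^ 2) = iW w' [^]\<^bsub>N\<^esub> p"
      using x by (metis N.nat_pow_pow power2_eq_square)
    also have "\<dots> = \<one>\<^bsub>N\<^esub>" using w'(1) by (simp add: pow_iW WcD(1) iW_zero)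
    finally show "x [^]\<^bsub>N\<^esub> (p ^ 2) = \<one>\<^bsub>N\<^esub>" .
  next
    assume "x [^]\<^bsub>N\<^esub> (p ^ 2) = \<one>\<^bsub>N\<^esub>"
    moreover have "p ^ 2 > 0" using p_gt_1 by simp
    ultimately have "t g ^ (p ^ 2) = e" "s g ^ (p ^ 2) = e" for g
      using pow_torus_part[of w u t s "p ^ 2"] x unfolding xe one_N by (auto simp: fun_eq_iff)
    moreover have "t g \<in> F" "s g \<in> F" for g using x unfolding xe by (auto simp: TcD)
    ultimately have "t g = e" "s g = e" for g by (metis fermat_F)+
    then show "x \<in> V" using x unfolding xe by (auto simp: fun_eq_iff)
  qed
qed

section \<open>A regular torus element and the centre\<close>

lemma F_fixed_point: "z \<in> F \<Longrightarrow> w \<in> F \<Longrightarrow> z \<noteq> e \<Longrightarrow> z * w = w \<Longrightarrow> w = 0"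
  using F_no_zero_div[of "z - e" w] by (simp add: left_diff_distrib)

definition zeta :: 'k where
  "zeta = (SOME z. z \<in> F \<and> z \<noteq> 0 \<and> (\<forall>i. 0 < i \<longrightarrow> i < p - 1 \<longrightarrow> z ^ i \<noteq> e) \<and>
    (\<forall>x. x \<in> F \<longrightarrow> x \<noteq> 0 \<longrightarrow> (\<exists>i>0. x = z ^ i)))"

lemma zeta:
  shows "zeta \<in> F" "zeta \<noteq> 0" "0 < i \<Longrightarrow> i < p - 1 \<Longrightarrow> zeta ^ i \<noteq> e"
    "x \<in> F \<Longrightarrow> x \<noteq> 0 \<Longrightarrow> \<exists>i>0. x = zeta ^ i"
proof -
  have "\<exists>z. z \<in> F \<and> z \<noteq> 0 \<and> (\<forall>i. 0 < i \<longrightarrow> i < p - 1 \<longrightarrow> z ^ i \<noteq> e) \<and>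
    (\<forall>x. x \<in> F \<longrightarrow> x \<noteq> 0 \<longrightarrow> (\<exists>i>0. x = z ^ i))"
    using primitive_root by metis
  from someI_ex[OF this] show "zeta \<in> F" "zeta \<noteq> 0" "0 < i \<Longrightarrow> i < p - 1 \<Longrightarrow> zeta ^ i \<noteq> e"
    "x \<in> F \<Longrightarrow> x \<noteq> 0 \<Longrightarrow> \<exists>i>0. x = zeta ^ i"
    unfolding zeta_def[symmetric] by blast+
qed

lemma zeta_neq_e: "zeta \<noteq> e"
  using zeta(3)[of 1] p_large by simp

abbreviation t0 where "t0 \<equiv> iT (const_on zeta) (const_on zeta)"

lemma t0_in [simp]: "t0 \<in> carrier N" by (simp add: zeta)

text \<open>Conjugation by \<open>t0\<close> scales U by \<open>zeta\<close> and the index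
  \<open>(h, g, j)\<close> of W by \<open>zeta ^ (j + 1)\<close>. As
  \<open>0 < j + 1 < p - 1\<close>, none of these scalars is \<open>e\<close>, so no nonzero
  \<open>u\<close> or \<open>w\<close> is fixed and the centraliser of \<open>t0\<close> lies in the
  torus.\<close>

lemma commutes_t0:
  assumes "x \<in> carrier N" "x \<bullet> t0 = t0 \<bullet> x"
  shows "\<exists>t\<in>Tc. \<exists>s\<in>Tc. x = iT t s"
proof -
  obtain w u t s where xe: "x = (w, u, t, s)" by (cases x)
  have mem: "w \<in> Wc" "u \<in> Uc" "t \<in> Tc" "s \<in> Tc" using assms(1) unfolding xe by auto
  have "w = act zeros (const_on zeta) (const_on zeta) w" "u = (\<lambda>g. const_on zeta g * u g)"
    using assms(2) unfolding xe iT_def by simp_all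
  then have eqs: "w i = act zeros (const_on zeta) (const_on zeta) w i" "u g = const_on zeta g * u g" for i g
    by (metis fun_cong)+
  have "u g = 0" for g
  proof (cases "g \<in> C")
    case True
    then show ?thesis using eqs(2)[of g] mem zeta(1) zeta_neq_e
      by (intro F_fixed_point[of zeta]) (auto simp: const_on_def UcD)
  qed (simp add: UcD mem)
  moreover have "w i = 0" for i
  proof (rule ccontr)
    assume nz: "w i \<noteq> 0"
    obtain h g j where i: "i = (h, g, j)" by (cases i)
    have hgj: "h \<in> C" "g \<in> C" "j \<le> m g h" using WcD(2)[OF mem(1)] nz unfolding i by blast+
    then have "j + 1 < p - 1" using m_less_p[of g h] by linarith
    then have "zeta ^ (j + 1) \<noteq> e" by (intro zeta(3)) auto
    moreover have "zeta ^ (j + 1) * w i = w i"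
      using eqs(1)[of i] hgj unfolding i act_torus[OF mem(1)] by (simp add: const_on_def)
    ultimately show False
      using nz F_fixed_point[of "zeta ^ (j + 1)" "w i"] WcD(1)[OF mem(1)] F_power[OF zeta(1), of "j + 1"]
      by simp
  qed
  ultimately have "x = iT t s" unfolding xe iT_def by (simp add: fun_eq_iff)
  with mem show ?thesis by blast
qed

text \<open>A central element commutes with \<open>t0\<close> and hence lies in the torus. There the
  weight of x_g reads off \<open>t g\<close> and the weight of y_h reads off
  \<open>s h\<close>.\<close>

lemma center_N: "center N = {\<one>\<^bsub>N\<^esub>}"
proof -
  have "z = \<one>\<^bsub>N\<^esub>" if z: "z \<in> carrier N" "\<And>x. x \<in> carrier N \<Longrightarrow> z \<bullet> x = x \<bullet> z" for z
  proof -
    obtain t s where ts: "t \<in> Tc" "s \<in> Tc" and ze: "z = iT t s"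
      using commutes_t0[OF z(1) z(2)[OF t0_in]] by blast
    have "t g = e" if g: "g \<in> C" for g
    proof -
      have "z \<bullet> iU (unit_vec g e) = iU (unit_vec g e) \<bullet> z" using g by (intro z(2)) simp
      then have "t g * unit_vec g e g = unit_vec g e g"
        unfolding ze iT_def iU_def by (simp add: fun_eq_iff)
      then show ?thesis using TcD(1)[OF ts(1)] by (simp add: unit_vec_def)
    qed
    moreover have "s h = e" if h: "h \<in> C" for h
    proof -
      let ?y = "basis_vec h \<one> 0 e"
      have y: "?y \<in> Wc" using h by simp
      have "z \<bullet> iW ?y = iW ?y \<bullet> z" using y by (intro z(2)) simp
      then have "act zeros t s ?y = ?y"
        unfolding ze iT_def iW_def by (simp add: fun_eq_iff)
      then have "act zeros t s ?y (h, \<one>, 0) = ?y (h, \<one>, 0)" by simp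
      then show ?thesis using TcD(1)[OF ts(2)] unfolding act_torus[OF y] basis_vec_apply by simp
    qed
    ultimately have "t = ones" "s = ones" using TcD(3) ts by (metis ext)+
    then show ?thesis unfolding ze iT_def one_N by simp
  qed
  then have "center N \<subseteq> {\<one>\<^bsub>N\<^esub>}" unfolding center_def by blast
  moreover have "\<one>\<^bsub>N\<^esub> \<in> center N" by (simp add: center_def)
  ultimately show ?thesis by blast
qed

section \<open>Automorphisms induced by left translations\<close>

definition shift_W :: "'a \<Rightarrow> ('a \<times> 'a \<times> nat \<Rightarrow> 'k) \<Rightarrow> 'a \<times> 'a \<times> nat \<Rightarrow> 'k" where
  "shift_W a w = (\<lambda>(h, g, j). if h \<in> C \<and> g \<in> C then w (inv a \<otimes> h, inv a \<otimes> g, j) else 0)"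

definition shift_F :: "'k \<Rightarrow> 'a \<Rightarrow> ('a \<Rightarrow> 'k) \<Rightarrow> 'a \<Rightarrow> 'k" where
  "shift_F d a f = (\<lambda>g. if g \<in> C then f (inv a \<otimes> g) else d)"

text \<open>The families are pushed forward along \<open>g \<mapsto> a \<otimes> g\<close>, which
  explains \<open>inv a\<close> in the shifts. The restriction to the carrier is needed because
  members of \<open>auto N\<close> are extensional.\<close>

definition Phi where
  "Phi a = restrict (\<lambda>(w, u, t, s). (shift_W a w, shift_F 0 a u, shift_F e a t, shift_F e a s)) (carrier N)"

lemma Phi_apply: "(w, u, t, s) \<in> carrier N \<Longrightarrow>
    Phi a (w, u, t, s) = (shift_W a w, shift_F 0 a u, shift_F e a t, shift_F e a s)"
  by (simp add: Phi_def)

lemma m_shift: "a \<in> C \<Longrightarrow> g \<in> C \<Longrightarrow> h \<in> C \<Longrightarrow> m (inv a \<otimes> g) (inv a \<otimes> h) = m g h"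
  unfolding m_def by (simp add: G.inv_mult_group G.m_assoc) (simp add: G.m_assoc[symmetric])

lemma shift_W_in [simp]:
  assumes "a \<in> C" "w \<in> Wc" shows "shift_W a w \<in> Wc"
proof (rule WcI)
  show "shift_W a w i \<in> F" for i by (cases i) (simp add: shift_W_def WcD(1)[OF assms(2)])
  show "h \<in> C \<and> g \<in> C \<and> j \<le> m g h" if "shift_W a w (h, g, j) \<noteq> 0" for h g j
  proof -
    have hg: "h \<in> C" "g \<in> C" "w (inv a \<otimes> h, inv a \<otimes> g, j) \<noteq> 0"
      using that by (auto simp: shift_W_def split: if_splits)
    then show ?thesis using WcD(2)[OF assms(2) hg(3)] m_shift[OF assms(1)] by simp
  qed
  show "shift_W a w (h, g, 0) = shift_W a w (h, \<one>, 0)" if "g \<in> C" for h g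
    using WcD(3)[OF assms(2), of "inv a \<otimes> g" "inv a \<otimes> h"] WcD(3)[OF assms(2), of "inv a" "inv a \<otimes> h"] that assms(1)
    by (simp add: shift_W_def)
qed

lemma shift_Uc [simp]: "a \<in> C \<Longrightarrow> u \<in> Uc \<Longrightarrow> shift_F 0 a u \<in> Uc"
  by (rule UcI) (simp_all add: shift_F_def UcD)

lemma shift_Tc [simp]: "a \<in> C \<Longrightarrow> t \<in> Tc \<Longrightarrow> shift_F e a t \<in> Tc"
  by (rule TcI) (simp_all add: shift_F_def TcD)

text \<open>The action is truncated at chain lengths, and these depend only on
  \<open>inv g \<otimes> h\<close>; so the truncation is compatible with left translation of both
  indices.\<close>

lemma shift_W_act:
  assumes "a \<in> C"
  shows "shift_W a (act u t s w) = act (shift_F 0 a u) (shift_F e a t) (shift_F e a s) (shift_W a w)"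
proof (rule ext)
  fix i :: "'a \<times> 'a \<times> nat"
  obtain h g j where i: "i = (h, g, j)" by (cases i)
  show "shift_W a (act u t s w) i = act (shift_F 0 a u) (shift_F e a t) (shift_F e a s) (shift_W a w) i"
  proof (cases "h \<in> C \<and> g \<in> C")
    case True
    then show ?thesis using assms by (simp add: i shift_W_def act_apply shift_F_def m_shift)
  next
    case False
    then have "shift_W a w (h, g, k) = 0" for k by (auto simp: shift_W_def)
    moreover have "shift_W a (act u t s w) i = 0" using False by (auto simp: i shift_W_def)
    ultimately show ?thesis by (simp add: i act_apply)
  qed
qed

lemma Phi_hom:
  assumes a: "a \<in> C" shows "Phi a \<in> hom N N"
proof (rule homI)
  fix x assume "x \<in> carrier N"
  then show "Phi a x \<in> carrier N"
    using a by (cases x) (simp add: Phi_apply)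
next
  fix x y assume xy: "x \<in> carrier N" "y \<in> carrier N"
  obtain w u t s where xe: "x = (w, u, t, s)" by (cases x)
  obtain w' u' t' s' where ye: "y = (w', u', t', s')" by (cases y)
  have mem: "(w, u, t, s) \<in> carrier N" "(w', u', t', s') \<in> carrier N" using xy unfolding xe ye by auto
  have "shift_W a (\<lambda>i. w i + act u t s w' i) = (\<lambda>i. shift_W a w i + shift_W a (act u t s w') i)"
    by (auto simp: shift_W_def fun_eq_iff)
  moreover have "shift_F 0 a (\<lambda>g. u g + t g * u' g) = (\<lambda>g. shift_F 0 a u g + shift_F e a t g * shift_F 0 a u' g)"
    by (auto simp: shift_F_def fun_eq_iff)
  moreover have "shift_F e a (\<lambda>g. t g * t' g) = (\<lambda>g. shift_F e a t g * shift_F e a t' g)" for t t'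
    by (auto simp: shift_F_def fun_eq_iff idem)
  moreover have "x \<bullet> y \<in> carrier N" using xy by simp
  ultimately show "Phi a (x \<bullet> y) = Phi a x \<bullet> Phi a y"
    using mem unfolding xe ye by (simp add: Phi_apply shift_W_act[OF a])
qed

lemma Phi_comp:
  assumes a: "a \<in> C" and b: "b \<in> C" and x: "x \<in> carrier N"
  shows "Phi (a \<otimes> b) x = Phi a (Phi b x)"
proof -
  obtain w u t s where xe: "x = (w, u, t, s)" by (cases x)
  have inv: "inv (a \<otimes> b) \<otimes> g = inv b \<otimes> (inv a \<otimes> g)" if "g \<in> C" for g
    using a b that by (simp add: G.inv_mult_group G.m_assoc)
  have "shift_W (a \<otimes> b) w = shift_W a (shift_W b w)"
    using a b by (auto simp: shift_W_def fun_eq_iff inv)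
  moreover have "shift_F d (a \<otimes> b) f = shift_F d a (shift_F d b f)" for d f
    using a b by (auto simp: shift_F_def fun_eq_iff inv)
  ultimately show ?thesis using a b x unfolding xe by (simp add: Phi_apply)
qed

lemma Phi_one: "x \<in> carrier N \<Longrightarrow> Phi \<one> x = x"
proof -
  assume x: "x \<in> carrier N"
  obtain w u t s where xe: "x = (w, u, t, s)" by (cases x)
  have mem: "w \<in> Wc" "u \<in> Uc" "t \<in> Tc" "s \<in> Tc" using x unfolding xe by auto
  have "shift_W \<one> w = w"
  proof (rule ext)
    fix i show "shift_W \<one> w i = w i"
    proof (cases i)
      case (fields h g j)
      then show ?thesis using WcD(2)[OF mem(1), of h g j] by (auto simp: shift_W_def)
    qed
  qed
  moreover have "shift_F 0 \<one> u = u" "shift_F e \<one> t = t" "shift_F e \<one> s = s"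
    using mem by (auto simp: shift_F_def fun_eq_iff UcD TcD)
  ultimately show ?thesis using x unfolding xe by (simp add: Phi_apply)
qed

lemma Phi_in: "a \<in> C \<Longrightarrow> x \<in> carrier N \<Longrightarrow> Phi a x \<in> carrier N"
  by (rule hom_in_carrier[OF Phi_hom])

lemma Phi_auto: "a \<in> C \<Longrightarrow> Phi a \<in> auto N"
proof -
  assume a: "a \<in> C"
  have "bij_betw (Phi a) (carrier N) (carrier N)"
  proof (rule bij_betw_byWitness[where f' = "Phi (inv a)"])
    show "\<forall>x\<in>carrier N. Phi (inv a) (Phi a x) = x" "\<forall>x\<in>carrier N. Phi a (Phi (inv a) x) = x"
      using a by (auto simp: Phi_comp[symmetric] Phi_one)
  qed (use a Phi_in in auto)
  then show ?thesis using Phi_hom[OF a] by (simp add: auto_def Bij_def Phi_def)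
qed

end

section \<open>Automorphisms\<close>

lemma (in group) conj_mult:
  assumes "x \<in> carrier G" "y \<in> carrier G" "z \<in> carrier G"
  shows "x \<otimes> (y \<otimes> z) \<otimes> inv x = (x \<otimes> y \<otimes> inv x) \<otimes> (x \<otimes> z \<otimes> inv x)"
proof -
  have "inv x \<otimes> (x \<otimes> (z \<otimes> inv x)) = z \<otimes> inv x"
    using assms by (simp add: m_assoc[symmetric])
  then show ?thesis using assms by (simp add: m_assoc)
qed

lemma (in group) conj_inv_conj:
  assumes "x \<in> carrier G" "y \<in> carrier G"
  shows "inv x \<otimes> (x \<otimes> y \<otimes> inv x) \<otimes> x = y" "x \<otimes> (inv x \<otimes> y \<otimes> x) \<otimes> inv x = y"
proof -
  have "inv x \<otimes> (x \<otimes> y) = y" "x \<otimes> (inv x \<otimes> y) = y"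
    using assms by (simp_all add: m_assoc[symmetric])
  then show "inv x \<otimes> (x \<otimes> y \<otimes> inv x) \<otimes> x = y" "x \<otimes> (inv x \<otimes> y \<otimes> x) \<otimes> inv x = y"
    using assms by (simp_all add: m_assoc)
qed

lemma (in group) conj_iso:
  assumes x: "x \<in> carrier G" and \<alpha>: "\<alpha> \<in> iso G G"
  shows "(\<lambda>y. x \<otimes> \<alpha> y \<otimes> inv x) \<in> iso G G"
proof -
  have bij: "bij_betw (\<lambda>y. x \<otimes> y \<otimes> inv x) (carrier G) (carrier G)"
    by (rule bij_betw_byWitness[where f' = "\<lambda>y. inv x \<otimes> y \<otimes> x"])
      (use x in \<open>auto simp: conj_inv_conj\<close>)
  have \<alpha>': "\<alpha> \<in> hom G G" "bij_betw \<alpha> (carrier G) (carrier G)"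
    using \<alpha> by (auto simp: iso_def)
  have "bij_betw ((\<lambda>y. x \<otimes> y \<otimes> inv x) \<circ> \<alpha>) (carrier G) (carrier G)"
    by (rule bij_betw_trans[OF \<alpha>'(2) bij])
  moreover have "(\<lambda>y. x \<otimes> \<alpha> y \<otimes> inv x) \<in> hom G G"
    using \<alpha>'(1) x by (intro homI) (simp_all add: hom_in_carrier hom_mult conj_mult)
  ultimately show ?thesis by (simp add: iso_def comp_def)
qed

lemma (in group) commute_conj_eq:
  assumes "x \<in> carrier G" "y \<in> carrier G" "z \<in> carrier G"
  shows "x \<otimes> y \<otimes> inv x = z \<longleftrightarrow> x \<otimes> y = z \<otimes> x"
  using assms inv_solve_right'[of z "x \<otimes> y" x] by auto

context coloured_group
begin

section \<open>Generators, commutators, and W as a centraliser\<close>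

definition T where "T = {iT t s | t s. t \<in> Tc \<and> s \<in> Tc}"

abbreviation xel :: "'a \<Rightarrow> _" where "xel g \<equiv> iU (unit_vec g e)"
abbreviation yel :: "'a \<Rightarrow> _" where "yel h \<equiv> iW (basis_vec h \<one> 0 e)"

text \<open>The commutator of \<open>xel g\<close> and \<open>yel h\<close>. All chain coefficients
  are \<open>e\<close>, because the constant term of \<open>(e + X) ^ j\<close> is
  \<open>e\<close>.\<close>

definition comm_vec :: "'a \<Rightarrow> 'a \<Rightarrow> 'a \<times> 'a \<times> nat \<Rightarrow> 'k" where
  "comm_vec g h = (\<lambda>(h', g', j). if h' = h \<and> g' = g \<and> 1 \<le> j \<and> j \<le> m g h then e else 0)"

lemma comm_vec_in [simp]: "g \<in> C \<Longrightarrow> h \<in> C \<Longrightarrow> comm_vec g h \<in> Wc"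
  by (rule WcI) (auto simp: comm_vec_def split: if_splits prod.splits)

lemma X_in [simp]: "g \<in> C \<Longrightarrow> xel g \<in> carrier N" by simp
lemma Y_in [simp]: "h \<in> C \<Longrightarrow> yel h \<in> carrier N" by simp

lemma iW_V [simp]: "iW w \<in> V \<longleftrightarrow> w \<in> Wc" by (simp add: iW_def)
lemma iU_V [simp]: "iU u \<in> V \<longleftrightarrow> u \<in> Uc" by (simp add: iU_def)

lemma act_X_Y:
  assumes "g \<in> C" "h \<in> C"
  shows "act (unit_vec g e) ones ones (basis_vec h \<one> 0 e) = (\<lambda>i. comm_vec g h i + basis_vec h \<one> 0 e i)"
proof (rule ext)
  fix i :: "'a \<times> 'a \<times> nat"
  obtain h' g' j where i: "i = (h', g', j)" by (cases i)
  let ?y = "basis_vec h \<one> 0 e"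
  have "(\<Sum>i\<le>j. of_nat (j choose i) * unit_vec g e g' ^ (j - i) * e ^ i * ?y (h', g', i)) =
      (\<Sum>i\<le>j. if i = 0 then unit_vec g e g' ^ j * ?y (h', g', 0) else 0)"
    by (rule sum.cong) (auto simp: basis_vec_def)
  then have act: "act (unit_vec g e) ones ones ?y i =
      (if j \<le> m g' h' then e * (unit_vec g e g' ^ j * ?y (h', g', 0)) else 0)"
    unfolding i by (simp add: act_apply)
  show "act (unit_vec g e) ones ones ?y i = comm_vec g h i + ?y i"
  proof (cases "h' = h \<and> g' \<in> C")
    case True
    then show ?thesis unfolding act unfolding i
      by (cases "j = 0") (auto simp: comm_vec_def basis_vec_def unit_vec_def idem power_0_left)
  next
    case False
    then show ?thesis unfolding act unfolding i
      using assms by (auto simp: comm_vec_def basis_vec_def)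
  qed
qed

lemma comm_X_Y:
  assumes "g \<in> C" "h \<in> C"
  shows "iW (comm_vec g h) \<bullet> (yel h \<bullet> xel g) = xel g \<bullet> yel h"
  using assms act_X_Y[OF assms] by (simp add: iW_def iU_def fun_eq_iff unit_vec_def idem)

text \<open>The equation says that \<open>d\<close> is the commutator of \<open>v\<close> and
  \<open>v'\<close>, written without inverses so that automorphisms transport it directly. It has no
  \<open>u\<close>-part because U is abelian, and no part at \<open>j = 0\<close> because
  \<open>V\<close> acts trivially on these coordinates.\<close>

lemma V_commutator:
  assumes v: "v \<in> V" and v': "v' \<in> V" and d: "d \<in> carrier N"
    and eq: "d \<bullet> (v' \<bullet> v) = v \<bullet> v'"
  shows "\<exists>w\<in>Wc. d = iW w \<and> (\<forall>h. w (h, \<one>, 0) = 0)"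
proof -
  obtain w1 u1 where ve: "v = (w1, u1, ones, ones)" "w1 \<in> Wc" "u1 \<in> Uc" using v by (cases v) auto
  obtain w2 u2 where v'e: "v' = (w2, u2, ones, ones)" "w2 \<in> Wc" "u2 \<in> Uc" using v' by (cases v') auto
  obtain w u t s where de: "d = (w, u, t, s)" by (cases d)
  have mem: "w \<in> Wc" "u \<in> Uc" "t \<in> Tc" "s \<in> Tc" using d unfolding de by auto
  have ts: "t g = e" "s g = e" for g
    using eq mem unfolding de ve(1) v'e(1) by (auto simp: fun_eq_iff idem TcD)
  then have ts': "t = ones" "s = ones" by auto
  have "u g + (u2 g + u1 g) = u1 g + u2 g" for g
    using eq unfolding de ve(1) v'e(1) ts' by (simp add: fun_eq_iff UcD ve v'e)
  then have u: "u = zeros" by (simp add: fun_eq_iff)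
  have "(\<lambda>i. w i + act zeros ones ones (\<lambda>i. w2 i + act u2 ones ones w1 i) i) = (\<lambda>i. w1 i + act u1 ones ones w2 i)"
    using eq unfolding de ve(1) v'e(1) ts' u by simp
  then have "w i + act zeros ones ones (\<lambda>i. w2 i + act u2 ones ones w1 i) i = w1 i + act u1 ones ones w2 i" for i
    by (rule fun_cong)
  then have "w i + (w2 i + act u2 ones ones w1 i) = w1 i + act u1 ones ones w2 i" for i
    using ve v'e by simp
  from this[of "(h, \<one>, 0)" for h] have "w (h, \<one>, 0) = 0" for h
    using ve(2) v'e(2) by (simp add: act_apply WcD(1))
  then show ?thesis using mem(1) unfolding de ts' u iW_def by blast
qed

text \<open>A nonzero \<open>u g\<close> pushes the first chain vector onto the second, which exists
  because every colour is at least 2.\<close>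

lemma commutes_comm_vec:
  assumes x: "(w, u, ones, ones) \<in> V" and g: "g \<in> C"
    and eq: "(w, u, ones, ones) \<bullet> iW (comm_vec g \<one>) = iW (comm_vec g \<one>) \<bullet> (w, u, ones, ones)"
  shows "u g = 0"
proof (rule ccontr)
  assume nz: "u g \<noteq> 0"
  have mem: "w \<in> Wc" "u \<in> Uc" using x by auto
  have m2: "2 \<le> m g \<one>" using g m_ge_2 by simp
  let ?c = "comm_vec g \<one>"
  have "(\<lambda>i. w i + act u ones ones ?c i) = (\<lambda>i. ?c i + w i)"
    using eq mem by (simp add: iW_def)
  then have "w (\<one>, g, 2) + act u ones ones ?c (\<one>, g, 2) = ?c (\<one>, g, 2) + w (\<one>, g, 2)"
    by (rule fun_cong)
  then have "act u ones ones ?c (\<one>, g, 2) = ?c (\<one>, g, 2)"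
    by simp
  moreover have "?c (\<one>, g, Suc 0) = e" "?c (\<one>, g, Suc (Suc 0)) = e" "?c (\<one>, g, 0) = 0"
    using m2 by (simp_all add: comm_vec_def)
  \<comment> \<open>The coordinate at \<open>j = 2\<close> of the transformed commutator is
    \<open>c_2 + 2 u c_1 + u^2 c_0\<close> with \<open>c_0 = 0\<close> and
    \<open>c_1 = c_2 = e\<close>. The factor 2 can be cancelled because \<open>p\<close> is
    large.\<close>
  ultimately have "e * (of_nat 2 * u g + e) = e"
    using m2 mem by (simp add: act_apply numeral_2_eq_2 UcD idem mult.assoc)
  then have "of_nat 2 * u g = 0"
    using mem by (simp add: distrib_left idem UcD mult.left_commute)
  then show False using of_nat_mult_neq_0[of 2 "u g"] nz p_large UcD(1)[OF mem(2)] by simp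
qed

text \<open>W is the centraliser in \<open>V\<close> of the commutators of \<open>V\<close>: it is
  abelian and contains them all, while the commutator of x_g with \<open>yel \<one>\<close> detects
  \<open>u g\<close>. The condition refers only to the multiplication and to \<open>V\<close>, so
  automorphisms preserve it.\<close>

lemma W_iff:
  assumes x: "x \<in> V"
  shows "x \<in> iW ` Wc \<longleftrightarrow> (\<forall>d\<in>carrier N. \<forall>v\<in>V. \<forall>v'\<in>V.
    d \<bullet> (v' \<bullet> v) = v \<bullet> v' \<longrightarrow> x \<bullet> d = d \<bullet> x)" (is "_ = ?R")
proof
  assume "x \<in> iW ` Wc"
  then obtain w where w: "x = iW w" "w \<in> Wc" by blast
  show ?R
  proof (intro ballI impI)
    fix d v v' assume "d \<in> carrier N" "v \<in> V" "v' \<in> V" "d \<bullet> (v' \<bullet> v) = v \<bullet> v'"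
    then obtain w' where "w' \<in> Wc" "d = iW w'" using V_commutator by blast
    then show "x \<bullet> d = d \<bullet> x" using w by (simp add: iW_mult add.commute)
  qed
next
  assume R: ?R
  obtain w u where xe: "x = (w, u, ones, ones)" "w \<in> Wc" "u \<in> Uc" using x by (cases x) auto
  have "u g = 0" for g
  proof (cases "g \<in> C")
    case True
    have "x \<bullet> iW (comm_vec g \<one>) = iW (comm_vec g \<one>) \<bullet> x"
    proof -
      have "iW (comm_vec g \<one>) \<in> carrier N" "xel g \<in> V" "yel \<one> \<in> V" using True by simp_all
      then show ?thesis using R comm_X_Y[OF True G.one_closed] by blast
    qed
    then show ?thesis using commutes_comm_vec[OF _ True] x unfolding xe(1) by blast
  qed (use xe UcD in blast)
  then have "x = iW w" unfolding xe(1) iW_def by (simp add: fun_eq_iff)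
  with xe(2) show "x \<in> iW ` Wc" by blast
qed

section \<open>Separating weights by the torus\<close>

lemma zeta_power_inj:
  assumes "i < p - 1" "j < p - 1" "e * zeta ^ i = e * zeta ^ j"
  shows "i = j"
proof -
  have *: "False" if "i < j" "j < p - 1" "e * zeta ^ i = e * zeta ^ j" for i j
  proof -
    have nz: "e * zeta ^ i \<in> F" "e * zeta ^ i \<noteq> 0"
      using F_no_zero_div[of e "zeta ^ i"] F_power_neq_0[of zeta i] F_power[of zeta i] zeta
      by (cases "i = 0"; simp)+
    have pw: "zeta ^ (j - i) \<in> F" using that zeta by (intro F_power) auto
    have "(e * zeta ^ i) * zeta ^ (j - i) = e * zeta ^ j"
      using that(1) by (simp add: mult.assoc flip: power_add)
    also have "\<dots> = (e * zeta ^ i) * e" using that(3) nz(1) by simp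
    finally have "zeta ^ (j - i) = e"
      using F_mult_cancel[OF pw _ nz] by simp
    then show False using zeta(3)[of "j - i"] that by simp
  qed
  show ?thesis using *[of i j] *[of j i] assms by (metis linorder_neqE_nat)
qed

text \<open>Torus elements with the single nontrivial entry \<open>zeta\<close> are the test
  elements. One at \<open>h1\<close> in the \<open>s\<close>-part separates \<open>h1\<close> from
  \<open>h2\<close>. For \<open>g1 \<noteq> g2\<close>, one at \<open>g1\<close> in the
  \<open>t\<close>-part forces \<open>j1 = 0\<close> and one at \<open>g2\<close> forces
  \<open>j2 = 0\<close>, where the choice of \<open>g\<close> makes no difference.\<close>

lemma weight_inj:
  assumes "h1 \<in> C" "g1 \<in> C" "h2 \<in> C" "g2 \<in> C" and small: "j1 < p - 1" "j2 < p - 1"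
    and eq: "\<And>t s. t \<in> Tc \<Longrightarrow> s \<in> Tc \<Longrightarrow> e * (s h1 * t g1 ^ j1) = e * (s h2 * t g2 ^ j2)"
  shows "h1 = h2 \<and> j1 = j2 \<and> (g1 = g2 \<or> j1 = 0)"
proof -
  have at: "at_coord x zeta \<in> Tc" if "x \<in> C" for x using that zeta by simp
  have one: "e * e ^ i = e" for i by (cases "i = 0") (simp_all add: idem)
  have ez: "e * zeta = zeta" using zeta(1) by simp
  have "h1 = h2"
  proof (rule ccontr)
    assume ne: "h1 \<noteq> h2"
    have "e * (at_coord h1 zeta h1 * e ^ j1) = e * (at_coord h1 zeta h2 * e ^ j2)"
      by (rule eq) (use at assms in auto)
    then have "zeta = e"
      using ne zeta(1) by (simp add: at_coord_def mult.left_commute[of e zeta] one idem)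
    then show False using zeta_neq_e by simp
  qed
  moreover have "j1 = j2 \<and> (g1 = g2 \<or> j1 = 0)"
  proof (cases "g1 = g2")
    case True
    have "e * (e * at_coord g1 zeta g1 ^ j1) = e * (e * at_coord g1 zeta g2 ^ j2)"
      by (rule eq) (use at assms in auto)
    then have "e * zeta ^ j1 = e * zeta ^ j2"
      unfolding mult.assoc[symmetric] idem using True by (simp add: at_coord_def)
    then show ?thesis using zeta_power_inj small True by blast
  next
    case False
    have "e * (e * at_coord g1 zeta g1 ^ j1) = e * (e * at_coord g1 zeta g2 ^ j2)"
      by (rule eq) (use at assms in auto)
    then have "e * zeta ^ j1 = e * zeta ^ 0"
      unfolding mult.assoc[symmetric] idem using False one[of j2] by (simp add: at_coord_def)
    moreover have "e * (e * at_coord g2 zeta g1 ^ j1) = e * (e * at_coord g2 zeta g2 ^ j2)"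
      by (rule eq) (use at assms in auto)
    then have "e * zeta ^ j2 = e * zeta ^ 0"
      unfolding mult.assoc[symmetric] idem using False one[of j1] by (simp add: at_coord_def)
    ultimately have "j1 = 0" "j2 = 0" using zeta_power_inj[of _ 0] small by auto
    then show ?thesis by simp
  qed
  ultimately show ?thesis by blast
qed

lemma add_closed_scale:
  assumes D: "D \<subseteq> Wc" and add: "\<And>w w'. w \<in> D \<Longrightarrow> w' \<in> D \<Longrightarrow> (\<lambda>i. w i + w' i) \<in> D"
    and w: "w \<in> D" and a: "a \<in> F"
  shows "(\<lambda>i. a * w i) \<in> D"
proof -
  have scale_nat: "(\<lambda>i. of_nat k * w i) \<in> D" if "w \<in> D" "k > 0" for k w
    using that(2)
  proof (induction k rule: nat_induct_non_zero)
    case 1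
    then show ?case using that(1) by simp
  next
    case (Suc k)
    then show ?case using add[OF that(1) Suc.IH] by (simp add: distrib_right)
  qed
  obtain k where k: "a = of_nat k * e" using F_of_nat[OF a] by blast
  have wF: "w i \<in> F" for i using w D WcD by blast
    \<comment> \<open>Adding \<open>p\<close> changes no scalar and makes the multiplier positive:
      repeated addition inside \<open>D\<close> starts at 1, as \<open>D\<close> is not assumed to
      contain the zero vector.\<close>
    have "(\<lambda>i. of_nat (k + p) * w i) \<in> D"
      using w p_gt_1 by (intro scale_nat) auto
    moreover have "of_nat (k + p) * w i = a * w i" for i
      using wF by (simp add: k distrib_right mult.assoc)
    ultimately show ?thesis by (simp del: of_nat_add)
qed

text \<open>Lagrange interpolation. On the chain, a torus element with entry \<open>zeta\<close> at
  \<open>g\<close> has the distinct eigenvalues \<open>zeta ^ i\<close>, so the product of the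
  operators "torus element minus \<open>zeta ^ l\<close>" over all \<open>l \<noteq> j\<close> kills
  every component of the commutator except the one at \<open>j\<close>.\<close>

lemma torus_projection:
  assumes g: "g \<in> C" and h: "h \<in> C" and j: "1 \<le> j" "j \<le> m g h"
    and D: "D \<subseteq> Wc" "comm_vec g h \<in> D"
    and add: "\<And>w w'. w \<in> D \<Longrightarrow> w' \<in> D \<Longrightarrow> (\<lambda>i. w i + w' i) \<in> D"
    and tor: "\<And>t s w. t \<in> Tc \<Longrightarrow> s \<in> Tc \<Longrightarrow> w \<in> D \<Longrightarrow> act zeros t s w \<in> D"
  shows "basis_vec h g j e \<in> D"
proof -
  have scale: "(\<lambda>i. a * w i) \<in> D" if "w \<in> D" "a \<in> F" for a w
    by (rule add_closed_scale[OF D(1) _ that]) (rule add)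
  \<comment> \<open>\<open>P S i\<close> is the eigenvalue at coordinate \<open>i\<close> of the
    product of the operators for \<open>l \<in> S\<close>; \<open>vec S\<close> is the result of
    applying this product to \<open>comm_vec g h\<close>.\<close>
  define P where "P S i = e * (\<Prod>l\<in>S. zeta ^ i - zeta ^ l)" for S :: "nat set" and i
  define vec where "vec S = (\<lambda>(h', g', i). if h' = h \<and> g' = g \<and> 1 \<le> i \<and> i \<le> m g h then P S i else 0)" for S
  \<comment> \<open>\<open>0 \<notin> S\<close> keeps the scalars \<open>zeta ^ l\<close> inside
    \<open>F\<close>, where scaling is available.\<close>
  have "vec S \<in> D" if "finite S" "0 \<notin> S" for S
    using that
  proof (induction S rule: finite_induct)
    case empty
    have "vec {} = comm_vec g h" by (auto simp: vec_def comm_vec_def P_def fun_eq_iff)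
    then show ?case using D by simp
  next
    case (insert l S)
    then have IH: "vec S \<in> D" and l: "l > 0" by auto
    have "act zeros (at_coord g zeta) ones (vec S) \<in> D"
      using IH g zeta by (intro tor) auto
    moreover have "(\<lambda>i. (- (zeta ^ l)) * vec S i) \<in> D"
      using IH l zeta F_power by (intro scale) auto
    ultimately have *: "(\<lambda>i. act zeros (at_coord g zeta) ones (vec S) i + (- (zeta ^ l)) * vec S i) \<in> D"
      by (rule add)
    have "vec S \<in> Wc" using IH D by blast
    then have "act zeros (at_coord g zeta) ones (vec S) (h', g', i) + (- (zeta ^ l)) * vec S (h', g', i)
        = vec (insert l S) (h', g', i)" for h' g' i
      using insert.hyps
      by (auto simp: act_torus vec_def at_coord_def P_def left_diff_distrib right_diff_distrib mult_ac idem
          simp flip: mult.assoc[of e e])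
    then have "(\<lambda>i. act zeros (at_coord g zeta) ones (vec S) i + (- (zeta ^ l)) * vec S i) = vec (insert l S)"
      by (auto simp: fun_eq_iff)
    with * show ?case by simp
  qed
  then have vecD: "vec ({1..m g h} - {j}) \<in> D" by simp
  have Pnz: "P S i \<in> F \<and> P S i \<noteq> 0" if "finite S" "0 \<notin> S" "i \<notin> S" "\<And>l. l \<in> S \<Longrightarrow> l < p - 1" "0 < i" "i < p - 1" for S i
    using that
  proof (induction S rule: finite_induct)
    case (insert l S)
    have l: "0 < l" "l < p - 1" "l \<noteq> i" using insert.prems by auto
    have F: "zeta ^ i \<in> F" "zeta ^ l \<in> F" using l insert.prems zeta F_power by blast+
    have "zeta ^ i - zeta ^ l \<noteq> 0" using zeta_power_inj[of i l] l insert.prems by auto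
    moreover have "P S i \<in> F \<and> P S i \<noteq> 0" using insert by auto
    ultimately have "(zeta ^ i - zeta ^ l) * P S i \<noteq> 0"
      using F_no_zero_div[of "zeta ^ i - zeta ^ l" "P S i"] F by auto
    moreover have "P (insert l S) i = (zeta ^ i - zeta ^ l) * P S i"
      using insert.hyps by (simp add: P_def mult_ac)
    ultimately show ?case using F by (simp add: P_def)
  qed (simp add: P_def)
  have small: "m g h < p - 1" using m_less_p[OF g h] by linarith
  let ?d = "P ({1..m g h} - {j}) j"
  have d: "?d \<in> F" "?d \<noteq> 0"
    using Pnz[of "{1..m g h} - {j}" j] j small by auto
  have "vec ({1..m g h} - {j}) = basis_vec h g j ?d"
  proof (rule ext, clarify)
    fix h' g' i
    have "P ({1..m g h} - {j}) i = 0" if "1 \<le> i" "i \<le> m g h" "i \<noteq> j"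
    proof -
      have "(\<Prod>l\<in>{1..m g h} - {j}. zeta ^ i - zeta ^ l) = 0"
        by (rule prod_zero) (use that in auto)
      then show ?thesis by (simp add: P_def)
    qed
    then show "vec ({1..m g h} - {j}) (h', g', i) = basis_vec h g j ?d (h', g', i)"
      using j by (auto simp: vec_def basis_vec_def)
  qed
  then have "(\<lambda>i. Finv ?d * basis_vec h g j ?d i) \<in> D"
    using scale[OF vecD, of "Finv ?d"] Finv[OF d] by simp
  then show ?thesis unfolding basis_vec_scale Finv(3)[OF d] .
qed

section \<open>Characteristic subgroups and the image of the torus\<close>

lemma iso_N_D:
  assumes "\<alpha> \<in> iso N N"
  shows "x \<in> carrier N \<Longrightarrow> \<alpha> x \<in> carrier N"
    and "x \<in> carrier N \<Longrightarrow> y \<in> carrier N \<Longrightarrow> \<alpha> (x \<bullet> y) = \<alpha> x \<bullet> \<alpha> y"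
    and "x \<in> carrier N \<Longrightarrow> y \<in> carrier N \<Longrightarrow> \<alpha> x = \<alpha> y \<Longrightarrow> x = y"
    and "x \<in> carrier N \<Longrightarrow> \<alpha> (x [^]\<^bsub>N\<^esub> (k::nat)) = \<alpha> x [^]\<^bsub>N\<^esub> k"
    and "\<alpha> \<one>\<^bsub>N\<^esub> = \<one>\<^bsub>N\<^esub>"
proof -
  have h: "\<alpha> \<in> hom N N" "inj_on \<alpha> (carrier N)" using assms by (auto simp: iso_def bij_betw_def)
  interpret h: group_hom N N \<alpha>
    using h(1) group_N by (simp add: group_hom_def group_hom_axioms_def)
  show "x \<in> carrier N \<Longrightarrow> \<alpha> x \<in> carrier N" by simp
  show "x \<in> carrier N \<Longrightarrow> y \<in> carrier N \<Longrightarrow> \<alpha> (x \<bullet> y) = \<alpha> x \<bullet> \<alpha> y" by simp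
  show "x \<in> carrier N \<Longrightarrow> y \<in> carrier N \<Longrightarrow> \<alpha> x = \<alpha> y \<Longrightarrow> x = y" using h(2) by (simp add: inj_on_def)
  show "x \<in> carrier N \<Longrightarrow> \<alpha> (x [^]\<^bsub>N\<^esub> (k::nat)) = \<alpha> x [^]\<^bsub>N\<^esub> k" by (rule h.hom_nat_pow)
  show "\<alpha> \<one>\<^bsub>N\<^esub> = \<one>\<^bsub>N\<^esub>" by simp
qed

lemma iso_N_inverse:
  assumes "\<alpha> \<in> iso N N"
  obtains \<beta> where "\<beta> \<in> iso N N" "\<And>x. x \<in> carrier N \<Longrightarrow> \<beta> (\<alpha> x) = x" "\<And>x. x \<in> carrier N \<Longrightarrow> \<alpha> (\<beta> x) = x"
proof (rule that)
  have b: "bij_betw \<alpha> (carrier N) (carrier N)" using assms by (simp add: iso_def)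
  show "inv_into (carrier N) \<alpha> \<in> iso N N" by (rule N.iso_set_sym[OF assms])
  show "x \<in> carrier N \<Longrightarrow> inv_into (carrier N) \<alpha> (\<alpha> x) = x" for x
    using b by (simp add: bij_betw_def inv_into_f_f)
  show "x \<in> carrier N \<Longrightarrow> \<alpha> (inv_into (carrier N) \<alpha> x) = x" for x
    using b by (simp add: bij_betw_def f_inv_into_f)
qed

text \<open>By \<open>V_iff_pow\<close>, membership in \<open>V\<close> is a condition on a power,
  which automorphisms respect.\<close>

lemma iso_V:
  assumes "\<alpha> \<in> iso N N" "x \<in> carrier N"
  shows "\<alpha> x \<in> V \<longleftrightarrow> x \<in> V"
proof -
  have "\<alpha> x [^]\<^bsub>N\<^esub> (p ^ 2) = \<one>\<^bsub>N\<^esub> \<longleftrightarrow> \<alpha> (x [^]\<^bsub>N\<^esub> (p ^ 2)) = \<alpha> \<one>\<^bsub>N\<^esub>"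
    using iso_N_D(4,5)[OF assms(1)] assms(2) by simp
  also have "\<dots> \<longleftrightarrow> x [^]\<^bsub>N\<^esub> (p ^ 2) = \<one>\<^bsub>N\<^esub>"
    using iso_N_D(3)[OF assms(1), of "x [^]\<^bsub>N\<^esub> (p ^ 2)" "\<one>\<^bsub>N\<^esub>"] assms(2) by auto
  finally show ?thesis
    using V_iff_pow assms(2) iso_N_D(1)[OF assms] by simp
qed

lemma V_in: "x \<in> V \<Longrightarrow> x \<in> carrier N" using V_subset by blast

lemma iso_W:
  assumes \<alpha>: "\<alpha> \<in> iso N N" and w: "w \<in> Wc"
  shows "\<exists>w'\<in>Wc. \<alpha> (iW w) = iW w'"
proof -
  obtain \<beta> where \<beta>: "\<beta> \<in> iso N N" "\<And>x. x \<in> carrier N \<Longrightarrow> \<beta> (\<alpha> x) = x" "\<And>x. x \<in> carrier N \<Longrightarrow> \<alpha> (\<beta> x) = x"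
    using iso_N_inverse[OF \<alpha>] by blast
  have xV: "iW w \<in> V" using w by simp
  have \<alpha>V: "\<alpha> (iW w) \<in> V" using iso_V[OF \<alpha>] w by simp
  have "\<alpha> (iW w) \<bullet> d = d \<bullet> \<alpha> (iW w)"
    if d: "d \<in> carrier N" and v: "v \<in> V" "v' \<in> V" and eq: "d \<bullet> (v' \<bullet> v) = v \<bullet> v'" for d v v'
  proof -
    have vc: "v \<in> carrier N" "v' \<in> carrier N" using v V_in by auto
    have "\<beta> d \<bullet> (\<beta> v' \<bullet> \<beta> v) = \<beta> v \<bullet> \<beta> v'"
      using iso_N_D(2)[OF \<beta>(1)] d vc eq by (metis N.m_closed)
    moreover have "\<beta> d \<in> carrier N" "\<beta> v \<in> V" "\<beta> v' \<in> V"
      using iso_N_D(1)[OF \<beta>(1)] iso_V[OF \<beta>(1)] d v vc by auto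
    ultimately have "iW w \<bullet> \<beta> d = \<beta> d \<bullet> iW w"
      using W_iff[OF xV] w by blast
    then have "\<alpha> (iW w) \<bullet> \<alpha> (\<beta> d) = \<alpha> (\<beta> d) \<bullet> \<alpha> (iW w)"
      using iso_N_D(2)[OF \<alpha>] w \<open>\<beta> d \<in> carrier N\<close> by (metis iW_in)
    then show ?thesis using \<beta>(3)[OF d] by simp
  qed
  then have "\<alpha> (iW w) \<in> iW ` Wc" using W_iff[OF \<alpha>V] by blast
  then show ?thesis by blast
qed

lemma finite_T: "finite T"
proof -
  have "T = (\<lambda>(t, s). iT t s) ` (Tc \<times> Tc)" by (auto simp: T_def)
  then show ?thesis using finite_Tc by simp
qed

lemma T_in: "x \<in> T \<Longrightarrow> x \<in> carrier N" by (auto simp: T_def)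

text \<open>A substitute for the conjugacy of complements: \<open>t0\<close> acts on \<open>V\<close> without fixed points,
  hence so does \<open>x = \<alpha> t0\<close>, and then \<open>v \<mapsto> v x v\<^sup>-\<^sup>1\<close> maps \<open>V\<close> onto the coset of \<open>x\<close>.\<close>
lemma iso_torus:
  assumes \<alpha>: "\<alpha> \<in> iso N N"
  shows "\<exists>v\<in>carrier N. (\<lambda>y. v \<bullet> \<alpha> y \<bullet> inv\<^bsub>N\<^esub> v) \<in> iso N N \<and>
    (\<lambda>y. v \<bullet> \<alpha> y \<bullet> inv\<^bsub>N\<^esub> v) ` T = T"
proof -
  obtain \<beta> where \<beta>: "\<beta> \<in> iso N N" "\<And>x. x \<in> carrier N \<Longrightarrow> \<beta> (\<alpha> x) = x" "\<And>x. x \<in> carrier N \<Longrightarrow> \<alpha> (\<beta> x) = x"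
    using iso_N_inverse[OF \<alpha>] by blast
  obtain w1 u1 t1 s1 where x1: "\<alpha> t0 = (w1, u1, t1, s1)" by (cases "\<alpha> t0")
  have x1_in: "\<alpha> t0 \<in> carrier N" by (rule iso_N_D(1)[OF \<alpha> t0_in])
  then have ts1: "t1 \<in> Tc" "s1 \<in> Tc" unfolding x1 by auto
  \<comment> \<open>Pulled back by \<open>\<beta>\<close>, such a \<open>v\<close> commutes with
    \<open>t0\<close> and so lies in the torus; but it also lies in \<open>V\<close>, and the two
    meet trivially.\<close>
  have fix_one: "v = \<one>\<^bsub>N\<^esub>" if v: "v \<in> V" and eq: "v \<bullet> \<alpha> t0 = \<alpha> t0 \<bullet> v" for v
  proof -
    have "\<beta> (v \<bullet> \<alpha> t0) = \<beta> (\<alpha> t0 \<bullet> v)" using eq by simp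
    then have "\<beta> v \<bullet> t0 = t0 \<bullet> \<beta> v"
      using iso_N_D(2)[OF \<beta>(1)] V_in[OF v] x1_in \<beta>(2)[OF t0_in] by simp
    then obtain t s where "\<beta> v = iT t s"
      using commutes_t0 iso_N_D(1)[OF \<beta>(1) V_in[OF v]] by blast
    moreover have "\<beta> v \<in> V" using iso_V[OF \<beta>(1) V_in[OF v]] v by simp
    ultimately have "\<beta> v = \<one>\<^bsub>N\<^esub>" by (simp add: iT_def one_N)
    then show "v = \<one>\<^bsub>N\<^esub>" using \<beta>(3)[OF V_in[OF v]] iso_N_D(5)[OF \<alpha>] by simp
  qed
  define \<psi> where "\<psi> v = v \<bullet> \<alpha> t0 \<bullet> inv\<^bsub>N\<^esub> v" for v
  let ?coset = "Wc \<times> Uc \<times> {t1} \<times> {s1}"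
  have in_coset: "\<psi> v \<in> ?coset" if v: "v \<in> V" for v
  proof -
    have vc: "v \<in> carrier N" using V_in v .
    have in_N: "\<psi> v \<in> carrier N" unfolding \<psi>_def using vc x1_in by simp
    obtain w u t s where z: "\<psi> v = (w, u, t, s)" by (cases "\<psi> v")
    have mem: "w \<in> Wc" "u \<in> Uc" "t \<in> Tc" "s \<in> Tc" using in_N unfolding z by auto
    have "v \<bullet> \<alpha> t0 = \<psi> v \<bullet> v"
      using N.commute_conj_eq[OF vc x1_in in_N] unfolding \<psi>_def by blast
    moreover obtain wv uv where "v = (wv, uv, ones, ones)" using v by (cases v) auto
    ultimately have "(\<lambda>g. e * t1 g) = (\<lambda>g. t g * e)" "(\<lambda>g. e * s1 g) = (\<lambda>g. s g * e)"
      unfolding z x1 by simp_all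
    then have "t = t1" "s = s1" using mem ts1 by (simp_all add: TcD)
    then show ?thesis using mem unfolding z by simp
  qed
  have inj: "inj_on \<psi> V"
  proof (rule inj_onI)
    fix v v' assume vv: "v \<in> V" "v' \<in> V" "\<psi> v = \<psi> v'"
    have vc: "v \<in> carrier N" "v' \<in> carrier N" using vv V_in by auto
    let ?d = "inv\<^bsub>N\<^esub> v' \<bullet> v"
    have "\<psi> v' \<in> carrier N" unfolding \<psi>_def using vc x1_in by simp
    from N.commute_conj_eq[OF vc(1) x1_in this]
    have "v \<bullet> \<alpha> t0 = \<psi> v' \<bullet> v"
      using vv(3) unfolding \<psi>_def by blast
    also have "\<dots> = v' \<bullet> (\<alpha> t0 \<bullet> ?d)"
      unfolding \<psi>_def using vc x1_in by (simp add: N.m_assoc)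
    finally have "inv\<^bsub>N\<^esub> v' \<bullet> (v \<bullet> \<alpha> t0) = inv\<^bsub>N\<^esub> v' \<bullet> (v' \<bullet> (\<alpha> t0 \<bullet> ?d))"
      by simp
    then have comm: "?d \<bullet> \<alpha> t0 = \<alpha> t0 \<bullet> ?d"
      using vc x1_in by (simp add: N.m_assoc[symmetric])
    moreover have "?d \<in> V"
    proof -
      obtain wv uv where v: "v = (wv, uv, ones, ones)" using vv(1) by (cases v) auto
      obtain wv' uv' where v': "v' = (wv', uv', ones, ones)" using vv(2) by (cases v') auto
      obtain w u t s where d: "?d = (w, u, t, s)" by (cases ?d)
      have d_in: "?d \<in> carrier N" using vc by simp
      then have mem: "w \<in> Wc" "u \<in> Uc" "t \<in> Tc" "s \<in> Tc" unfolding d by auto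
      have "v' \<bullet> ?d = v" using vc by (simp add: N.m_assoc[symmetric])
      then have "(\<lambda>g. e * t g) = ones" "(\<lambda>g. e * s g) = ones"
        unfolding d unfolding v v' by simp_all
      then have "t = ones" "s = ones" using mem by (simp_all add: TcD)
      then show ?thesis using mem unfolding d by simp
    qed
    ultimately have "?d = \<one>\<^bsub>N\<^esub>" by (rule fix_one[rotated])
    then show "v = v'" using vc by (metis N.inv_closed N.inv_inv N.inv_equality)
  qed
  have "card ?coset = card V" "finite ?coset"
    using finite_Wc finite_Uc by (simp_all add: V_def card_cartesian_product)
  moreover have "\<psi> ` V \<subseteq> ?coset" using in_coset by (rule image_subsetI)
  ultimately have "\<psi> ` V = ?coset"
    using card_image[OF inj] card_subset_eq[of ?coset "\<psi> ` V"] by metis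
  moreover have "iT t1 s1 \<in> ?coset" by (simp add: iT_def)
  ultimately obtain v where v: "v \<in> V" "\<psi> v = iT t1 s1" by (metis imageE)
  have vc: "v \<in> carrier N" using v V_in by blast
  define \<gamma> where "\<gamma> = (\<lambda>y. v \<bullet> \<alpha> y \<bullet> inv\<^bsub>N\<^esub> v)"
  have \<gamma>: "\<gamma> \<in> iso N N" unfolding \<gamma>_def using N.conj_iso[OF vc \<alpha>] .
  obtain \<delta> where \<delta>: "\<delta> \<in> iso N N" "\<And>x. x \<in> carrier N \<Longrightarrow> \<delta> (\<gamma> x) = x" "\<And>x. x \<in> carrier N \<Longrightarrow> \<gamma> (\<delta> x) = x"
    using iso_N_inverse[OF \<gamma>] by blast
  have \<gamma>t0: "\<gamma> t0 = iT t1 s1" using v(2) unfolding \<psi>_def \<gamma>_def .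
  \<comment> \<open>Torus elements commute with \<open>\<gamma> t0\<close>, which is itself in the
    torus. Their preimages therefore commute with \<open>t0\<close> and lie in \<open>T\<close>.
    Equality follows by counting.\<close>
  have "T \<subseteq> \<gamma> ` T"
  proof
    fix y assume y: "y \<in> T"
    have yc: "y \<in> carrier N" using T_in y .
    have "y \<bullet> \<gamma> t0 = \<gamma> t0 \<bullet> y"
      using y iT_commute unfolding \<gamma>t0 T_def by blast
    then have "\<delta> y \<bullet> \<delta> (\<gamma> t0) = \<delta> (\<gamma> t0) \<bullet> \<delta> y"
      using iso_N_D(2)[OF \<delta>(1)] yc iso_N_D(1)[OF \<gamma> t0_in] by metis
    then have "\<delta> y \<bullet> t0 = t0 \<bullet> \<delta> y" unfolding \<delta>(2)[OF t0_in] .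
    then have "\<delta> y \<in> T" using commutes_t0[OF iso_N_D(1)[OF \<delta>(1) yc]] unfolding T_def by blast
    then show "y \<in> \<gamma> ` T" using \<delta>(3)[OF yc] by (metis imageI)
  qed
  then have "\<gamma> ` T = T"
    using card_seteq[of "\<gamma> ` T" T] finite_T card_image_le[OF finite_T, of \<gamma>] by auto
  with vc \<gamma> show ?thesis unfolding \<gamma>_def by blast
qed

section \<open>Automorphisms preserving the torus permute the weight lines\<close>

definition torus_aut where "torus_aut \<alpha> \<longleftrightarrow> \<alpha> \<in> iso N N \<and> \<alpha> ` T = T"

lemma torus_aut_iso: "torus_aut \<alpha> \<Longrightarrow> \<alpha> \<in> iso N N" by (simp add: torus_aut_def)

lemma torus_aut_inverse:
  assumes "torus_aut \<alpha>"
  obtains \<beta> where "torus_aut \<beta>" "\<And>x. x \<in> carrier N \<Longrightarrow> \<beta> (\<alpha> x) = x" "\<And>x. x \<in> carrier N \<Longrightarrow> \<alpha> (\<beta> x) = x"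
proof -
  obtain \<beta> where \<beta>: "\<beta> \<in> iso N N" "\<And>x. x \<in> carrier N \<Longrightarrow> \<beta> (\<alpha> x) = x" "\<And>x. x \<in> carrier N \<Longrightarrow> \<alpha> (\<beta> x) = x"
    using iso_N_inverse[OF torus_aut_iso[OF assms]] by blast
  have "\<beta> ` T = \<beta> ` \<alpha> ` T" using assms by (simp add: torus_aut_def)
  also have "\<dots> = T" using \<beta>(2) T_in by (force simp: image_image)
  finally have "torus_aut \<beta>" using \<beta>(1) by (simp add: torus_aut_def)
  then show ?thesis using that \<beta> by blast
qed

lemma torus_aut_image:
  assumes "torus_aut \<alpha>" "t \<in> Tc" "s \<in> Tc"
  shows "\<exists>t'\<in>Tc. \<exists>s'\<in>Tc. \<alpha> (iT t s) = iT t' s'"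
proof -
  have "iT t s \<in> T" using assms unfolding T_def by blast
  then have "\<alpha> (iT t s) \<in> T" using assms(1) unfolding torus_aut_def by blast
  then show ?thesis unfolding T_def by blast
qed

lemma torus_aut_preimage:
  assumes "torus_aut \<alpha>" "t \<in> Tc" "s \<in> Tc"
  shows "\<exists>t'\<in>Tc. \<exists>s'\<in>Tc. \<alpha> (iT t' s') = iT t s"
proof -
  have "iT t s \<in> \<alpha> ` T" using assms unfolding T_def torus_aut_def by blast
  then obtain x where "x \<in> T" "iT t s = \<alpha> x" by (rule imageE)
  then show ?thesis unfolding T_def by fastforce
qed

text \<open>Being a weight vector is expressed without scalars: multiplication by an element of the
  prime field is a \<open>k\<close>-th power, and every automorphism commutes with powers.\<close>

lemma unit_vec_weight:
  assumes \<alpha>: "torus_aut \<alpha>" and g: "g \<in> C" and ts: "t \<in> Tc" "s \<in> Tc" "t' \<in> Tc" "s' \<in> Tc"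
    and eq: "\<alpha> (iT t' s') = iT t s" and k: "t' g = of_nat k * e"
  shows "iT t s \<bullet> \<alpha> (xel g) = \<alpha> (xel g) [^]\<^bsub>N\<^esub> k \<bullet> iT t s"
proof -
  have i: "\<alpha> \<in> iso N N" using \<alpha> by (rule torus_aut_iso)
  have "(\<lambda>g'. t' g' * unit_vec g e g') = (\<lambda>i. of_nat k * unit_vec g e i)"
    using k by (auto simp: unit_vec_def fun_eq_iff idem mult.assoc)
  then have "iT t' s' \<bullet> xel g = xel g [^]\<^bsub>N\<^esub> k \<bullet> iT t' s'"
    using g ts by (simp add: iT_iU pow_iU)
  then have "\<alpha> (iT t' s' \<bullet> xel g) = \<alpha> (xel g [^]\<^bsub>N\<^esub> k \<bullet> iT t' s')" by simp
  then show ?thesis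
    using iso_N_D(2)[OF i] iso_N_D(4)[OF i] g ts eq by simp
qed

text \<open>The \<open>u\<close>-part of the image is nonzero, since otherwise \<open>xel g\<close>
  would lie in the characteristic subgroup W. The image is again a weight vector for the torus, and
  distinct coordinates of U have distinct weights, so only one coordinate occurs.\<close>

lemma image_unit_vec:
  assumes \<alpha>: "torus_aut \<alpha>" and g: "g \<in> C"
  shows "\<exists>g'\<in>C. \<exists>b\<in>F. b \<noteq> 0 \<and> \<alpha> (xel g) = iU (unit_vec g' b)"
proof -
  have i: "\<alpha> \<in> iso N N" using \<alpha> by (rule torus_aut_iso)
  have "\<alpha> (xel g) \<in> V" using iso_V[OF i X_in[OF g]] g by simp
  then obtain w u where im: "\<alpha> (xel g) = (w, u, ones, ones)" and mem: "w \<in> Wc" "u \<in> Uc"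
    by (cases "\<alpha> (xel g)") auto
  have "u \<noteq> zeros"
  proof
    assume "u = zeros"
    then have "\<alpha> (xel g) = iW w" unfolding im iW_def by simp
    then have eq: "\<alpha> (xel g) = iW w" .
    obtain \<beta> where \<beta>: "\<beta> \<in> iso N N" "\<And>x. x \<in> carrier N \<Longrightarrow> \<beta> (\<alpha> x) = x"
      "\<And>x. x \<in> carrier N \<Longrightarrow> \<alpha> (\<beta> x) = x"
      using iso_N_inverse[OF i] by blast
    obtain w' where w': "\<beta> (iW w) = iW w'"
      using iso_W[OF \<beta>(1) mem(1)] by blast
    have "xel g = iW w'" using \<beta>(2)[OF X_in[OF g]] unfolding eq w' by (rule sym)
    then have "unit_vec g e = zeros" by (simp add: iU_def iW_def)
    then have "unit_vec g e g = 0" by simp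
    then show False by (simp add: unit_vec_def)
  qed
  then obtain g1 where g1: "u g1 \<noteq> 0" by (auto simp: fun_eq_iff)
  then have g1C: "g1 \<in> C" using UcD(2)[OF mem(2)] by blast
  have key: "\<exists>k t' s'. t' \<in> Tc \<and> s' \<in> Tc \<and> \<alpha> (iT t' s') = iT t s \<and> t' g = of_nat k * e \<and>
      (\<forall>h. t h * u h = of_nat k * u h)" if ts: "t \<in> Tc" "s \<in> Tc" for t s
  proof -
    obtain t' s' where ts': "t' \<in> Tc" "s' \<in> Tc" "\<alpha> (iT t' s') = iT t s"
      using torus_aut_preimage[OF \<alpha> ts] by blast
    obtain k where k: "t' g = of_nat k * e" using F_of_nat[OF TcD(1)[OF ts'(1)]] by blast
    obtain w' where "\<alpha> (xel g) [^]\<^bsub>N\<^esub> k = (w', \<lambda>g. of_nat k * u g, ones, ones)"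
      using pow_unipotent[OF mem] unfolding im by blast
    then have "(\<lambda>h. t h * u h) = (\<lambda>h. of_nat k * u h)"
      using unit_vec_weight[OF \<alpha> g ts ts'(1,2,3) k] unfolding im iT_def by simp
    then have "\<forall>h. t h * u h = of_nat k * u h" by (simp add: fun_eq_iff)
    with ts' k show ?thesis by blast
  qed
  have ke: "of_nat k * e = e" if "of_nat k * u h = u h" "u h \<noteq> 0" for k h
  proof (rule F_mult_cancel)
    show "u h * (of_nat k * e) = u h * e"
      using that UcD(1)[OF mem(2), of h] by (simp add: mult.left_commute)
  qed (use that UcD[OF mem(2)] in auto)
  have "u g2 = 0" if "g2 \<noteq> g1" for g2
  proof (rule ccontr)
    assume nz: "u g2 \<noteq> 0"
    have "at_coord g1 zeta \<in> Tc" using g1C zeta by simp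
    then obtain k where k: "\<And>h. at_coord g1 zeta h * u h = of_nat k * u h" using key[OF _ Tc_one] by blast
    have "of_nat k * u g2 = u g2" using k[of g2] that UcD(1)[OF mem(2)] by (simp add: at_coord_def)
    then have "of_nat k * e = e" using ke nz by blast
    then have "of_nat k * u g1 = u g1"
      using UcD(1)[OF mem(2), of g1] by (metis F_e(2) mult.assoc)
    then have "zeta * u g1 = u g1" using k[of g1] by (simp add: at_coord_def)
    then show False using F_fixed_point[OF zeta(1) UcD(1)[OF mem(2)] zeta_neq_e] g1 by blast
  qed
  then have u: "u = unit_vec g1 (u g1)" by (auto simp: unit_vec_def fun_eq_iff)
  \<comment> \<open>The test element has trivial \<open>t\<close>-part, so it fixes the
    \<open>u\<close>-part and the multiplier must be \<open>e\<close>. On W it scales every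
    coordinate by \<open>zeta\<close>, hence \<open>w\<close> vanishes.\<close>
  have w: "w = zeros"
  proof -
    have cz: "const_on zeta \<in> Tc" using zeta by simp
    obtain k t' s' where k: "t' \<in> Tc" "s' \<in> Tc" "\<alpha> (iT t' s') = iT ones (const_on zeta)" "t' g = of_nat k * e"
        "\<And>h. e * u h = of_nat k * u h"
      using key[OF Tc_one cz] by blast
    have "of_nat k * e = e" using ke[of k g1] k(5)[of g1] g1 UcD(1)[OF mem(2)] by simp
    then have "t' g = of_nat 1 * e" using k(4) by simp
    from unit_vec_weight[OF \<alpha> g Tc_one cz k(1,2,3) this]
    have "iT ones (const_on zeta) \<bullet> \<alpha> (xel g) = \<alpha> (xel g) \<bullet> iT ones (const_on zeta)"
      using iso_N_D(1)[OF i X_in[OF g]] by simp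
    then have act: "act zeros ones (const_on zeta) w = w"
      unfolding im iT_def by simp
    show ?thesis
    proof (rule ext, rule ccontr)
      fix i assume nz: "w i \<noteq> 0"
      obtain h g' j where i: "i = (h, g', j)" by (cases i)
      have "h \<in> C" using WcD(2)[OF mem(1)] nz unfolding i by blast
      then have "zeta * e ^ j * w i = w i"
        using act act_torus[OF mem(1), of ones "const_on zeta" h g' j] unfolding i by (simp add: const_on_def)
      then have "zeta * w i = w i" using WcD(1)[OF mem(1)] by (simp add: mult.assoc)
      then show False using F_fixed_point[OF zeta(1) WcD(1)[OF mem(1)] zeta_neq_e] nz by blast
    qed
  qed
  have "\<alpha> (xel g) = iU (unit_vec g1 (u g1))"
    using u unfolding im w by (simp add: iU_def)
  then show ?thesis using g1C g1 UcD(1)[OF mem(2)] by blast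
qed

text \<open>All nonzero coordinates of the image have the weight of the original vector, transported
  by \<open>\<alpha>\<close>. By \<open>weight_inj\<close> they belong to a single basis vector. The
  weight identity is kept in the conclusion because it later identifies which vector this
  is.\<close>

lemma image_basis_vec:
  assumes \<alpha>: "torus_aut \<alpha>" and hgj: "h \<in> C" "g \<in> C" "j \<le> m g h"
  shows "\<exists>h1\<in>C. \<exists>g1\<in>C. \<exists>j1\<le>m g1 h1. \<exists>b\<in>F. b \<noteq> 0 \<and>
    \<alpha> (iW (basis_vec h g j e)) = iW (basis_vec h1 g1 j1 b) \<and>
    (\<forall>t s t' s'. t \<in> Tc \<and> s \<in> Tc \<and> t' \<in> Tc \<and> s' \<in> Tc \<and> \<alpha> (iT t' s') = iT t s \<longrightarrow>
      e * (s h1 * t g1 ^ j1) = e * (s' h * t' g ^ j))"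
proof -
  have i: "\<alpha> \<in> iso N N" using \<alpha> by (rule torus_aut_iso)
  let ?b = "basis_vec h g j"
  have bW: "?b e \<in> Wc" using hgj by simp
  obtain w where w: "w \<in> Wc" "\<alpha> (iW (?b e)) = iW w" using iso_W[OF i bW] by blast
  have weight: "e * (s h1 * t g1 ^ j1) = e * (s' h * t' g ^ j)"
    if ts: "t \<in> Tc" "s \<in> Tc" "t' \<in> Tc" "s' \<in> Tc" "\<alpha> (iT t' s') = iT t s" and nz: "w (h1, g1, j1) \<noteq> 0"
    for t s t' s' h1 g1 j1
  proof -
    let ?l = "e * (s' h * t' g ^ j)"
    have "?l \<in> F" by simp
    then obtain k where k: "?l = of_nat k * e" using F_of_nat by blast
    have "act zeros t' s' (?b e) = (\<lambda>i. of_nat k * ?b e i)"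
      unfolding act_basis_vec[OF hgj F_intros(2)] basis_vec_scale using k by (simp add: mult.commute)
    then have "iT t' s' \<bullet> iW (?b e) = iW (?b e) [^]\<^bsub>N\<^esub> k \<bullet> iT t' s'"
      using bW ts by (simp add: iT_iW pow_iW)
    then have "\<alpha> (iT t' s' \<bullet> iW (?b e)) = \<alpha> (iW (?b e) [^]\<^bsub>N\<^esub> k \<bullet> iT t' s')" by simp
    then have "iT t s \<bullet> iW w = iW w [^]\<^bsub>N\<^esub> k \<bullet> iT t s"
      using iso_N_D(2)[OF i] iso_N_D(4)[OF i] bW ts w by simp
    then have "iW (act zeros t s w) = iW (\<lambda>i. of_nat k * w i)"
      using ts w(1) by (simp add: iT_iW pow_iW)
    then have "act zeros t s w (h1, g1, j1) = of_nat k * w (h1, g1, j1)" by simp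
    then have eq: "s h1 * t g1 ^ j1 * w (h1, g1, j1) = of_nat k * w (h1, g1, j1)"
      by (simp only: act_torus[OF w(1)])
    have wF: "w (h1, g1, j1) \<in> F" by (rule WcD(1)[OF w(1)])
    show ?thesis unfolding k
    proof (rule F_mult_cancel)
      show "w (h1, g1, j1) * (e * (s h1 * t g1 ^ j1)) = w (h1, g1, j1) * (of_nat k * e)"
        using eq wF by (simp add: mult_ac)
    qed (use wF nz in auto)
  qed
  have "w \<noteq> zeros"
  proof
    assume "w = zeros"
    then have "\<alpha> (iW (?b e)) = \<alpha> \<one>\<^bsub>N\<^esub>" using w iso_N_D(5)[OF i] by (simp add: iW_zero)
    then have "iW (?b e) = \<one>\<^bsub>N\<^esub>"
      using iso_N_D(3)[OF i, of "iW (?b e)" "\<one>\<^bsub>N\<^esub>"] bW by simp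
    then have "?b e = zeros" by (simp add: iW_zero[symmetric])
    then have "?b e (h, g, j) = 0" by simp
    then show False by (simp add: basis_vec_apply)
  qed
  then obtain h1 g1 j1 where nz: "w (h1, g1, j1) \<noteq> 0" by (auto simp: fun_eq_iff)
  have in1: "h1 \<in> C" "g1 \<in> C" "j1 \<le> m g1 h1" using WcD(2)[OF w(1) nz] by auto
  have "w = basis_vec h1 g1 j1 (w (h1, g1, j1))"
  proof (rule ext, clarify)
    fix h2 g2 j2
    show "w (h2, g2, j2) = basis_vec h1 g1 j1 (w (h1, g1, j1)) (h2, g2, j2)"
    proof (cases "w (h2, g2, j2) = 0")
      case True
      have "\<not> (h2 = h1 \<and> j2 = j1 \<and> (g2 = g1 \<or> j1 = 0 \<and> g2 \<in> C))"
      proof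
        assume a: "h2 = h1 \<and> j2 = j1 \<and> (g2 = g1 \<or> j1 = 0 \<and> g2 \<in> C)"
        then have "w (h2, g2, j2) = w (h1, g1, j1)"
          using WcD(3)[OF w(1), of g1 h1] WcD(3)[OF w(1), of g2 h1] in1 by auto
        with True nz show False by simp
      qed
      then show ?thesis unfolding True basis_vec_def by (simp only: prod.case if_False)
    next
      case False
      have in2: "h2 \<in> C" "g2 \<in> C" "j2 \<le> m g2 h2" using WcD(2)[OF w(1) False] by auto
      have "e * (s h1 * t g1 ^ j1) = e * (s h2 * t g2 ^ j2)" if ts: "t \<in> Tc" "s \<in> Tc" for t s
      proof -
        obtain t' s' where "t' \<in> Tc" "s' \<in> Tc" "\<alpha> (iT t' s') = iT t s"
          using torus_aut_preimage[OF \<alpha> ts] by blast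
        then show ?thesis using weight[OF ts _ _ _ nz] weight[OF ts _ _ _ False] by metis
      qed
      then have same: "h1 = h2 \<and> j1 = j2 \<and> (g1 = g2 \<or> j1 = 0)"
        using weight_inj[of h1 g1 h2 g2 j1 j2] in1 in2 m_less_p[of g1 h1] m_less_p[of g2 h2] by simp
      then have "w (h2, g2, j2) = w (h1, g1, j1)"
        using WcD(3)[OF w(1), of g1 h1] WcD(3)[OF w(1), of g2 h1] in1 in2 by auto
      with same in2 show ?thesis by (auto simp: basis_vec_def)
    qed
  qed
  moreover have "w (h1, g1, j1) \<in> F" by (rule WcD(1)[OF w(1)])
  ultimately show ?thesis using in1 nz weight[OF _ _ _ _ _ nz] w(2) by metis
qed

text \<open>Induction on the size of the support, subtracting one scaled basis vector at a
  time.\<close>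

lemma Wc_span:
  assumes D: "D \<subseteq> Wc" and add: "\<And>w w'. w \<in> D \<Longrightarrow> w' \<in> D \<Longrightarrow> (\<lambda>i. w i + w' i) \<in> D"
    and basis: "\<And>h g j. h \<in> C \<Longrightarrow> g \<in> C \<Longrightarrow> j \<le> m g h \<Longrightarrow> basis_vec h g j e \<in> D"
    and w: "w \<in> Wc"
  shows "w \<in> D"
proof -
  have scale: "(\<lambda>i. a * w i) \<in> D" if "w \<in> D" "a \<in> F" for a w
    by (rule add_closed_scale[OF D _ that]) (rule add)
  have zero: "zeros \<in> D"
    using scale[OF basis[of \<one> \<one> 0], of 0] by simp
  have fin: "finite {i. w i \<noteq> 0}" if "w \<in> Wc" for w
  proof (rule finite_subset)
    show "{i. w i \<noteq> 0} \<subseteq> C \<times> C \<times> {..<p}"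
    proof (rule subsetI)
      fix i assume nz: "i \<in> {i. w i \<noteq> 0}"
      obtain h g j where i: "i = (h, g, j)" by (cases i)
      have "h \<in> C \<and> g \<in> C \<and> j \<le> m g h" by (rule WcD(2)[OF that]) (use nz i in simp)
      then show "i \<in> C \<times> C \<times> {..<p}"
        using m_less_p[of g h] unfolding i by auto
    qed
  qed (use fin_G in simp)
  show ?thesis using w
  proof (induction "card {i. w i \<noteq> 0}" arbitrary: w rule: less_induct)
    case less
    show ?case
    proof (cases "w = zeros")
      case True
      then show ?thesis using zero by simp
    next
      case False
      then obtain h g j where nz: "w (h, g, j) \<noteq> 0" by (auto simp: fun_eq_iff)
      have hgj: "h \<in> C" "g \<in> C" "j \<le> m g h" using WcD(2)[OF less.prems nz] by auto
      let ?b = "basis_vec h g j (w (h, g, j))"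
      have wF: "w (h, g, j) \<in> F" by (rule WcD(1)[OF less.prems])
      have b: "?b \<in> D"
        using scale[OF basis[OF hgj] wF] unfolding basis_vec_scale using wF by simp
      have sub_in: "(\<lambda>i. w i + - ?b i) \<in> Wc"
        using Wc_add[OF less.prems Wc_uminus[of ?b]] b D by blast
      \<comment> \<open>For \<open>j = 0\<close> the subtracted vector has many entries, but
        \<open>w\<close> agrees with it on all of them by the identification in \<open>Wc\<close>.
        So the subtraction creates no new nonzero coordinate.\<close>
      have "?b i = w i" if "?b i \<noteq> 0" for i
      proof -
        obtain h' g' j' where i: "i = (h', g', j')" by (cases i)
        show ?thesis using that WcD(3)[OF less.prems, of g h] WcD(3)[OF less.prems, of g' h] hgj
          unfolding i basis_vec_def by (auto split: if_splits)
      qed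
      then have "w i + - ?b i \<noteq> 0 \<Longrightarrow> w i \<noteq> 0" for i by (cases "?b i = 0") auto
      then have "{i. w i + - ?b i \<noteq> 0} \<subseteq> {i. w i \<noteq> 0}" by blast
      moreover have "(h, g, j) \<in> {i. w i \<noteq> 0}" "(h, g, j) \<notin> {i. w i + - ?b i \<noteq> 0}"
        using nz by (simp_all add: basis_vec_apply)
      ultimately have "{i. w i + - ?b i \<noteq> 0} \<subset> {i. w i \<noteq> 0}" by blast
      then have "card {i. w i + - ?b i \<noteq> 0} < card {i. w i \<noteq> 0}"
        by (rule psubset_card_mono[OF fin[OF less.prems]])
      from less.hyps[OF this sub_in] have "(\<lambda>i. (w i + - ?b i) + ?b i) \<in> D" using b by (rule add)
      then show ?thesis by simp
    qed
  qed
qed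

lemma Uc_induct:
  assumes u: "u \<in> Uc" and zero: "P zeros"
    and step: "\<And>u g b. u \<in> Uc \<Longrightarrow> g \<in> C \<Longrightarrow> b \<in> F \<Longrightarrow> P u \<Longrightarrow> P (\<lambda>g'. unit_vec g b g' + u g')"
  shows "P u"
proof -
  have "P u" if "finite A" "A \<subseteq> C" "u \<in> Uc" "\<And>g. g \<notin> A \<Longrightarrow> u g = 0" for A u
    using that
  proof (induction A arbitrary: u rule: finite_induct)
    case empty
    then have "u = zeros" by (auto simp: fun_eq_iff)
    then show ?case using zero by simp
  next
    case (insert x A)
    let ?v = "u(x := 0)"
    have v: "?v \<in> Uc" by (rule UcI) (use UcD[OF insert.prems(2)] in auto)
    have "P ?v"
    proof (rule insert.IH[OF _ v])
      show "A \<subseteq> C" using insert.prems by blast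
      show "?v g = 0" if "g \<notin> A" for g using insert.prems(3)[of g] that by auto
    qed
    then have "P (\<lambda>g'. unit_vec x (u x) g' + ?v g')"
      using \<open>P ?v\<close> insert.prems(1) by (intro step[OF v _ UcD(1)[OF insert.prems(2)]]) auto
    moreover have "(\<lambda>g'. unit_vec x (u x) g' + ?v g') = u"
      by (auto simp: unit_vec_def fun_eq_iff)
    ultimately show ?case by simp
  qed
  from this[OF fin_G order_refl u] show ?thesis using UcD(2)[OF u] by blast
qed

lemma basis_vec_0: "g \<in> C \<Longrightarrow> basis_vec h g 0 a = basis_vec h \<one> 0 a"
  by (auto simp: basis_vec_def fun_eq_iff)

text \<open>Vectors further up a chain come from commutators of \<open>V\<close> by torus operations
  and sums, and this property is invariant under automorphisms. \<open>yel h\<close> does not have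
  it, because such elements vanish at \<open>j = 0\<close>.\<close>

lemma image_yel:
  assumes \<alpha>: "torus_aut \<alpha>" and h: "h \<in> C"
  shows "\<exists>h1\<in>C. \<exists>b\<in>F. b \<noteq> 0 \<and> \<alpha> (yel h) = iW (basis_vec h1 \<one> 0 b)"
proof -
  have i: "\<alpha> \<in> iso N N" using \<alpha> by (rule torus_aut_iso)
  obtain \<beta> where \<beta>: "torus_aut \<beta>" "\<And>x. x \<in> carrier N \<Longrightarrow> \<beta> (\<alpha> x) = x" "\<And>x. x \<in> carrier N \<Longrightarrow> \<alpha> (\<beta> x) = x"
    using torus_aut_inverse[OF \<alpha>] by blast
  have i': "\<beta> \<in> iso N N" using \<beta>(1) by (rule torus_aut_iso)
  obtain h1 g1 j1 b where im: "h1 \<in> C" "g1 \<in> C" "j1 \<le> m g1 h1" "b \<in> F" "b \<noteq> 0"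
      "\<alpha> (yel h) = iW (basis_vec h1 g1 j1 b)"
    using image_basis_vec[OF \<alpha> h G.one_closed, of 0] by auto
  have "j1 = 0"
  proof (rule ccontr)
    assume "j1 \<noteq> 0"
    then have j1: "1 \<le> j1" by simp
    \<comment> \<open>\<open>D\<close> consists of the images of those vectors of W that vanish at
      \<open>j = 0\<close>. It contains the commutators and is closed under sums and under the
      torus, as \<open>torus_projection\<close> demands.\<close>
    define D where "D = {w \<in> Wc. \<exists>w'\<in>Wc. (\<forall>h. w' (h, \<one>, 0) = 0) \<and> \<alpha> (iW w') = iW w}"
    have "basis_vec h1 g1 j1 e \<in> D"
    proof (rule torus_projection[OF im(2,1) j1 im(3)])
      show "D \<subseteq> Wc" unfolding D_def by blast
      have V: "\<beta> (xel g1) \<in> V" "\<beta> (yel h1) \<in> V"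
        using iso_V[OF i' X_in[OF im(2)]] iso_V[OF i' Y_in[OF im(1)]] im(1,2) by simp_all
      have cv: "iW (comm_vec g1 h1) \<in> carrier N" using im by simp
      have "\<beta> (iW (comm_vec g1 h1) \<bullet> (yel h1 \<bullet> xel g1)) = \<beta> (xel g1 \<bullet> yel h1)"
        using comm_X_Y[OF im(2,1)] by simp
      then have "\<beta> (iW (comm_vec g1 h1)) \<bullet> (\<beta> (yel h1) \<bullet> \<beta> (xel g1)) = \<beta> (xel g1) \<bullet> \<beta> (yel h1)"
        using iso_N_D(2)[OF i'] cv X_in[OF im(2)] Y_in[OF im(1)] by (metis N.m_closed)
      then obtain w' where w': "w' \<in> Wc" "\<beta> (iW (comm_vec g1 h1)) = iW w'" "\<forall>h. w' (h, \<one>, 0) = 0"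
        using V_commutator[OF V iso_N_D(1)[OF i' cv]] by blast
      have "\<alpha> (iW w') = iW (comm_vec g1 h1)" using \<beta>(3)[OF cv] w'(2) by simp
      then show "comm_vec g1 h1 \<in> D" using w' im unfolding D_def by auto
    next
      fix w1 w2 assume "w1 \<in> D" "w2 \<in> D"
      then obtain w1' w2' where *: "w1 \<in> Wc" "w2 \<in> Wc" "w1' \<in> Wc" "w2' \<in> Wc" "\<forall>h. w1' (h, \<one>, 0) = 0"
          "\<forall>h. w2' (h, \<one>, 0) = 0" "\<alpha> (iW w1') = iW w1" "\<alpha> (iW w2') = iW w2"
        unfolding D_def by blast
      have "\<alpha> (iW w1' \<bullet> iW w2') = iW w1 \<bullet> iW w2"
        using iso_N_D(2)[OF i, of "iW w1'" "iW w2'"] * by simp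
      then have "\<alpha> (iW (\<lambda>i. w1' i + w2' i)) = iW (\<lambda>i. w1 i + w2 i)"
        using * by (simp add: iW_mult)
      then show "(\<lambda>i. w1 i + w2 i) \<in> D"
        unfolding D_def using * by (intro CollectI conjI bexI[of _ "\<lambda>i. w1' i + w2' i"]) simp_all
    next
      fix t s w assume ts: "t \<in> Tc" "s \<in> Tc" and "w \<in> D"
      then obtain w' where *: "w \<in> Wc" "w' \<in> Wc" "\<forall>h. w' (h, \<one>, 0) = 0" "\<alpha> (iW w') = iW w"
        unfolding D_def by blast
      obtain t' s' where ts': "t' \<in> Tc" "s' \<in> Tc" "\<alpha> (iT t' s') = iT t s"
        using torus_aut_preimage[OF \<alpha> ts] by blast
      have "\<alpha> (iT t' s' \<bullet> iW w') = \<alpha> (iW (act zeros t' s' w') \<bullet> iT t' s')"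
        using * ts' by (simp add: iT_iW)
      then have "iT t s \<bullet> iW w = \<alpha> (iW (act zeros t' s' w')) \<bullet> iT t s"
        using iso_N_D(2)[OF i] * ts' by simp
      then have "iW (act zeros t s w) \<bullet> iT t s = \<alpha> (iW (act zeros t' s' w')) \<bullet> iT t s"
        using * ts by (simp add: iT_iW)
      then have "\<alpha> (iW (act zeros t' s' w')) = iW (act zeros t s w)"
        using N.r_cancel[of "iT t s"] * ts ts' iso_N_D(1)[OF i] by simp
      moreover have "\<forall>h. act zeros t' s' w' (h, \<one>, 0) = 0" using * by (simp add: act_torus)
      ultimately show "act zeros t s w \<in> D" unfolding D_def using * act_Wc by blast
    qed
    then obtain w' where w': "w' \<in> Wc" "\<forall>h. w' (h, \<one>, 0) = 0" "\<alpha> (iW w') = iW (basis_vec h1 g1 j1 e)"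
      unfolding D_def by blast
    obtain k where k: "b = of_nat k * e" using F_of_nat[OF im(4)] by blast
    have "\<alpha> (iW w' [^]\<^bsub>N\<^esub> k) = iW (basis_vec h1 g1 j1 e) [^]\<^bsub>N\<^esub> k"
      using iso_N_D(4)[OF i, of "iW w'"] w' by simp
    also have "\<dots> = \<alpha> (yel h)"
      using im k by (simp add: pow_iW basis_vec_scale)
    finally have "iW w' [^]\<^bsub>N\<^esub> k = yel h"
      using iso_N_D(3)[OF i, of "iW w' [^]\<^bsub>N\<^esub> k" "yel h"] w' h by simp
    then have "(\<lambda>i. of_nat k * w' i) = basis_vec h \<one> 0 e"
      using w' by (simp add: pow_iW)
    then have "of_nat k * w' (h, \<one>, 0) = basis_vec h \<one> 0 e (h, \<one>, 0)" by (rule fun_cong)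
    then show False using w'(2) by (simp add: basis_vec_apply)
  qed
  then show ?thesis using im basis_vec_0[OF im(2)] by auto
qed

section \<open>Automorphisms permuting the generators are translations\<close>

definition normal_aut where
  "normal_aut \<alpha> \<sigma> \<tau> \<longleftrightarrow> torus_aut \<alpha> \<and> (\<forall>g\<in>C. \<sigma> g \<in> C \<and> \<alpha> (xel g) = xel (\<sigma> g)) \<and>
     (\<forall>h\<in>C. \<tau> h \<in> C \<and> \<alpha> (yel h) = yel (\<tau> h))"

lemma normal_autD:
  assumes "normal_aut \<alpha> \<sigma> \<tau>"
  shows "torus_aut \<alpha>" "\<alpha> \<in> iso N N" "g \<in> C \<Longrightarrow> \<sigma> g \<in> C" "g \<in> C \<Longrightarrow> \<alpha> (xel g) = xel (\<sigma> g)"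
    "g \<in> C \<Longrightarrow> \<tau> g \<in> C" "g \<in> C \<Longrightarrow> \<alpha> (yel g) = yel (\<tau> g)"
  using assms torus_aut_iso unfolding normal_aut_def by blast+

text \<open>The scalars in the images of the generators are removed by conjugation with a torus
  element; as the torus is abelian, this does not change how the automorphism acts on it.\<close>

lemma normalise:
  assumes \<alpha>: "torus_aut \<alpha>"
  shows "\<exists>x\<in>carrier N. \<exists>\<sigma> \<tau>. normal_aut (\<lambda>y. x \<bullet> \<alpha> y \<bullet> inv\<^bsub>N\<^esub> x) \<sigma> \<tau>"
proof -
  have i: "\<alpha> \<in> iso N N" using \<alpha> by (rule torus_aut_iso)
  obtain \<sigma> b where \<sigma>: "\<And>g. g \<in> C \<Longrightarrow> \<sigma> g \<in> C \<and> b g \<in> F \<and> b g \<noteq> 0 \<and> \<alpha> (xel g) = iU (unit_vec (\<sigma> g) (b g))"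
    using image_unit_vec[OF \<alpha>] by metis
  obtain \<tau> d where \<tau>: "\<And>h. h \<in> C \<Longrightarrow> \<tau> h \<in> C \<and> d h \<in> F \<and> d h \<noteq> 0 \<and> \<alpha> (yel h) = iW (basis_vec (\<tau> h) \<one> 0 (d h))"
    using image_yel[OF \<alpha>] by metis
  \<comment> \<open>On a line over a prime field every vector is a group-theoretic power of any
    nonzero one. So two generators with images on one line would be powers of each other; this gives
    the injectivity of \<open>\<sigma>\<close> and \<open>\<tau>\<close>.\<close>
  have ratio: "\<exists>k. of_nat k * y = x" if xy: "x \<in> F" "y \<in> F" "y \<noteq> 0" for x y
  proof -
    obtain k where "x * Finv y = of_nat k * e" using F_of_nat[of "x * Finv y"] F_intros(7)[OF xy(1)] by blast
    then have "x * (Finv y * y) = of_nat k * (e * y)" by (simp add: mult.assoc[symmetric])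
    then have "of_nat k * y = x" using xy Finv(3)[of y] by simp
    then show ?thesis by blast
  qed
  have "inj_on \<sigma> C"
  proof (rule inj_onI, rule ccontr)
    fix g1 g2 assume g: "g1 \<in> C" "g2 \<in> C" "\<sigma> g1 = \<sigma> g2" "g1 \<noteq> g2"
    obtain k where k: "of_nat k * b g2 = b g1" using ratio \<sigma> g by blast
    have "\<alpha> (xel g2 [^]\<^bsub>N\<^esub> k) = \<alpha> (xel g1)"
      using iso_N_D(4)[OF i X_in[OF g(2)]] \<sigma>[OF g(1)] \<sigma>[OF g(2)] g k by (simp add: pow_iU unit_vec_scale)
    then have "xel g2 [^]\<^bsub>N\<^esub> k = xel g1"
      using iso_N_D(3)[OF i, of "xel g2 [^]\<^bsub>N\<^esub> k" "xel g1"] g by simp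
    then have "(\<lambda>i. of_nat k * unit_vec g2 e i) = unit_vec g1 e" using g by (simp add: pow_iU)
    then have "of_nat k * unit_vec g2 e g1 = unit_vec g1 e g1" by (rule fun_cong)
    then show False using g by (simp add: unit_vec_def)
  qed
  have "inj_on \<tau> C"
  proof (rule inj_onI, rule ccontr)
    fix g1 g2 assume g: "g1 \<in> C" "g2 \<in> C" "\<tau> g1 = \<tau> g2" "g1 \<noteq> g2"
    obtain k where k: "of_nat k * d g2 = d g1" using ratio \<tau> g by blast
    have "\<alpha> (yel g2 [^]\<^bsub>N\<^esub> k) = \<alpha> (yel g1)"
      using iso_N_D(4)[OF i Y_in[OF g(2)]] \<tau>[OF g(1)] \<tau>[OF g(2)] g k by (simp add: pow_iW basis_vec_scale)
    then have "yel g2 [^]\<^bsub>N\<^esub> k = yel g1"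
      using iso_N_D(3)[OF i, of "yel g2 [^]\<^bsub>N\<^esub> k" "yel g1"] g by simp
    then have "(\<lambda>i. of_nat k * basis_vec g2 \<one> 0 e i) = basis_vec g1 \<one> 0 e" using g by (simp add: pow_iW)
    then have "of_nat k * basis_vec g2 \<one> 0 e (g1, \<one>, 0) = basis_vec g1 \<one> 0 e (g1, \<one>, 0)" by (rule fun_cong)
    then show False using g by (simp add: basis_vec_def)
  qed
  \<comment> \<open>The entries at the target coordinates \<open>\<sigma> g\<close> and
    \<open>\<tau> h\<close> cancel the scalars \<open>b g\<close> and \<open>d h\<close>;
    injectivity makes this well defined.\<close>
  define t where "t g = (if g \<in> \<sigma> ` C then Finv (b (inv_into C \<sigma> g)) else e)" for g
  define s where "s g = (if g \<in> \<tau> ` C then Finv (d (inv_into C \<tau> g)) else e)" for g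
  have t\<sigma>: "t (\<sigma> g) = Finv (b g)" if "g \<in> C" for g
    using that \<open>inj_on \<sigma> C\<close> by (simp add: t_def)
  have s\<tau>: "s (\<tau> g) = Finv (d g)" if "g \<in> C" for g
    using that \<open>inj_on \<tau> C\<close> by (simp add: s_def)
  have t: "t \<in> Tc"
  proof (rule TcI)
    fix g
    have "t g \<in> F \<and> t g \<noteq> 0"
    proof (cases "g \<in> \<sigma> ` C")
      case True
      then obtain g' where "g' \<in> C" "g = \<sigma> g'" by blast
      then show ?thesis using t\<sigma>[of g'] \<sigma>[of g'] Finv[of "b g'"] by simp
    qed (simp add: t_def)
    then show "t g \<in> F" "t g \<noteq> 0" by auto
    show "t g = e" if "g \<notin> C"
    proof -
      have "g \<notin> \<sigma> ` C" using that \<sigma> by blast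
      then show ?thesis by (simp add: t_def)
    qed
  qed
  have s: "s \<in> Tc"
  proof (rule TcI)
    fix g
    have "s g \<in> F \<and> s g \<noteq> 0"
    proof (cases "g \<in> \<tau> ` C")
      case True
      then obtain g' where "g' \<in> C" "g = \<tau> g'" by blast
      then show ?thesis using s\<tau>[of g'] \<tau>[of g'] Finv[of "d g'"] by simp
    qed (simp add: s_def)
    then show "s g \<in> F" "s g \<noteq> 0" by auto
    show "s g = e" if "g \<notin> C"
    proof -
      have "g \<notin> \<tau> ` C" using that \<tau> by blast
      then show ?thesis by (simp add: s_def)
    qed
  qed
  let ?x = "iT t s"
  have xc: "?x \<in> carrier N" using t s by simp
  let ?\<gamma> = "\<lambda>y. ?x \<bullet> \<alpha> y \<bullet> inv\<^bsub>N\<^esub> ?x"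
  have "?\<gamma> ` T = \<alpha> ` T"
  proof (rule image_cong[OF refl])
    fix y assume "y \<in> T"
    then have "\<alpha> y \<in> T" using \<alpha> unfolding torus_aut_def by blast
    then obtain t2 s2 where ay: "\<alpha> y = iT t2 s2" "iT t2 s2 \<in> carrier N" using T_in unfolding T_def by blast
    have "?x \<bullet> iT t2 s2 = iT t2 s2 \<bullet> ?x" by (rule iT_commute)
    then show "?\<gamma> y = \<alpha> y"
      using N.commute_conj_eq[OF xc ay(2) ay(2)] unfolding ay(1) by blast
  qed
  then have "torus_aut ?\<gamma>"
    using \<alpha> N.conj_iso[OF xc i] unfolding torus_aut_def by simp
  moreover have "?\<gamma> (xel g) = xel (\<sigma> g)" if g: "g \<in> C" for g
  proof -
    have "?x \<bullet> \<alpha> (xel g) = iU (\<lambda>g'. t g' * unit_vec (\<sigma> g) (b g) g') \<bullet> ?x"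
      using \<sigma>[OF g] t s by (simp add: iT_iU)
    also have "(\<lambda>g'. t g' * unit_vec (\<sigma> g) (b g) g') = unit_vec (\<sigma> g) e"
      using t\<sigma>[OF g] Finv(3)[of "b g"] \<sigma>[OF g] by (auto simp: unit_vec_def fun_eq_iff)
    finally show ?thesis
      using N.commute_conj_eq[OF xc iso_N_D(1)[OF i X_in[OF g]] X_in[of "\<sigma> g"]] \<sigma>[OF g] by blast
  qed
  moreover have "?\<gamma> (yel g) = yel (\<tau> g)" if g: "g \<in> C" for g
  proof -
    have "?x \<bullet> \<alpha> (yel g) = iW (act zeros t s (basis_vec (\<tau> g) \<one> 0 (d g))) \<bullet> ?x"
      using \<tau>[OF g] t s by (simp add: iT_iW)
    also have "act zeros t s (basis_vec (\<tau> g) \<one> 0 (d g)) = basis_vec (\<tau> g) \<one> 0 e"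
      using s\<tau>[OF g] Finv(3)[of "d g"] \<tau>[OF g] by (simp add: act_basis_vec)
    finally show ?thesis
      using N.commute_conj_eq[OF xc iso_N_D(1)[OF i Y_in[OF g]] Y_in[of "\<tau> g"]] \<tau>[OF g] by blast
  qed
  ultimately have "normal_aut ?\<gamma> \<sigma> \<tau>"
    unfolding normal_aut_def using \<sigma> \<tau> by blast
  then show ?thesis using xc by blast
qed

text \<open>The weights of the generators are the coordinates of the torus, so permuting the
  generators forces the same permutation of the torus coordinates.\<close>

lemma normal_weights:
  assumes n: "normal_aut \<alpha> \<sigma> \<tau>" and ts: "t \<in> Tc" "s \<in> Tc" "t' \<in> Tc" "s' \<in> Tc"
    and eq: "\<alpha> (iT t' s') = iT t s" and g: "g \<in> C"
  shows "t (\<sigma> g) = t' g" "s (\<tau> g) = s' g"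
proof -
  note D = normal_autD[OF n]
  obtain k where k: "t' g = of_nat k * e" using F_of_nat[OF TcD(1)[OF ts(3)]] by blast
  have \<sigma>C: "\<sigma> g \<in> C" using D(3) g by blast
  have "iT t s \<bullet> xel (\<sigma> g) = xel (\<sigma> g) [^]\<^bsub>N\<^esub> k \<bullet> iT t s"
    using unit_vec_weight[OF D(1) g ts eq k] unfolding D(4)[OF g] .
  then have "(\<lambda>g'. t g' * unit_vec (\<sigma> g) e g') = (\<lambda>g'. of_nat k * unit_vec (\<sigma> g) e g')"
    using ts \<sigma>C by (simp add: iT_iU pow_iU)
  then have "t (\<sigma> g) * unit_vec (\<sigma> g) e (\<sigma> g) = of_nat k * unit_vec (\<sigma> g) e (\<sigma> g)"
    by (rule fun_cong)
  then show "t (\<sigma> g) = t' g" using k TcD(1)[OF ts(1)] by (simp add: unit_vec_def)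
  obtain h1 g1 j1 b where im: "b \<noteq> 0" "\<alpha> (yel g) = iW (basis_vec h1 g1 j1 b)"
      "e * (s h1 * t g1 ^ j1) = e * (s' g * t' \<one> ^ 0)"
    using image_basis_vec[OF D(1) g G.one_closed, of 0] ts eq by auto
  have "basis_vec (\<tau> g) \<one> 0 e = basis_vec h1 g1 j1 b"
    using im(2) unfolding D(6)[OF g] by simp
  then have "basis_vec (\<tau> g) \<one> 0 e (\<tau> g, \<one>, 0) = basis_vec h1 g1 j1 b (\<tau> g, \<one>, 0)" by simp
  then have "h1 = \<tau> g" "j1 = 0" by (auto simp: basis_vec_def split: if_splits)
  then show "s (\<tau> g) = s' g" using im(3) ts by (simp add: TcD)
qed

text \<open>The last vector of the chain from y_h along x_g is sent to a vector of weight
  \<open>s (\<tau> h) * t (\<sigma> g) ^ m g h\<close>. By \<open>weight_inj\<close> this is a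
  vector of the chain for \<open>\<sigma> g\<close> and \<open>\<tau> h\<close>, which must
  therefore be at least as long.\<close>

lemma normal_m_le:
  assumes n: "normal_aut \<alpha> \<sigma> \<tau>" and g: "g \<in> C" and h: "h \<in> C"
  shows "m g h \<le> m (\<sigma> g) (\<tau> h)"
proof -
  note D = normal_autD[OF n]
  let ?j = "m g h"
  obtain h1 g1 j1 where in1: "h1 \<in> C" "g1 \<in> C" "j1 \<le> m g1 h1" and wt:
      "\<And>t s t' s'. t \<in> Tc \<Longrightarrow> s \<in> Tc \<Longrightarrow> t' \<in> Tc \<Longrightarrow> s' \<in> Tc \<Longrightarrow> \<alpha> (iT t' s') = iT t s \<Longrightarrow>
        e * (s h1 * t g1 ^ j1) = e * (s' h * t' g ^ ?j)"
    using image_basis_vec[OF D(1) h g order_refl] by blast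
  have "e * (s h1 * t g1 ^ j1) = e * (s (\<tau> h) * t (\<sigma> g) ^ ?j)" if ts: "t \<in> Tc" "s \<in> Tc" for t s
  proof -
    obtain t' s' where ts': "t' \<in> Tc" "s' \<in> Tc" "\<alpha> (iT t' s') = iT t s"
      using torus_aut_preimage[OF D(1) ts] by blast
    show ?thesis
      using wt[OF ts ts'] normal_weights(1)[OF n ts ts' g] normal_weights(2)[OF n ts ts' h] by simp
  qed
  then have "h1 = \<tau> h \<and> j1 = ?j \<and> (g1 = \<sigma> g \<or> j1 = 0)"
    using weight_inj[of h1 g1 "\<tau> h" "\<sigma> g" j1 ?j] in1 D(3)[OF g] D(5)[OF h] m_less_p[of g1 h1] m_less_p[OF g h]
    by simp
  \<comment> \<open>The ambiguous case \<open>j1 = 0\<close> of \<open>weight_inj\<close> is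
    excluded because chain lengths are at least 2.\<close>
  then show ?thesis using in1 m_ge_2[OF g h] by auto
qed

text \<open>Once all chain lengths are preserved, injectivity of the colouring turns this into
  \<open>inv (\<sigma> g) \<otimes> \<tau> h = inv g \<otimes> h\<close>. Taking
  \<open>g = \<one>\<close> shows that \<open>\<tau>\<close> is a left translation, taking
  \<open>h = g\<close> shows that \<open>\<sigma>\<close> and \<open>\<tau>\<close> agree.\<close>

lemma normal_shift:
  assumes n: "normal_aut \<alpha> \<sigma> \<tau>"
  shows "\<exists>a\<in>C. \<forall>g\<in>C. \<sigma> g = a \<otimes> g \<and> \<tau> g = a \<otimes> g"
proof -
  note D = normal_autD[OF n]
  have "inj_on \<sigma> C"
  proof (rule inj_onI)
    fix g g' assume g: "g \<in> C" "g' \<in> C" "\<sigma> g = \<sigma> g'"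
    have "\<alpha> (xel g) = \<alpha> (xel g')" unfolding D(4)[OF g(1)] D(4)[OF g(2)] g(3) ..
    then have "xel g = xel g'" by (rule iso_N_D(3)[OF D(2) X_in[OF g(1)] X_in[OF g(2)]])
    then have "unit_vec g e = unit_vec g' e" by (simp only: iU_eq)
    then have "unit_vec g e g = unit_vec g' e g" by (rule fun_cong)
    then show "g = g'" by (simp add: unit_vec_def split: if_splits)
  qed
  moreover have "\<sigma> ` C \<subseteq> C" using D(3) by blast
  ultimately have \<sigma>: "bij_betw \<sigma> C C" using endo_inj_surj[OF fin_G] by (simp add: bij_betw_def)
  have "inj_on \<tau> C"
  proof (rule inj_onI)
    fix g g' assume g: "g \<in> C" "g' \<in> C" "\<tau> g = \<tau> g'"
    have "\<alpha> (yel g) = \<alpha> (yel g')" unfolding D(6)[OF g(1)] D(6)[OF g(2)] g(3) ..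
    then have "yel g = yel g'" by (rule iso_N_D(3)[OF D(2) Y_in[OF g(1)] Y_in[OF g(2)]])
    then have "basis_vec g \<one> 0 e = basis_vec g' \<one> 0 e" by (simp only: iW_eq)
    then have "basis_vec g \<one> 0 e (g, \<one>, 0) = basis_vec g' \<one> 0 e (g, \<one>, 0)" by (rule fun_cong)
    then show "g = g'" by (simp add: basis_vec_def split: if_splits)
  qed
  moreover have "\<tau> ` C \<subseteq> C" using D(5) by blast
  ultimately have \<tau>: "bij_betw \<tau> C C" using endo_inj_surj[OF fin_G] by (simp add: bij_betw_def)
  \<comment> \<open>Reindexing along the bijections leaves the total length unchanged, so none of
    the inequalities from \<open>normal_m_le\<close> can be strict.\<close>
  have "(\<Sum>g\<in>C. \<Sum>h\<in>C. m (\<sigma> g) (\<tau> h)) = (\<Sum>g\<in>C. \<Sum>h\<in>C. m (\<sigma> g) h)"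
    by (rule sum.cong[OF refl]) (rule sum.reindex_bij_betw[OF \<tau>])
  also have "\<dots> = (\<Sum>g\<in>C. \<Sum>h\<in>C. m g h)"
    by (rule sum.reindex_bij_betw[OF \<sigma>])
  finally have total: "(\<Sum>g\<in>C. \<Sum>h\<in>C. m g h) = (\<Sum>g\<in>C. \<Sum>h\<in>C. m (\<sigma> g) (\<tau> h))" by simp
  have "(\<Sum>h\<in>C. m g h) = (\<Sum>h\<in>C. m (\<sigma> g) (\<tau> h))" if "g \<in> C" for g
    by (rule sum_mono_inv[OF total _ that fin_G]) (intro sum_mono normal_m_le[OF n])
  then have "m g h = m (\<sigma> g) (\<tau> h)" if "g \<in> C" "h \<in> C" for g h
    using sum_mono_inv[of "m g" C "\<lambda>h. m (\<sigma> g) (\<tau> h)" h] normal_m_le[OF n] fin_G that by blast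
  then have colour: "inv (\<sigma> g) \<otimes> \<tau> h = inv g \<otimes> h" if "g \<in> C" "h \<in> C" for g h
    using inj_onD[OF c_inj, of "inv (\<sigma> g) \<otimes> \<tau> h" "inv g \<otimes> h"] that D(3)[OF that(1)] D(5)[OF that(2)]
    unfolding m_def by simp
  have tau: "\<tau> h = \<sigma> \<one> \<otimes> h" if "h \<in> C" for h
  proof -
    have "inv (\<sigma> \<one>) \<otimes> \<tau> h = h" using colour[OF G.one_closed that] that by simp
    then show ?thesis using D(3)[OF G.one_closed] D(5)[OF that] that by (metis G.inv_closed G.inv_inv G.inv_solve_left)
  qed
  have "\<sigma> g = \<tau> g" if "g \<in> C" for g
  proof -
    have "inv (\<sigma> g) \<otimes> \<tau> g = \<one>" using colour[OF that that] that by simp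
    then show ?thesis using D(3)[OF that] D(5)[OF that] by (metis G.inv_closed G.inv_equality G.inv_inv)
  qed
  then have "\<forall>g\<in>C. \<sigma> g = \<sigma> \<one> \<otimes> g \<and> \<tau> g = \<sigma> \<one> \<otimes> g"
    using tau by metis
  then show ?thesis using D(3)[OF G.one_closed] by blast
qed

section \<open>Every automorphism is a translation up to conjugation\<close>

lemma Phi_iT: "t \<in> Tc \<Longrightarrow> s \<in> Tc \<Longrightarrow> Phi a (iT t s) = iT (shift_F e a t) (shift_F e a s)"
  by (simp add: iT_def Phi_apply) (auto simp: shift_W_def shift_F_def fun_eq_iff)

lemma inv_mult_eq_iff: "a \<in> C \<Longrightarrow> g \<in> C \<Longrightarrow> g' \<in> C \<Longrightarrow> inv a \<otimes> g' = g \<longleftrightarrow> g' = a \<otimes> g"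
  by (metis G.inv_closed G.inv_inv G.inv_solve_left G.m_closed)

lemma Phi_xel:
  assumes "a \<in> C" "g \<in> C" shows "Phi a (xel g) = xel (a \<otimes> g)"
proof -
  have "shift_F 0 a (unit_vec g e) = unit_vec (a \<otimes> g) e"
    using assms by (auto simp: shift_F_def unit_vec_def fun_eq_iff inv_mult_eq_iff)
  moreover have "shift_W a zeros = zeros" "shift_F e a ones = ones"
    by (auto simp: shift_W_def shift_F_def fun_eq_iff)
  moreover have "xel g \<in> carrier N" using assms by simp
  ultimately show ?thesis unfolding iU_def by (simp add: Phi_apply)
qed

lemma Phi_yel:
  assumes "a \<in> C" "h \<in> C" shows "Phi a (yel h) = yel (a \<otimes> h)"
proof -
  have "shift_W a (basis_vec h \<one> 0 e) = basis_vec (a \<otimes> h) \<one> 0 e"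
    using assms by (auto simp: shift_W_def basis_vec_def fun_eq_iff inv_mult_eq_iff)
  moreover have "shift_F 0 a zeros = zeros" "shift_F e a ones = ones"
    by (auto simp: shift_F_def fun_eq_iff)
  moreover have "yel h \<in> carrier N" using assms by simp
  ultimately show ?thesis unfolding iW_def by (simp add: Phi_apply)
qed

lemma Phi_iso: "a \<in> C \<Longrightarrow> Phi a \<in> iso N N"
  using Phi_auto[of a] by (simp add: auto_def Bij_def iso_def)

text \<open>Two automorphisms that agree on the torus and on all \<open>xel g\<close> and
  \<open>yel h\<close> agree everywhere, because these elements generate \<open>N\<close>.\<close>

lemma normal_eq_Phi:
  assumes n: "normal_aut \<alpha> \<sigma> \<tau>" and a: "a \<in> C" and \<sigma>\<tau>: "\<And>g. g \<in> C \<Longrightarrow> \<sigma> g = a \<otimes> g \<and> \<tau> g = a \<otimes> g"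
    and y: "y \<in> carrier N"
  shows "\<alpha> y = Phi a y"
proof -
  note D = normal_autD[OF n]
  have \<Phi>: "Phi a \<in> iso N N" using a by (rule Phi_iso)
  have T: "\<alpha> (iT t s) = Phi a (iT t s)" if ts: "t \<in> Tc" "s \<in> Tc" for t s
  proof -
    obtain t1 s1 where ts1: "t1 \<in> Tc" "s1 \<in> Tc" "\<alpha> (iT t s) = iT t1 s1"
      using torus_aut_image[OF D(1) ts] by blast
    have "t1 g = shift_F e a t g \<and> s1 g = shift_F e a s g" for g
    proof (cases "g \<in> C")
      case True
      then have g': "inv a \<otimes> g \<in> C" "a \<otimes> (inv a \<otimes> g) = g"
        using a by (auto simp: G.m_assoc[symmetric])
      then show ?thesis
        using normal_weights[OF n ts1(1,2) ts ts1(3) g'(1)] \<sigma>\<tau>[OF g'(1)] True by (simp add: shift_F_def)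
    qed (simp add: shift_F_def TcD(3) ts1)
    then have "t1 = shift_F e a t" "s1 = shift_F e a s" by auto
    then show ?thesis using ts1(3) Phi_iT[OF ts] by simp
  qed
  have X: "\<alpha> (xel g) = Phi a (xel g)" if "g \<in> C" for g
    using D(4)[OF that] \<sigma>\<tau>[OF that] Phi_xel[OF a that] by simp
  have Y: "\<alpha> (yel g) = Phi a (yel g)" if "g \<in> C" for g
    using D(6)[OF that] \<sigma>\<tau>[OF that] Phi_yel[OF a that] by simp
  \<comment> \<open>The part of W on which both maps agree. It is closed under sums and the torus
    and contains all commutators, so \<open>torus_projection\<close> supplies the chain
    vectors.\<close>
  define E where "E = {w \<in> Wc. \<alpha> (iW w) = Phi a (iW w)}"
  have E_add: "(\<lambda>i. w i + w' i) \<in> E" if "w \<in> E" "w' \<in> E" for w w'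
  proof -
    have w: "w \<in> Wc" "w' \<in> Wc" "\<alpha> (iW w) = Phi a (iW w)" "\<alpha> (iW w') = Phi a (iW w')"
      using that unfolding E_def by auto
    then have "\<alpha> (iW w \<bullet> iW w') = Phi a (iW w \<bullet> iW w')"
      using iso_N_D(2)[OF D(2), of "iW w" "iW w'"] iso_N_D(2)[OF \<Phi>, of "iW w" "iW w'"] by simp
    then show ?thesis using w unfolding E_def by (simp add: iW_mult)
  qed
  have E_tor: "act zeros t s w \<in> E" if ts: "t \<in> Tc" "s \<in> Tc" and "w \<in> E" for t s w
  proof -
    have w: "w \<in> Wc" "\<alpha> (iW w) = Phi a (iW w)" using that unfolding E_def by auto
    let ?t = "iT t s" and ?w' = "iW (act zeros t s w)"
    have c: "?t \<in> carrier N" "?w' \<in> carrier N" "iW w \<in> carrier N" using ts w by simp_all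
    have eq: "?t \<bullet> iW w = ?w' \<bullet> ?t" using iT_iW ts w by blast
    have "\<alpha> ?w' \<bullet> \<alpha> ?t = \<alpha> ?t \<bullet> \<alpha> (iW w)"
      using iso_N_D(2)[OF D(2) c(2) c(1)] iso_N_D(2)[OF D(2) c(1) c(3)] eq by simp
    also have "\<dots> = Phi a ?w' \<bullet> \<alpha> ?t"
      using iso_N_D(2)[OF \<Phi> c(2) c(1)] iso_N_D(2)[OF \<Phi> c(1) c(3)] eq T[OF ts] w(2) by simp
    finally have "\<alpha> ?w' = Phi a ?w'"
      using N.r_cancel iso_N_D(1)[OF D(2) c(1)] iso_N_D(1)[OF D(2) c(2)] iso_N_D(1)[OF \<Phi> c(2)] by blast
    then show ?thesis using w unfolding E_def by simp
  qed
  have E_comm: "comm_vec g h \<in> E" if gh: "g \<in> C" "h \<in> C" for g h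
  proof -
    let ?c = "iW (comm_vec g h)"
    have c: "?c \<in> carrier N" "xel g \<in> carrier N" "yel h \<in> carrier N" "yel h \<bullet> xel g \<in> carrier N"
      using gh by simp_all
    note eq = comm_X_Y[OF gh]
    have "\<alpha> ?c \<bullet> \<alpha> (yel h \<bullet> xel g) = \<alpha> (xel g) \<bullet> \<alpha> (yel h)"
      using iso_N_D(2)[OF D(2) c(1) c(4)] iso_N_D(2)[OF D(2) c(2) c(3)] eq by simp
    also have "\<dots> = Phi a ?c \<bullet> Phi a (yel h \<bullet> xel g)"
      using iso_N_D(2)[OF \<Phi> c(1) c(4)] iso_N_D(2)[OF \<Phi> c(2) c(3)] eq X Y gh by simp
    also have "Phi a (yel h \<bullet> xel g) = \<alpha> (yel h \<bullet> xel g)"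
      using iso_N_D(2)[OF \<Phi> c(3) c(2)] iso_N_D(2)[OF D(2) c(3) c(2)] X Y gh by simp
    finally have "\<alpha> ?c = Phi a ?c"
      using N.r_cancel iso_N_D(1)[OF D(2) c(4)] iso_N_D(1)[OF D(2) c(1)] iso_N_D(1)[OF \<Phi> c(1)] by blast
    then show ?thesis using gh unfolding E_def by simp
  qed
  have sub: "E \<subseteq> Wc" unfolding E_def by blast
  have E_basis: "basis_vec h g j e \<in> E" if hgj: "h \<in> C" "g \<in> C" "j \<le> m g h" for h g j
  proof (cases "j = 0")
    case True
    then show ?thesis using Y[OF hgj(1)] hgj basis_vec_0[OF hgj(2)] unfolding E_def by simp
  next
    case False
    then have j: "1 \<le> j" by simp
    show ?thesis
      by (rule torus_projection[OF hgj(2,1) j hgj(3) sub E_comm[OF hgj(2,1)]]) (fact E_add, fact E_tor)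
  qed
  have W: "\<alpha> (iW w) = Phi a (iW w)" if "w \<in> Wc" for w
  proof -
    have "w \<in> E" by (rule Wc_span[OF sub _ _ that]) (fact E_add, fact E_basis)
    then show ?thesis unfolding E_def by blast
  qed
  have U: "\<alpha> (iU u) = Phi a (iU u)" if "u \<in> Uc" for u
    using that
  proof (rule Uc_induct)
    show "\<alpha> (iU zeros) = Phi a (iU zeros)"
      using iso_N_D(5)[OF D(2)] iso_N_D(5)[OF \<Phi>] by (simp add: iU_zero)
    fix u g b assume u: "u \<in> Uc" and g: "g \<in> C" and b: "b \<in> F" and IH: "\<alpha> (iU u) = Phi a (iU u)"
    obtain k where k: "b = of_nat k * e" using F_of_nat[OF b] by blast
    have c: "xel g [^]\<^bsub>N\<^esub> k \<in> carrier N" "iU u \<in> carrier N" "xel g \<in> carrier N" using g u by simp_all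
    have "iU (\<lambda>g'. unit_vec g b g' + u g') = xel g [^]\<^bsub>N\<^esub> k \<bullet> iU u"
      using g u k by (simp add: pow_iU unit_vec_scale iU_mult)
    then show "\<alpha> (iU (\<lambda>g'. unit_vec g b g' + u g')) = Phi a (iU (\<lambda>g'. unit_vec g b g' + u g'))"
      using iso_N_D(2)[OF D(2) c(1) c(2)] iso_N_D(2)[OF \<Phi> c(1) c(2)]
        iso_N_D(4)[OF D(2) c(3), of k] iso_N_D(4)[OF \<Phi> c(3), of k] X[OF g] IH by simp
  qed
  obtain w u t s where ye: "y = (w, u, t, s)" by (cases y)
  have mem: "w \<in> Wc" "u \<in> Uc" "t \<in> Tc" "s \<in> Tc" using y unfolding ye by auto
  have c: "iW w \<in> carrier N" "iU u \<in> carrier N" "iT t s \<in> carrier N" "iU u \<bullet> iT t s \<in> carrier N"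
    using mem by simp_all
  have "y = iW w \<bullet> (iU u \<bullet> iT t s)" using decompose y unfolding ye by blast
  then show ?thesis
    using iso_N_D(2)[OF D(2) c(1) c(4)] iso_N_D(2)[OF D(2) c(2) c(3)]
      iso_N_D(2)[OF \<Phi> c(1) c(4)] iso_N_D(2)[OF \<Phi> c(2) c(3)] W[OF mem(1)] U[OF mem(2)] T[OF mem(3,4)]
    by simp
qed

theorem aut_classification:
  assumes \<alpha>: "\<alpha> \<in> iso N N"
  shows "\<exists>a\<in>C. \<exists>x\<in>carrier N. \<forall>y\<in>carrier N. x \<bullet> \<alpha> y \<bullet> inv\<^bsub>N\<^esub> x = Phi a y"
proof -
  obtain v where v: "v \<in> carrier N" and \<gamma>: "torus_aut (\<lambda>y. v \<bullet> \<alpha> y \<bullet> inv\<^bsub>N\<^esub> v)"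
    using iso_torus[OF \<alpha>] unfolding torus_aut_def by blast
  obtain x \<sigma> \<tau> where x: "x \<in> carrier N" and
      n: "normal_aut (\<lambda>y. x \<bullet> (v \<bullet> \<alpha> y \<bullet> inv\<^bsub>N\<^esub> v) \<bullet> inv\<^bsub>N\<^esub> x) \<sigma> \<tau>"
    using normalise[OF \<gamma>] by blast
  obtain a where a: "a \<in> C" "\<And>g. g \<in> C \<Longrightarrow> \<sigma> g = a \<otimes> g \<and> \<tau> g = a \<otimes> g"
    using normal_shift[OF n] by blast
  have "(x \<bullet> v) \<bullet> \<alpha> y \<bullet> inv\<^bsub>N\<^esub> (x \<bullet> v) = Phi a y" if y: "y \<in> carrier N" for y
    using normal_eq_Phi[OF n a y] x v iso_N_D(1)[OF \<alpha> y] by (simp add: N.inv_mult_group N.m_assoc)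
  moreover have "x \<bullet> v \<in> carrier N" using x v by simp
  ultimately show ?thesis using a(1) by blast
qed

end

section \<open>Groups with a split outer automorphism group\<close>

lemma AutoGroup_mult:
  assumes "f \<in> auto N" "g \<in> auto N"
  shows "f \<otimes>\<^bsub>AutoGroup N\<^esub> g = compose (carrier N) f g"
  using assms by (simp add: AutoGroup_def BijGroup_def auto_def)

lemma carrier_AutoGroup: "carrier (AutoGroup N) = auto N"
  by (simp add: AutoGroup_def)

lemma auto_iff: "f \<in> auto N \<longleftrightarrow> f \<in> iso N N \<and> f \<in> extensional (carrier N)"
  by (auto simp: auto_def iso_def Bij_def)

text \<open>The group \<open>N\<close> is a copy of \<open>M\<close> along \<open>b\<close>; it will be realised on the natural numbers.
  The sets \<open>D\<close> serve to bound the index of a subgroup on which \<open>\<phi> a\<close> acts trivially modulo \<open>V\<close>.\<close>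
locale split_automorphisms = M: group M + N: group N + G: group G
  for M :: "('m, 'x) monoid_scheme" (structure) and N :: "('n, 'y) monoid_scheme" and G :: "('a, 'z) monoid_scheme" +
  fixes b :: "'m \<Rightarrow> 'n" and \<phi> :: "'a \<Rightarrow> 'm \<Rightarrow> 'm" and V :: "'m set" and q :: nat
  assumes b_iso: "b \<in> iso M N"
    and fin_M: "finite (carrier M)" and fin_G: "finite (carrier G)"
    and center_M: "center M = {\<one>}"
    and phi_iso: "a \<in> carrier G \<Longrightarrow> \<phi> a \<in> iso M M"
    and phi_mult: "a \<in> carrier G \<Longrightarrow> a' \<in> carrier G \<Longrightarrow> x \<in> carrier M \<Longrightarrow> \<phi> (a \<otimes>\<^bsub>G\<^esub> a') x = \<phi> a (\<phi> a' x)"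
    and classification: "\<alpha> \<in> iso M M \<Longrightarrow>
      \<exists>a\<in>carrier G. \<exists>x\<in>carrier M. \<forall>y\<in>carrier M. x \<otimes> \<alpha> y \<otimes> inv x = \<phi> a y"
    and V_normal: "V \<lhd> M"
    and V_pow: "x \<in> carrier M \<Longrightarrow> x \<in> V \<longleftrightarrow> x [^] q = \<one>"
    and V_comm: "x \<in> carrier M \<Longrightarrow> y \<in> carrier M \<Longrightarrow> \<exists>v\<in>V. x \<otimes> y = v \<otimes> (y \<otimes> x)"
    and cop: "coprime q (order G)"
    and moved: "a \<in> carrier G \<Longrightarrow> a \<noteq> \<one>\<^bsub>G\<^esub> \<Longrightarrow> \<exists>D\<subseteq>carrier M. order G < card D \<and>
      (\<forall>d\<in>D. \<forall>d'\<in>D. d \<noteq> d' \<longrightarrow> \<phi> a (inv d \<otimes> d') \<otimes> inv (inv d \<otimes> d') \<notin> V)"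
begin

section \<open>Aut N as a semidirect product of Inn N and G\<close>

abbreviation A where "A \<equiv> AutoGroup N"

definition b' where "b' = inv_into (carrier M) b"

lemma b: "x \<in> carrier M \<Longrightarrow> b x \<in> carrier N" "x \<in> carrier M \<Longrightarrow> b' (b x) = x"
    "y \<in> carrier N \<Longrightarrow> b' y \<in> carrier M" "y \<in> carrier N \<Longrightarrow> b (b' y) = y"
    "x \<in> carrier M \<Longrightarrow> z \<in> carrier M \<Longrightarrow> b (x \<otimes> z) = b x \<otimes>\<^bsub>N\<^esub> b z"
    "b ` carrier M = carrier N"
proof -
  have bb: "bij_betw b (carrier M) (carrier N)" "b \<in> hom M N" using b_iso by (auto simp: iso_def)
  show "x \<in> carrier M \<Longrightarrow> b x \<in> carrier N" "x \<in> carrier M \<Longrightarrow> z \<in> carrier M \<Longrightarrow> b (x \<otimes> z) = b x \<otimes>\<^bsub>N\<^esub> b z"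
    using bb(2) by (auto simp: hom_def)
  show "b ` carrier M = carrier N" "x \<in> carrier M \<Longrightarrow> b' (b x) = x"
      "y \<in> carrier N \<Longrightarrow> b' y \<in> carrier M" "y \<in> carrier N \<Longrightarrow> b (b' y) = y"
    using bb(1) unfolding b'_def bij_betw_def by (auto simp: inv_into_f_f f_inv_into_f inv_into_into)
qed

lemma b'_iso: "b' \<in> iso N M"
  unfolding b'_def by (rule M.iso_set_sym[OF b_iso])

lemma b_inv: "x \<in> carrier M \<Longrightarrow> b (inv x) = inv\<^bsub>N\<^esub> (b x)"
proof -
  interpret h: group_hom M N b
    using b_iso by (simp add: group_hom_def group_hom_axioms_def iso_def M.is_group N.is_group)
  show "x \<in> carrier M \<Longrightarrow> b (inv x) = inv\<^bsub>N\<^esub> (b x)" by (rule h.hom_inv)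
qed

lemma phi_in: "a \<in> carrier G \<Longrightarrow> x \<in> carrier M \<Longrightarrow> \<phi> a x \<in> carrier M"
  using phi_iso[of a] by (auto simp: iso_def hom_def)

lemma phi_hom: "a \<in> carrier G \<Longrightarrow> x \<in> carrier M \<Longrightarrow> y \<in> carrier M \<Longrightarrow> \<phi> a (x \<otimes> y) = \<phi> a x \<otimes> \<phi> a y"
  using phi_iso[of a] by (auto simp: iso_def hom_def)

lemma phi_inv: "a \<in> carrier G \<Longrightarrow> x \<in> carrier M \<Longrightarrow> \<phi> a (inv x) = inv (\<phi> a x)"
proof -
  assume a: "a \<in> carrier G"
  interpret h: group_hom M M "\<phi> a"
    using phi_iso[OF a] by (simp add: group_hom_def group_hom_axioms_def iso_def M.is_group)
  show "x \<in> carrier M \<Longrightarrow> \<phi> a (inv x) = inv (\<phi> a x)" by (rule h.hom_inv)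
qed

definition \<iota> where "\<iota> x = (\<lambda>y\<in>carrier N. b x \<otimes>\<^bsub>N\<^esub> y \<otimes>\<^bsub>N\<^esub> inv\<^bsub>N\<^esub> (b x))"
definition \<psi> where "\<psi> a = (\<lambda>y\<in>carrier N. b (\<phi> a (b' y)))"

sublocale A: group A by (rule N.AutoGroup)

lemma inn_eq: "inn N = \<iota> ` carrier M"
  unfolding inn_def \<iota>_def b(6)[symmetric] image_image ..

lemma iso_restrict: "f \<in> iso N N \<Longrightarrow> restrict f (carrier N) \<in> carrier A"
  unfolding carrier_AutoGroup auto_def Bij_def iso_def hom_def
  by (auto simp: bij_betw_def inj_on_def)

lemma \<iota>_in: "x \<in> carrier M \<Longrightarrow> \<iota> x \<in> carrier A"
proof -
  assume x: "x \<in> carrier M"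
  have "inj_on (\<lambda>y. b x \<otimes>\<^bsub>N\<^esub> y \<otimes>\<^bsub>N\<^esub> inv\<^bsub>N\<^esub> b x) (carrier N)"
    using b(1)[OF x] by (intro inj_onI) simp
  moreover have "y \<in> (\<lambda>y. b x \<otimes>\<^bsub>N\<^esub> y \<otimes>\<^bsub>N\<^esub> inv\<^bsub>N\<^esub> b x) ` carrier N" if "y \<in> carrier N" for y
  proof (rule image_eqI)
    have "b x \<otimes>\<^bsub>N\<^esub> (inv\<^bsub>N\<^esub> b x \<otimes>\<^bsub>N\<^esub> y) = y" using b(1)[OF x] that by (simp add: N.m_assoc[symmetric])
    then show "y = b x \<otimes>\<^bsub>N\<^esub> (inv\<^bsub>N\<^esub> b x \<otimes>\<^bsub>N\<^esub> y \<otimes>\<^bsub>N\<^esub> b x) \<otimes>\<^bsub>N\<^esub> inv\<^bsub>N\<^esub> b x"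
      using b(1)[OF x] that by (simp add: N.m_assoc)
  qed (use b(1)[OF x] that in simp)
  ultimately have "bij_betw (\<lambda>y. b x \<otimes>\<^bsub>N\<^esub> y \<otimes>\<^bsub>N\<^esub> inv\<^bsub>N\<^esub> b x) (carrier N) (carrier N)"
    using b(1)[OF x] by (auto simp: bij_betw_def)
  moreover have "(\<lambda>y. b x \<otimes>\<^bsub>N\<^esub> y \<otimes>\<^bsub>N\<^esub> inv\<^bsub>N\<^esub> b x) \<in> hom N N"
  proof (rule homI)
    fix y z assume yz: "y \<in> carrier N" "z \<in> carrier N"
    have "inv\<^bsub>N\<^esub> b x \<otimes>\<^bsub>N\<^esub> (b x \<otimes>\<^bsub>N\<^esub> (z \<otimes>\<^bsub>N\<^esub> inv\<^bsub>N\<^esub> b x)) = z \<otimes>\<^bsub>N\<^esub> inv\<^bsub>N\<^esub> b x"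
      using b(1)[OF x] yz by (simp add: N.m_assoc[symmetric])
    then show "b x \<otimes>\<^bsub>N\<^esub> (y \<otimes>\<^bsub>N\<^esub> z) \<otimes>\<^bsub>N\<^esub> inv\<^bsub>N\<^esub> b x =
        b x \<otimes>\<^bsub>N\<^esub> y \<otimes>\<^bsub>N\<^esub> inv\<^bsub>N\<^esub> b x \<otimes>\<^bsub>N\<^esub> (b x \<otimes>\<^bsub>N\<^esub> z \<otimes>\<^bsub>N\<^esub> inv\<^bsub>N\<^esub> b x)"
      using b(1)[OF x] yz by (simp add: N.m_assoc)
  qed (use b(1)[OF x] in simp)
  ultimately show ?thesis unfolding \<iota>_def by (intro iso_restrict) (simp add: iso_def)
qed

lemma \<psi>_in: "a \<in> carrier G \<Longrightarrow> \<psi> a \<in> carrier A"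
proof -
  assume a: "a \<in> carrier G"
  have "b \<circ> \<phi> a \<circ> b' \<in> iso N N"
    by (rule iso_set_trans[OF b'_iso iso_set_trans[OF phi_iso[OF a] b_iso]])
  then show ?thesis unfolding \<psi>_def using iso_restrict[of "b \<circ> \<phi> a \<circ> b'"] by (simp add: comp_def)
qed

lemma A_ext:
  assumes "f \<in> carrier A" "g \<in> carrier A" "\<And>y. y \<in> carrier N \<Longrightarrow> f y = g y"
  shows "f = g"
  using assms unfolding carrier_AutoGroup auto_iff by (intro extensionalityI) auto

lemma A_mult_apply:
  "f \<in> carrier A \<Longrightarrow> g \<in> carrier A \<Longrightarrow> y \<in> carrier N \<Longrightarrow> (f \<otimes>\<^bsub>A\<^esub> g) y = f (g y)"
  unfolding carrier_AutoGroup by (simp add: AutoGroup_mult compose_def)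

lemma \<iota>_apply: "y \<in> carrier N \<Longrightarrow> \<iota> x y = b x \<otimes>\<^bsub>N\<^esub> y \<otimes>\<^bsub>N\<^esub> inv\<^bsub>N\<^esub> (b x)"
  by (simp add: \<iota>_def)

lemma \<psi>_apply: "y \<in> carrier N \<Longrightarrow> \<psi> a y = b (\<phi> a (b' y))"
  by (simp add: \<psi>_def)

lemma \<iota>_mult:
  assumes "x \<in> carrier M" "z \<in> carrier M" shows "\<iota> (x \<otimes> z) = \<iota> x \<otimes>\<^bsub>A\<^esub> \<iota> z"
proof (rule A_ext)
  fix y assume y: "y \<in> carrier N"
  show "\<iota> (x \<otimes> z) y = (\<iota> x \<otimes>\<^bsub>A\<^esub> \<iota> z) y"
    using assms y b(1)[OF assms(1)] b(1)[OF assms(2)]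
    by (simp add: A_mult_apply \<iota>_in \<iota>_apply b(5) N.inv_mult_group N.m_assoc)
qed (use assms \<iota>_in in auto)

lemma \<psi>_mult:
  assumes "a \<in> carrier G" "c \<in> carrier G" shows "\<psi> (a \<otimes>\<^bsub>G\<^esub> c) = \<psi> a \<otimes>\<^bsub>A\<^esub> \<psi> c"
proof (rule A_ext)
  fix y assume y: "y \<in> carrier N"
  then show "\<psi> (a \<otimes>\<^bsub>G\<^esub> c) y = (\<psi> a \<otimes>\<^bsub>A\<^esub> \<psi> c) y"
    using assms b(3)[OF y] phi_in by (simp add: A_mult_apply \<psi>_in \<psi>_apply b(1,2) phi_mult)
qed (use assms \<psi>_in in auto)

text \<open>The commutation rule of a semidirect product: an automorphism carries conjugation by an
  element to conjugation by the image of that element.\<close>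

lemma \<psi>_\<iota>:
  assumes "a \<in> carrier G" "x \<in> carrier M"
  shows "\<psi> a \<otimes>\<^bsub>A\<^esub> \<iota> x = \<iota> (\<phi> a x) \<otimes>\<^bsub>A\<^esub> \<psi> a"
proof (rule A_ext)
  fix y assume y: "y \<in> carrier N"
  define z where "z = b' y"
  have z: "z \<in> carrier M" "y = b z" using b(3,4)[OF y] by (auto simp: z_def)
  have zx: "x \<otimes> z \<otimes> inv x \<in> carrier M" using z assms by simp
  have "\<iota> x y = b (x \<otimes> z \<otimes> inv x)"
    using assms z y by (simp add: \<iota>_apply b(5) b_inv)
  then have "(\<psi> a \<otimes>\<^bsub>A\<^esub> \<iota> x) y = b (\<phi> a (x \<otimes> z \<otimes> inv x))"
    using assms y zx by (simp add: A_mult_apply \<psi>_in \<iota>_in \<psi>_apply b(1,2))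
  also have "\<dots> = b (\<phi> a x) \<otimes>\<^bsub>N\<^esub> b (\<phi> a z) \<otimes>\<^bsub>N\<^esub> inv\<^bsub>N\<^esub> b (\<phi> a x)"
    using assms z phi_in[OF assms(1)] by (simp add: phi_hom phi_inv b(5) b_inv)
  also have "\<dots> = (\<iota> (\<phi> a x) \<otimes>\<^bsub>A\<^esub> \<psi> a) y"
    using assms z y phi_in[OF assms(1)] by (simp add: A_mult_apply \<psi>_in \<iota>_in \<psi>_apply \<iota>_apply b(1,2))
  finally show "(\<psi> a \<otimes>\<^bsub>A\<^esub> \<iota> x) y = (\<iota> (\<phi> a x) \<otimes>\<^bsub>A\<^esub> \<psi> a) y" .
qed (use assms \<iota>_in \<psi>_in phi_in in auto)

lemma A_decompose:
  assumes \<alpha>: "\<alpha> \<in> carrier A"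
  shows "\<exists>a\<in>carrier G. \<exists>x\<in>carrier M. \<alpha> = \<iota> x \<otimes>\<^bsub>A\<^esub> \<psi> a"
proof -
  have \<alpha>i: "\<alpha> \<in> iso N N" using \<alpha> unfolding carrier_AutoGroup auto_iff by blast
  have \<alpha>_in: "\<alpha> y \<in> carrier N" if "y \<in> carrier N" for y using \<alpha>i that by (auto simp: iso_def hom_def)
  let ?\<beta> = "b' \<circ> \<alpha> \<circ> b"
  have "?\<beta> \<in> iso M M"
    by (rule iso_set_trans[OF b_iso iso_set_trans[OF \<alpha>i b'_iso]])
  then obtain a x where a: "a \<in> carrier G" and x: "x \<in> carrier M"
      and eq: "\<And>y. y \<in> carrier M \<Longrightarrow> x \<otimes> ?\<beta> y \<otimes> inv x = \<phi> a y"
    using classification by blast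
  have ix: "inv x \<in> carrier M" using x by simp
  have "\<alpha> = \<iota> (inv x) \<otimes>\<^bsub>A\<^esub> \<psi> a"
  proof (rule A_ext[OF \<alpha>])
    fix y assume y: "y \<in> carrier N"
    let ?z = "b' (\<alpha> y)"
    have z: "?z \<in> carrier M" "b ?z = \<alpha> y" using b(3,4) \<alpha>_in[OF y] by auto
    have "?\<beta> (b' y) = ?z" using b(4)[OF y] by simp
    then have "\<phi> a (b' y) = x \<otimes> ?z \<otimes> inv x" using eq[OF b(3)[OF y]] by simp
    moreover have "inv x \<otimes> (x \<otimes> ?z \<otimes> inv x) \<otimes> inv (inv x) = ?z"
    proof -
      have "inv x \<otimes> (x \<otimes> ?z) = ?z" using x z by (simp add: M.m_assoc[symmetric])
      then show ?thesis using x z by (simp add: M.m_assoc)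
    qed
    ultimately have "b (inv x \<otimes> \<phi> a (b' y) \<otimes> inv (inv x)) = \<alpha> y" using z by simp
    moreover have "b (inv x \<otimes> \<phi> a (b' y) \<otimes> inv (inv x)) =
        b (inv x) \<otimes>\<^bsub>N\<^esub> b (\<phi> a (b' y)) \<otimes>\<^bsub>N\<^esub> inv\<^bsub>N\<^esub> (b (inv x))"
      using ix phi_in[OF a b(3)[OF y]] b(5) b_inv[OF ix] by simp
    ultimately show "\<alpha> y = (\<iota> (inv x) \<otimes>\<^bsub>A\<^esub> \<psi> a) y"
      using ix a y phi_in[OF a b(3)[OF y]]
      by (simp add: A_mult_apply[OF \<iota>_in[OF ix] \<psi>_in[OF a]] \<iota>_apply \<psi>_apply b(1))
  qed (use ix a \<iota>_in \<psi>_in in auto)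
  then show ?thesis using a ix by blast
qed

lemma V_in: "v \<in> V \<Longrightarrow> v \<in> carrier M"
  using normal_imp_subgroup[OF V_normal] by (rule subgroup.mem_carrier)

text \<open>Elements inducing the same conjugation differ by a central element; this is where the
  trivial centre enters.\<close>

lemma \<iota>_inj:
  assumes "x \<in> carrier M" "z \<in> carrier M" "\<iota> x = \<iota> z" shows "x = z"
proof -
  let ?d = "inv z \<otimes> x"
  have d: "?d \<in> carrier M" using assms by simp
  have "?d \<otimes> y = y \<otimes> ?d" if y: "y \<in> carrier M" for y
  proof -
    have c: "b x \<in> carrier N" "b z \<in> carrier N" "b y \<in> carrier N" using b(1) assms y by auto
    have "\<iota> x (b y) = \<iota> z (b y)" using assms(3) by simp
    then have "b x \<otimes>\<^bsub>N\<^esub> b y \<otimes>\<^bsub>N\<^esub> inv\<^bsub>N\<^esub> (b x) = b z \<otimes>\<^bsub>N\<^esub> b y \<otimes>\<^bsub>N\<^esub> inv\<^bsub>N\<^esub> (b z)"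
      unfolding \<iota>_apply[OF c(3)] .
    then have "b (x \<otimes> y \<otimes> inv x) = b (z \<otimes> y \<otimes> inv z)"
      using assms(1,2) y by (simp add: b(5) b_inv)
    then have "x \<otimes> y \<otimes> inv x = z \<otimes> y \<otimes> inv z"
      using b(2) assms y by (metis M.inv_closed M.m_closed)
    then have "inv z \<otimes> (x \<otimes> y \<otimes> inv x) \<otimes> x = inv z \<otimes> (z \<otimes> y \<otimes> inv z) \<otimes> x"
      by simp
    moreover have "inv z \<otimes> (x \<otimes> y \<otimes> inv x) \<otimes> x = ?d \<otimes> y"
      using assms y by (simp add: M.m_assoc)
    moreover have "inv z \<otimes> (z \<otimes> y \<otimes> inv z) \<otimes> x = y \<otimes> ?d"
    proof -
      have "inv z \<otimes> (z \<otimes> y) = y" using assms y by (simp add: M.m_assoc[symmetric])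
      then show ?thesis using assms y by (simp add: M.m_assoc) (simp add: M.m_assoc[symmetric])
    qed
    ultimately show ?thesis by simp
  qed
  then have "?d \<in> center M" using d unfolding center_def by blast
  then have "?d = \<one>" using center_M by blast
  then show "x = z" using assms by (metis M.inv_closed M.inv_equality M.inv_inv)
qed

text \<open>Inner automorphisms are trivial modulo \<open>V\<close>, as \<open>M\<close> is
  commutative modulo \<open>V\<close>. For \<open>a\<close> different from the identity,
  \<open>moved\<close> supplies an element that \<open>\<phi> a\<close> displaces outside
  \<open>V\<close>: the set \<open>D\<close> has at least two members, since \<open>order G\<close>
  is positive.\<close>

lemma \<psi>_not_inner:
  assumes a: "a \<in> carrier G" and x: "x \<in> carrier M" and eq: "\<psi> a = \<iota> x"
  shows "a = \<one>\<^bsub>G\<^esub>"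
proof (rule ccontr)
  assume "a \<noteq> \<one>\<^bsub>G\<^esub>"
  then obtain D where D: "D \<subseteq> carrier M" "order G < card D"
      "\<And>d d'. d \<in> D \<Longrightarrow> d' \<in> D \<Longrightarrow> d \<noteq> d' \<Longrightarrow>
        \<phi> a (inv d \<otimes> d') \<otimes> inv (inv d \<otimes> d') \<notin> V"
    using moved[OF a] by blast
  have "0 < order G" by (simp add: G.order_gt_0_iff_finite fin_G)
  then have "1 < card D" using D(2) by linarith
  moreover have "finite D" using D(1) fin_M by (rule finite_subset)
  ultimately have "\<not> (\<forall>d\<in>D. \<forall>d'\<in>D. d = d')" using card_le_Suc0_iff_eq[of D] by linarith
  then obtain d d' where d: "d \<in> D" "d' \<in> D" "d \<noteq> d'" by blast
  let ?y = "inv d \<otimes> d'"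
  have y: "?y \<in> carrier M" using d D(1) by blast
  have "\<psi> a (b ?y) = \<iota> x (b ?y)" using eq by simp
  then have "b (\<phi> a ?y) = b (x \<otimes> ?y \<otimes> inv x)"
    using x y by (simp add: \<psi>_apply \<iota>_apply b(1,2) b(5) b_inv)
  then have "\<phi> a ?y = x \<otimes> ?y \<otimes> inv x"
    using b(2) phi_in[OF a y] x y by (metis M.inv_closed M.m_closed)
  moreover obtain v where v: "v \<in> V" "x \<otimes> ?y = v \<otimes> (?y \<otimes> x)" using V_comm[OF x y] by blast
  ultimately have "\<phi> a ?y = v \<otimes> ?y" using x y V_in by (simp add: M.m_assoc)
  moreover have "v \<otimes> z \<otimes> inv z = v" if "z \<in> carrier M" for z
    using that V_in[OF v(1)] by (simp add: M.m_assoc)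
  ultimately have "\<phi> a ?y \<otimes> inv ?y = v" using y by simp
  then show False using D(3)[OF d] v(1) by simp
qed

text \<open>Two decompositions of one automorphism differ by an element that is both of the form
  \<open>\<psi>\<close> and of the form \<open>\<iota>\<close>, so \<open>\<psi>_not_inner\<close>
  applies to the quotient of \<open>a\<close> and \<open>a'\<close>.\<close>

lemma A_unique:
  assumes "x \<in> carrier M" "x' \<in> carrier M" "a \<in> carrier G" "a' \<in> carrier G"
    and eq: "\<iota> x \<otimes>\<^bsub>A\<^esub> \<psi> a = \<iota> x' \<otimes>\<^bsub>A\<^esub> \<psi> a'"
  shows "a = a'" "x = x'"
proof -
  have one: "\<psi> \<one>\<^bsub>G\<^esub> = \<one>\<^bsub>A\<^esub>" "\<iota> \<one> = \<one>\<^bsub>A\<^esub>"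
    using \<psi>_mult[OF G.one_closed G.one_closed] \<psi>_in[OF G.one_closed]
      \<iota>_mult[OF M.one_closed M.one_closed] \<iota>_in[OF M.one_closed] by simp_all
  have cl: "\<iota> x \<in> carrier A" "\<iota> x' \<in> carrier A" "\<psi> a \<in> carrier A" "\<psi> a' \<in> carrier A"
      "\<psi> (inv\<^bsub>G\<^esub> a') \<in> carrier A" "\<iota> (inv x) \<in> carrier A"
    using assms \<iota>_in \<psi>_in by simp_all
  have "\<iota> (inv x) \<otimes>\<^bsub>A\<^esub> (\<iota> x \<otimes>\<^bsub>A\<^esub> \<psi> a) \<otimes>\<^bsub>A\<^esub> \<psi> (inv\<^bsub>G\<^esub> a') =
      \<iota> (inv x) \<otimes>\<^bsub>A\<^esub> (\<iota> x' \<otimes>\<^bsub>A\<^esub> \<psi> a') \<otimes>\<^bsub>A\<^esub> \<psi> (inv\<^bsub>G\<^esub> a')"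
    using eq by simp
  moreover have "\<iota> (inv x) \<otimes>\<^bsub>A\<^esub> (\<iota> x \<otimes>\<^bsub>A\<^esub> \<psi> a) \<otimes>\<^bsub>A\<^esub> \<psi> (inv\<^bsub>G\<^esub> a') =
      (\<iota> (inv x) \<otimes>\<^bsub>A\<^esub> \<iota> x) \<otimes>\<^bsub>A\<^esub> (\<psi> a \<otimes>\<^bsub>A\<^esub> \<psi> (inv\<^bsub>G\<^esub> a'))"
    using cl by (simp add: A.m_assoc)
  moreover have "\<iota> (inv x) \<otimes>\<^bsub>A\<^esub> (\<iota> x' \<otimes>\<^bsub>A\<^esub> \<psi> a') \<otimes>\<^bsub>A\<^esub> \<psi> (inv\<^bsub>G\<^esub> a') =
      (\<iota> (inv x) \<otimes>\<^bsub>A\<^esub> \<iota> x') \<otimes>\<^bsub>A\<^esub> (\<psi> a' \<otimes>\<^bsub>A\<^esub> \<psi> (inv\<^bsub>G\<^esub> a'))"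
    using cl by (simp add: A.m_assoc)
  moreover have "\<psi> (a \<otimes>\<^bsub>G\<^esub> inv\<^bsub>G\<^esub> a') \<in> carrier A" "\<iota> (inv x \<otimes> x') \<in> carrier A"
    using assms \<iota>_in \<psi>_in by simp_all
  ultimately have "\<psi> (a \<otimes>\<^bsub>G\<^esub> inv\<^bsub>G\<^esub> a') = \<iota> (inv x \<otimes> x')"
    using assms one by (simp add: \<iota>_mult[symmetric] \<psi>_mult[symmetric])
  then have "a \<otimes>\<^bsub>G\<^esub> inv\<^bsub>G\<^esub> a' = \<one>\<^bsub>G\<^esub>"
    using \<psi>_not_inner[of "a \<otimes>\<^bsub>G\<^esub> inv\<^bsub>G\<^esub> a'" "inv x \<otimes> x'"] assms by simp
  then show "a = a'" using assms by (metis G.inv_closed G.inv_equality G.inv_inv)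
  then have "\<iota> x = \<iota> x'" using eq cl A.r_cancel by blast
  then show "x = x'" using \<iota>_inj assms by blast
qed

lemma \<iota>_one: "\<iota> \<one> = \<one>\<^bsub>A\<^esub>"
  using \<iota>_mult[OF M.one_closed M.one_closed] \<iota>_in[OF M.one_closed] by simp

lemma \<psi>_one: "\<psi> \<one>\<^bsub>G\<^esub> = \<one>\<^bsub>A\<^esub>"
  using \<psi>_mult[OF G.one_closed G.one_closed] \<psi>_in[OF G.one_closed] by simp

lemma \<iota>_inv: "x \<in> carrier M \<Longrightarrow> inv\<^bsub>A\<^esub> (\<iota> x) = \<iota> (inv x)"
  by (rule A.inv_equality) (simp_all add: \<iota>_in \<iota>_mult[symmetric] \<iota>_one)

lemma inn_normal: "inn N \<lhd> A"
proof (rule A.normal_invI)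
  show "subgroup (inn N) A"
    unfolding inn_eq
  proof (rule A.subgroupI)
    show "\<iota> ` carrier M \<subseteq> carrier A" using \<iota>_in by blast
    show "\<iota> ` carrier M \<noteq> {}" using M.one_closed by blast
    show "inv\<^bsub>A\<^esub> f \<in> \<iota> ` carrier M" if "f \<in> \<iota> ` carrier M" for f
      using that \<iota>_inv by auto
    show "f \<otimes>\<^bsub>A\<^esub> g \<in> \<iota> ` carrier M" if "f \<in> \<iota> ` carrier M" "g \<in> \<iota> ` carrier M" for f g
      using that by (auto simp: \<iota>_mult[symmetric])
  qed
  fix \<alpha> h assume \<alpha>: "\<alpha> \<in> carrier A" and "h \<in> inn N"
  then obtain x where x: "x \<in> carrier M" "h = \<iota> x" unfolding inn_eq by blast
  obtain a z where az: "a \<in> carrier G" "z \<in> carrier M" "\<alpha> = \<iota> z \<otimes>\<^bsub>A\<^esub> \<psi> a" using A_decompose[OF \<alpha>] by blast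
  let ?y = "z \<otimes> \<phi> a x \<otimes> inv z"
  have c: "\<phi> a x \<in> carrier M" "?y \<in> carrier M" using phi_in az x by simp_all
  have "\<alpha> \<otimes>\<^bsub>A\<^esub> \<iota> x = \<iota> z \<otimes>\<^bsub>A\<^esub> (\<iota> (\<phi> a x) \<otimes>\<^bsub>A\<^esub> \<psi> a)"
    using az x \<iota>_in \<psi>_in by (simp add: A.m_assoc \<psi>_\<iota>)
  also have "\<dots> = \<iota> (z \<otimes> \<phi> a x) \<otimes>\<^bsub>A\<^esub> \<psi> a"
    using az c \<iota>_in \<psi>_in by (simp add: A.m_assoc \<iota>_mult)
  also have "z \<otimes> \<phi> a x = ?y \<otimes> z" using az c(1) by (simp add: M.m_assoc)
  also have "\<iota> (?y \<otimes> z) \<otimes>\<^bsub>A\<^esub> \<psi> a = \<iota> ?y \<otimes>\<^bsub>A\<^esub> \<alpha>"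
    using az c(2) \<iota>_in \<psi>_in by (simp only: \<iota>_mult A.m_assoc az(3))
  finally have "\<alpha> \<otimes>\<^bsub>A\<^esub> \<iota> x \<otimes>\<^bsub>A\<^esub> inv\<^bsub>A\<^esub> \<alpha> = \<iota> ?y \<otimes>\<^bsub>A\<^esub> \<alpha> \<otimes>\<^bsub>A\<^esub> inv\<^bsub>A\<^esub> \<alpha>" by simp
  then have "\<alpha> \<otimes>\<^bsub>A\<^esub> \<iota> x \<otimes>\<^bsub>A\<^esub> inv\<^bsub>A\<^esub> \<alpha> = \<iota> ?y"
    using \<iota>_in[OF c(2)] \<alpha> by (simp add: A.m_assoc)
  then show "\<alpha> \<otimes>\<^bsub>A\<^esub> h \<otimes>\<^bsub>A\<^esub> inv\<^bsub>A\<^esub> \<alpha> \<in> inn N" unfolding inn_eq x(2) using c(2) by blast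
qed

lemma out_quot_\<iota>:
  assumes "x \<in> carrier M" "a \<in> carrier G"
  shows "out_quot N (\<iota> x \<otimes>\<^bsub>A\<^esub> \<psi> a) = out_quot N (\<psi> a)"
proof -
  have s: "subgroup (inn N) A" using inn_normal by (rule normal_imp_subgroup)
  have "inn N #>\<^bsub>A\<^esub> (\<iota> x \<otimes>\<^bsub>A\<^esub> \<psi> a) = inn N #>\<^bsub>A\<^esub> \<iota> x #>\<^bsub>A\<^esub> \<psi> a"
    using assms \<iota>_in \<psi>_in subgroup.subset[OF s] by (simp add: A.coset_mult_assoc)
  also have "inn N #>\<^bsub>A\<^esub> \<iota> x = inn N"
    using A.coset_join2[OF \<iota>_in[OF assms(1)] s] assms(1) unfolding inn_eq by blast
  finally show ?thesis unfolding out_quot_def .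
qed

lemma out_quot_iso: "(\<lambda>a. out_quot N (\<psi> a)) \<in> iso G (OutGroup N)"
proof -
  have s: "subgroup (inn N) A" using inn_normal by (rule normal_imp_subgroup)
  have car: "carrier (OutGroup N) = out_quot N ` carrier A"
    unfolding OutGroup_def carrier_FactGroup out_quot_def ..
  have "(\<lambda>a. out_quot N (\<psi> a)) \<in> hom G (OutGroup N)"
  proof (rule homI)
    show "out_quot N (\<psi> a) \<in> carrier (OutGroup N)" if "a \<in> carrier G" for a
      unfolding car using \<psi>_in[OF that] by blast
    show "out_quot N (\<psi> (a \<otimes>\<^bsub>G\<^esub> c)) = out_quot N (\<psi> a) \<otimes>\<^bsub>OutGroup N\<^esub> out_quot N (\<psi> c)"
      if "a \<in> carrier G" "c \<in> carrier G" for a c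
      unfolding OutGroup_def out_quot_def mult_FactGroup
      using normal.rcos_sum[OF inn_normal \<psi>_in[OF that(1)] \<psi>_in[OF that(2)]] \<psi>_mult[OF that] by simp
  qed
  moreover have "inj_on (\<lambda>a. out_quot N (\<psi> a)) (carrier G)"
  proof (rule inj_onI)
    fix a c assume ac: "a \<in> carrier G" "c \<in> carrier G" "out_quot N (\<psi> a) = out_quot N (\<psi> c)"
    have "\<psi> a \<in> out_quot N (\<psi> a)"
      unfolding out_quot_def by (rule A.rcos_self[OF \<psi>_in[OF ac(1)] s])
    then have "\<psi> a \<in> out_quot N (\<psi> c)" using ac(3) by simp
    then obtain x where x: "x \<in> carrier M" "\<psi> a = \<iota> x \<otimes>\<^bsub>A\<^esub> \<psi> c"
      unfolding out_quot_def r_coset_def inn_eq by blast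
    have "\<iota> \<one> \<otimes>\<^bsub>A\<^esub> \<psi> a = \<iota> x \<otimes>\<^bsub>A\<^esub> \<psi> c" using x(2) \<psi>_in[OF ac(1)] by (simp add: \<iota>_one)
    then show "a = c" using A_unique(1)[OF M.one_closed x(1) ac(1,2)] by blast
  qed
  moreover have "carrier (OutGroup N) \<subseteq> (\<lambda>a. out_quot N (\<psi> a)) ` carrier G"
  proof
    fix Q assume "Q \<in> carrier (OutGroup N)"
    then obtain \<alpha> where \<alpha>: "\<alpha> \<in> carrier A" "Q = out_quot N \<alpha>" unfolding car by blast
    then show "Q \<in> (\<lambda>a. out_quot N (\<psi> a)) ` carrier G"
      using A_decompose[OF \<alpha>(1)] out_quot_\<iota> by blast
  qed
  ultimately show ?thesis by (auto simp: iso_def bij_betw_def hom_def)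
qed

lemma G_iso_Out: "G \<cong> OutGroup N"
  using out_quot_iso unfolding is_iso_def by blast

lemma section_exists:
  "\<exists>s. s \<in> hom (OutGroup N) A \<and> (\<forall>Q \<in> carrier (OutGroup N). out_quot N (s Q) = Q)"
proof -
  let ?f = "\<lambda>a. out_quot N (\<psi> a)"
  let ?g = "inv_into (carrier G) ?f"
  have g: "?g \<in> iso (OutGroup N) G" by (rule G.iso_set_sym[OF out_quot_iso])
  have \<psi>: "\<psi> \<in> hom G A" using \<psi>_in \<psi>_mult by (auto simp: hom_def)
  have "\<psi> \<circ> ?g \<in> hom (OutGroup N) A"
    using g \<psi> unfolding iso_def by (intro Group.hom_compose[of _ _ G]) auto
  moreover have "out_quot N ((\<psi> \<circ> ?g) Q) = Q" if "Q \<in> carrier (OutGroup N)" for Q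
  proof -
    have "Q \<in> ?f ` carrier G" using out_quot_iso that by (simp add: iso_def bij_betw_def)
    then have "?f (?g Q) = Q" by (rule f_inv_into_f)
    then show ?thesis by simp
  qed
  ultimately show ?thesis by blast
qed

lemma center_N: "center N = {\<one>\<^bsub>N\<^esub>}"
proof -
  have "z = \<one>\<^bsub>N\<^esub>" if z: "z \<in> carrier N" "\<And>y. y \<in> carrier N \<Longrightarrow> z \<otimes>\<^bsub>N\<^esub> y = y \<otimes>\<^bsub>N\<^esub> z" for z
  proof -
    have "b' z \<otimes> x = x \<otimes> b' z" if x: "x \<in> carrier M" for x
    proof -
      have "b (b' z \<otimes> x) = b (x \<otimes> b' z)"
        using z(2)[OF b(1)[OF x]] b(3,4)[OF z(1)] x by (simp add: b(5))
      then show ?thesis using b(2) b(3)[OF z(1)] x by (metis M.m_closed)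
    qed
    then have "b' z \<in> center M" unfolding center_def using b(3)[OF z(1)] by blast
    then have "b' z = \<one>" using center_M by blast
    moreover have "b \<one> = \<one>\<^bsub>N\<^esub>"
      using b_iso hom_one[OF _ M.is_group N.is_group] by (auto simp: iso_def)
    ultimately show ?thesis using b(4)[OF z(1)] by simp
  qed
  then have "center N \<subseteq> {\<one>\<^bsub>N\<^esub>}" unfolding center_def by blast
  moreover have "\<one>\<^bsub>N\<^esub> \<in> center N" by (simp add: center_def)
  ultimately show ?thesis by blast
qed

section \<open>Inn N is the only copy of N in Aut N\<close>

definition Fix where "Fix a = {x \<in> carrier M. \<phi> a x \<otimes> inv x \<in> V}"

lemma V_conj: "x \<in> carrier M \<Longrightarrow> v \<in> V \<Longrightarrow> x \<otimes> v \<otimes> inv x \<in> V"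
  by (rule normal.inv_op_closed2[OF V_normal])

lemma V_mult: "v \<in> V \<Longrightarrow> v' \<in> V \<Longrightarrow> v \<otimes> v' \<in> V"
  using normal_imp_subgroup[OF V_normal] by (rule subgroup.m_closed)

lemma V_inv: "v \<in> V \<Longrightarrow> inv v \<in> V"
  using normal_imp_subgroup[OF V_normal] by (rule subgroup.m_inv_closed)

text \<open>\<open>Fix a\<close> is the preimage of the fixed points of \<open>\<phi> a\<close> on
  the quotient by the normal subgroup \<open>V\<close>.\<close>

lemma Fix_diff:
  assumes a: "a \<in> carrier G" and x: "x \<in> Fix a" and y: "y \<in> Fix a"
  shows "x \<otimes> inv y \<in> Fix a"
proof -
  define v where "v = \<phi> a x \<otimes> inv x"
  define w where "w = \<phi> a y \<otimes> inv y"
  have c: "x \<in> carrier M" "y \<in> carrier M" "v \<in> V" "w \<in> V" using x y unfolding Fix_def v_def w_def by auto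
  have vw: "v \<in> carrier M" "w \<in> carrier M" using c V_in by auto
  have e: "\<phi> a x = v \<otimes> x" "\<phi> a y = w \<otimes> y"
    using c phi_in[OF a c(1)] phi_in[OF a c(2)] unfolding v_def w_def by (simp_all add: M.m_assoc)
  let ?z = "x \<otimes> inv y"
  have z: "?z \<in> carrier M" using c by simp
  have "\<phi> a ?z = v \<otimes> (?z \<otimes> inv w)"
    using c vw a by (simp add: phi_hom phi_inv e M.inv_mult_group M.m_assoc)
  then have "\<phi> a ?z \<otimes> inv ?z = v \<otimes> (?z \<otimes> inv w \<otimes> inv ?z)"
    using vw z by (simp only: M.m_assoc M.inv_closed M.m_closed)
  also have "\<dots> \<in> V" by (intro V_mult V_conj V_inv c z)
  finally show ?thesis using z unfolding Fix_def by blast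
qed

text \<open>The members of \<open>D\<close> lie in different left cosets of \<open>Fix a\<close>, so
  the products \<open>d \<otimes> l\<close> are pairwise distinct and \<open>card D * card L\<close>
  is at most \<open>order M\<close>.\<close>

lemma card_Fix:
  assumes a: "a \<in> carrier G" "a \<noteq> \<one>\<^bsub>G\<^esub>" and L: "L \<subseteq> Fix a" "L \<noteq> {}"
  shows "order G * card L < order M"
proof -
  obtain D where D: "D \<subseteq> carrier M" "order G < card D"
      "\<And>d d'. d \<in> D \<Longrightarrow> d' \<in> D \<Longrightarrow> d \<noteq> d' \<Longrightarrow> inv d \<otimes> d' \<notin> Fix a"
    using moved[OF a] unfolding Fix_def by blast
  have LM: "L \<subseteq> carrier M" using L unfolding Fix_def by blast
  have "inj_on (\<lambda>(d, l). d \<otimes> l) (D \<times> L)"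
  proof (rule inj_onI, clarify)
    fix d l d' l' assume *: "d \<in> D" "l \<in> L" "d' \<in> D" "l' \<in> L" "d \<otimes> l = d' \<otimes> l'"
    have c: "d \<in> carrier M" "l \<in> carrier M" "d' \<in> carrier M" "l' \<in> carrier M"
      using * D(1) LM by auto
    have "inv d \<otimes> (d \<otimes> l) \<otimes> inv l' = inv d \<otimes> (d' \<otimes> l') \<otimes> inv l'"
      using *(5) by simp
    moreover have "inv d \<otimes> (d \<otimes> l) = l" using c by (simp add: M.m_assoc[symmetric])
    moreover have "inv d \<otimes> (d' \<otimes> l') \<otimes> inv l' = inv d \<otimes> d'" using c by (simp add: M.m_assoc)
    ultimately have "l \<otimes> inv l' = inv d \<otimes> d'" by simp
    moreover have "l \<otimes> inv l' \<in> Fix a" using Fix_diff[OF a(1)] L * by blast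
    ultimately have dd: "d = d'" using D(3)[OF *(1,3)] by metis
    then have "d \<otimes> l = d \<otimes> l'" using *(5) by simp
    then show "d = d' \<and> l = l'" using dd M.l_cancel[OF _ c(2,4,1)] by blast
  qed
  moreover have "(\<lambda>(d, l). d \<otimes> l) ` (D \<times> L) \<subseteq> carrier M" using D(1) LM by auto
  ultimately have "card (D \<times> L) \<le> order M" unfolding order_def using fin_M by (rule card_inj_on_le)
  then have le: "card D * card L \<le> order M" by (simp add: card_cartesian_product)
  have "0 < card L" using L(2) finite_subset[OF LM fin_M] by (simp add: card_gt_0_iff)
  then have "order G * card L < card D * card L" using D(2) by simp
  then show ?thesis using le by (rule less_le_trans)
qed

text \<open>A comparison of two indices: the part of \<open>H\<close> inside \<open>inn N\<close>
  has index at most \<open>order G\<close>, while an element of \<open>H\<close> outside would force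
  that part into some \<open>Fix a\<close>, whose index is larger.\<close>

lemma inn_unique:
  assumes H: "subgroup H A" and iso: "A\<lparr>carrier := H\<rparr> \<cong> N"
  shows "H = inn N"
proof -
  have HA: "H \<subseteq> carrier A" using H by (rule subgroup.subset)
  have gH: "group (A\<lparr>carrier := H\<rparr>)" using A.subgroup_imp_group[OF H] .
  have "A\<lparr>carrier := H\<rparr> \<cong> M"
    using iso_trans[OF iso] b'_iso unfolding is_iso_def by blast
  then obtain f where f: "f \<in> iso M (A\<lparr>carrier := H\<rparr>)"
    using group.iso_sym[OF gH] unfolding is_iso_def by blast
  have f_in: "f x \<in> H" "f x \<in> carrier A" if "x \<in> carrier M" for x
    using f HA that by (auto simp: iso_def hom_def)
  have f_mult: "f (x \<otimes> y) = f x \<otimes>\<^bsub>A\<^esub> f y" if "x \<in> carrier M" "y \<in> carrier M" for x y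
    using f that by (auto simp: iso_def hom_def)
  have f_bij: "f ` carrier M = H" "inj_on f (carrier M)"
    using f by (auto simp: iso_def bij_betw_def)
  interpret f: group_hom M A f
    using f_in f_mult by (auto simp: group_hom_def group_hom_axioms_def hom_def M.is_group A.is_group)
  \<comment> \<open>The outer and the inner component of an automorphism. They are merely chosen
    here; that \<open>\<kappa>\<close> is multiplicative rests on \<open>A_unique\<close>.\<close>
  obtain \<kappa> \<xi> where dec: "\<And>\<alpha>. \<alpha> \<in> carrier A \<Longrightarrow> \<kappa> \<alpha> \<in> carrier G \<and> \<xi> \<alpha> \<in> carrier M \<and> \<alpha> = \<iota> (\<xi> \<alpha>) \<otimes>\<^bsub>A\<^esub> \<psi> (\<kappa> \<alpha>)"
    using A_decompose by metis
  have mult_dec: "(\<iota> x \<otimes>\<^bsub>A\<^esub> \<psi> a) \<otimes>\<^bsub>A\<^esub> (\<iota> y \<otimes>\<^bsub>A\<^esub> \<psi> c) = \<iota> (x \<otimes> \<phi> a y) \<otimes>\<^bsub>A\<^esub> \<psi> (a \<otimes>\<^bsub>G\<^esub> c)"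
    if "x \<in> carrier M" "y \<in> carrier M" "a \<in> carrier G" "c \<in> carrier G" for x y a c
  proof -
    have cl: "\<iota> x \<in> carrier A" "\<iota> y \<in> carrier A" "\<psi> a \<in> carrier A" "\<psi> c \<in> carrier A" "\<phi> a y \<in> carrier M"
        "\<iota> (\<phi> a y) \<in> carrier A"
      using that \<iota>_in \<psi>_in phi_in by simp_all
    have "(\<iota> x \<otimes>\<^bsub>A\<^esub> \<psi> a) \<otimes>\<^bsub>A\<^esub> (\<iota> y \<otimes>\<^bsub>A\<^esub> \<psi> c) = \<iota> x \<otimes>\<^bsub>A\<^esub> ((\<psi> a \<otimes>\<^bsub>A\<^esub> \<iota> y) \<otimes>\<^bsub>A\<^esub> \<psi> c)"
      using cl by (simp add: A.m_assoc)
    also have "\<dots> = \<iota> x \<otimes>\<^bsub>A\<^esub> ((\<iota> (\<phi> a y) \<otimes>\<^bsub>A\<^esub> \<psi> a) \<otimes>\<^bsub>A\<^esub> \<psi> c)"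
      using \<psi>_\<iota> that by simp
    also have "\<dots> = (\<iota> x \<otimes>\<^bsub>A\<^esub> \<iota> (\<phi> a y)) \<otimes>\<^bsub>A\<^esub> (\<psi> a \<otimes>\<^bsub>A\<^esub> \<psi> c)"
      using cl by (simp add: A.m_assoc)
    finally show ?thesis using that cl by (simp add: \<iota>_mult \<psi>_mult)
  qed
  have \<kappa>_mult: "\<kappa> (\<alpha> \<otimes>\<^bsub>A\<^esub> \<beta>) = \<kappa> \<alpha> \<otimes>\<^bsub>G\<^esub> \<kappa> \<beta>" if "\<alpha> \<in> carrier A" "\<beta> \<in> carrier A" for \<alpha> \<beta>
  proof -
    have "\<iota> (\<xi> (\<alpha> \<otimes>\<^bsub>A\<^esub> \<beta>)) \<otimes>\<^bsub>A\<^esub> \<psi> (\<kappa> (\<alpha> \<otimes>\<^bsub>A\<^esub> \<beta>)) = \<alpha> \<otimes>\<^bsub>A\<^esub> \<beta>"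
      using dec[of "\<alpha> \<otimes>\<^bsub>A\<^esub> \<beta>"] that by simp
    also have "\<dots> = (\<iota> (\<xi> \<alpha>) \<otimes>\<^bsub>A\<^esub> \<psi> (\<kappa> \<alpha>)) \<otimes>\<^bsub>A\<^esub> (\<iota> (\<xi> \<beta>) \<otimes>\<^bsub>A\<^esub> \<psi> (\<kappa> \<beta>))"
      using dec[OF that(1)] dec[OF that(2)] by metis
    also have "\<dots> = \<iota> (\<xi> \<alpha> \<otimes> \<phi> (\<kappa> \<alpha>) (\<xi> \<beta>)) \<otimes>\<^bsub>A\<^esub> \<psi> (\<kappa> \<alpha> \<otimes>\<^bsub>G\<^esub> \<kappa> \<beta>)"
      using mult_dec dec[OF that(1)] dec[OF that(2)] by blast
    finally show ?thesis
      using A_unique(1) dec[OF that(1)] dec[OF that(2)] dec[of "\<alpha> \<otimes>\<^bsub>A\<^esub> \<beta>"] that phi_in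
      by (meson A.m_closed G.m_closed M.m_closed)
  qed
  interpret k: group_hom M G "\<lambda>y. \<kappa> (f y)"
    using f_in dec \<kappa>_mult f_mult
    by (auto simp: group_hom_def group_hom_axioms_def hom_def M.is_group G.is_group)
  have f_inner: "f y = \<iota> (\<xi> (f y))" if "y \<in> carrier M" "\<kappa> (f y) = \<one>\<^bsub>G\<^esub>" for y
  proof -
    have "f y = \<iota> (\<xi> (f y)) \<otimes>\<^bsub>A\<^esub> \<psi> (\<kappa> (f y))" "\<iota> (\<xi> (f y)) \<in> carrier A"
      using dec[OF f_in(2)[OF that(1)]] \<iota>_in by auto
    then show ?thesis unfolding that(2) \<psi>_one by simp
  qed
  \<comment> \<open>The outer component of \<open>f v\<close> has an order dividing both
    \<open>q\<close> and \<open>order G\<close>, so it is trivial. The inner component then inherits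
    the power condition that characterises \<open>V\<close>.\<close>
  have V_image: "\<exists>v'\<in>V. f v = \<iota> v'" if v: "v \<in> V" for v
  proof -
    have vM: "v \<in> carrier M" using V_in[OF v] .
    have kv: "\<kappa> (f v) \<in> carrier G" using dec[OF f_in(2)[OF vM]] by blast
    have vq: "v [^] q = \<one>" using V_pow[OF vM] v by blast
    have "\<kappa> (f v) [^]\<^bsub>G\<^esub> q = \<kappa> (f (v [^] q))" using k.hom_nat_pow[OF vM] by simp
    also have "\<dots> = \<one>\<^bsub>G\<^esub>" unfolding vq by (rule k.hom_one)
    finally have "G.ord (\<kappa> (f v)) dvd q" using G.pow_eq_id[OF kv] by simp
    moreover have "G.ord (\<kappa> (f v)) dvd order G" using G.ord_dvd_group_order[OF kv] .
    ultimately have "G.ord (\<kappa> (f v)) = 1" using cop by (metis coprime_common_divisor_nat)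
    then have "\<kappa> (f v) = \<one>\<^bsub>G\<^esub>" using G.ord_eq_1[OF kv] by simp
    then have fv: "f v = \<iota> (\<xi> (f v))" using f_inner[OF vM] by blast
    have x: "\<xi> (f v) \<in> carrier M" using dec[OF f_in(2)[OF vM]] by blast
    interpret i: group_hom M A \<iota>
      using \<iota>_in \<iota>_mult by (auto simp: group_hom_def group_hom_axioms_def hom_def M.is_group A.is_group)
    have "\<iota> (\<xi> (f v) [^] q) = f v [^]\<^bsub>A\<^esub> q" using i.hom_nat_pow[OF x] fv by simp
    also have "\<dots> = f (v [^] q)" using f.hom_nat_pow[OF vM] by simp
    also have "\<dots> = \<iota> \<one>" unfolding vq \<iota>_one by (rule f.hom_one)
    finally have "\<xi> (f v) [^] q = \<one>" using \<iota>_inj x by blast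
    then have "\<xi> (f v) \<in> V" using V_pow[OF x] by blast
    with fv show ?thesis by blast
  qed
  \<comment> \<open>\<open>K\<close> is the kernel of the outer component along \<open>f\<close>;
    \<open>L\<close> describes the same elements through the conjugations that they are mapped to,
    hence as a subset of \<open>M\<close>.\<close>
  define K where "K = {y \<in> carrier M. \<kappa> (f y) = \<one>\<^bsub>G\<^esub>}"
  define L where "L = (\<lambda>y. \<xi> (f y)) ` K"
  have cardL: "card L = card K"
    unfolding L_def
  proof (rule card_image, rule inj_onI)
    fix y z assume yz: "y \<in> K" "z \<in> K" "\<xi> (f y) = \<xi> (f z)"
    have "f y = \<iota> (\<xi> (f y))" "f z = \<iota> (\<xi> (f z))" using f_inner yz(1,2) unfolding K_def by blast+
    then have "f y = f z" using yz(3) by metis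
    then show "y = z" using f_bij(2) yz unfolding K_def inj_on_def by blast
  qed
  \<comment> \<open>\<open>carrier M\<close> is covered by the fibres over \<open>carrier G\<close>,
    and each nonempty fibre is a translate of the kernel \<open>K\<close>.\<close>
  have "order M \<le> order G * card K"
  proof -
    have finK: "finite K" unfolding K_def using fin_M by simp
    have fiber: "card {y \<in> carrier M. \<kappa> (f y) = a} \<le> card K" for a
    proof (cases "{y \<in> carrier M. \<kappa> (f y) = a} = {}")
      case False
      then obtain y0 where y0: "y0 \<in> carrier M" "\<kappa> (f y0) = a" by blast
      have aG: "a \<in> carrier G" using y0 k.hom_closed by blast
      show ?thesis
      proof (rule card_inj_on_le[OF _ _ finK])
        show "inj_on (\<lambda>y. inv y0 \<otimes> y) {y \<in> carrier M. \<kappa> (f y) = a}"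
          using y0 by (auto intro!: inj_onI)
        show "(\<lambda>y. inv y0 \<otimes> y) ` {y \<in> carrier M. \<kappa> (f y) = a} \<subseteq> K"
        proof (rule image_subsetI)
          fix y assume "y \<in> {y \<in> carrier M. \<kappa> (f y) = a}"
          then have y: "y \<in> carrier M" "\<kappa> (f y) = a" by auto
          have "\<kappa> (f (inv y0 \<otimes> y)) = inv\<^bsub>G\<^esub> a \<otimes>\<^bsub>G\<^esub> a"
            using k.hom_mult[of "inv y0" y] k.hom_inv[of y0] y y0 by simp
          then show "inv y0 \<otimes> y \<in> K" unfolding K_def using y y0 aG by simp
        qed
      qed
    next
      case True
      then show ?thesis by (metis card.empty le0)
    qed
    have "carrier M = (\<Union>a\<in>carrier G. {y \<in> carrier M. \<kappa> (f y) = a})"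
      using k.hom_closed by blast
    then have "order M \<le> (\<Sum>a\<in>carrier G. card {y \<in> carrier M. \<kappa> (f y) = a})"
      unfolding order_def using card_UN_le[OF fin_G] by metis
    also have "\<dots> \<le> (\<Sum>a\<in>carrier G. card K)" by (rule sum_mono[OF fiber])
    finally show ?thesis by (simp add: order_def)
  qed
  have "\<kappa> (f y) = \<one>\<^bsub>G\<^esub>" if y: "y \<in> carrier M" for y
  proof (rule ccontr)
    let ?a = "\<kappa> (f y)" and ?x = "\<xi> (f y)"
    assume na: "?a \<noteq> \<one>\<^bsub>G\<^esub>"
    have ax: "?a \<in> carrier G" "?x \<in> carrier M" "f y = \<iota> ?x \<otimes>\<^bsub>A\<^esub> \<psi> ?a"
      using dec[OF f_in(2)[OF y]] by auto
    \<comment> \<open>\<open>y\<close> and \<open>y'\<close> commute modulo \<open>V\<close> in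
      \<open>M\<close>, and \<open>f\<close> maps \<open>V\<close> into the conjugations by
      \<open>V\<close>. So \<open>f y\<close> and \<open>f y'\<close> commute modulo
      \<open>V\<close> too, which says that \<open>\<phi> ?a\<close> fixes \<open>l\<close> modulo
      \<open>V\<close>.\<close>
    have "L \<subseteq> Fix ?a"
    proof
      fix l assume "l \<in> L"
      then obtain y' where y': "y' \<in> carrier M" "\<kappa> (f y') = \<one>\<^bsub>G\<^esub>" "l = \<xi> (f y')"
        unfolding L_def K_def by blast
      have l: "l \<in> carrier M" "f y' = \<iota> l"
        using dec[OF f_in(2)[OF y'(1)]] f_inner[OF y'(1,2)] y'(3) by auto
      obtain v where v: "v \<in> V" "y \<otimes> y' = v \<otimes> (y' \<otimes> y)" using V_comm[OF y y'(1)] by blast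
      obtain v' where v': "v' \<in> V" "f v = \<iota> v'" using V_image[OF v(1)] by blast
      have pl: "\<phi> ?a l \<in> carrier M" using phi_in ax l by blast
      have one: "\<one>\<^bsub>G\<^esub> \<in> carrier G" by simp
      have \<iota>l: "\<iota> l = \<iota> l \<otimes>\<^bsub>A\<^esub> \<psi> \<one>\<^bsub>G\<^esub>" using \<iota>_in[OF l(1)] by (simp add: \<psi>_one)
      have phi1: "\<phi> \<one>\<^bsub>G\<^esub> ?x = ?x"
      proof -
        have "\<phi> \<one>\<^bsub>G\<^esub> (\<phi> \<one>\<^bsub>G\<^esub> ?x) = \<phi> \<one>\<^bsub>G\<^esub> ?x" using phi_mult[OF one one ax(2)] by simp
        moreover have "inj_on (\<phi> \<one>\<^bsub>G\<^esub>) (carrier M)" using phi_iso[OF one] by (simp add: iso_def bij_betw_def)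
        ultimately show ?thesis using phi_in[OF one ax(2)] ax(2) unfolding inj_on_def by blast
      qed
      have "f y \<otimes>\<^bsub>A\<^esub> f y' = \<iota> (?x \<otimes> \<phi> ?a l) \<otimes>\<^bsub>A\<^esub> \<psi> ?a"
        using mult_dec[OF ax(2) l(1) ax(1) one] ax(1,3) l(2) \<iota>l by simp
      moreover have "f y' \<otimes>\<^bsub>A\<^esub> f y = \<iota> (l \<otimes> ?x) \<otimes>\<^bsub>A\<^esub> \<psi> ?a"
      proof -
        have "(\<iota> l \<otimes>\<^bsub>A\<^esub> \<psi> \<one>\<^bsub>G\<^esub>) \<otimes>\<^bsub>A\<^esub> (\<iota> ?x \<otimes>\<^bsub>A\<^esub> \<psi> ?a) = \<iota> (l \<otimes> ?x) \<otimes>\<^bsub>A\<^esub> \<psi> ?a"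
          using mult_dec[OF l(1) ax(2) one ax(1)] phi1 ax(1) by simp
        then show ?thesis using \<iota>l l(2) ax(3) by metis
      qed
      moreover have "f y \<otimes>\<^bsub>A\<^esub> f y' = f v \<otimes>\<^bsub>A\<^esub> (f y' \<otimes>\<^bsub>A\<^esub> f y)"
        using f_mult[OF y y'(1)] f_mult[OF y'(1) y] f_mult[of v "y' \<otimes> y"] v y y'(1) V_in by simp
      ultimately have "\<iota> (?x \<otimes> \<phi> ?a l) \<otimes>\<^bsub>A\<^esub> \<psi> ?a = \<iota> v' \<otimes>\<^bsub>A\<^esub> (\<iota> (l \<otimes> ?x) \<otimes>\<^bsub>A\<^esub> \<psi> ?a)"
        using v'(2) by simp
      also have "\<dots> = \<iota> (v' \<otimes> (l \<otimes> ?x)) \<otimes>\<^bsub>A\<^esub> \<psi> ?a"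
        using \<iota>_mult[OF V_in[OF v'(1)], of "l \<otimes> ?x"] \<iota>_in[of "l \<otimes> ?x"] \<iota>_in[OF V_in[OF v'(1)]]
          l(1) ax(2) \<psi>_in[OF ax(1)] by (simp add: A.m_assoc)
      finally have eq1: "?x \<otimes> \<phi> ?a l = v' \<otimes> (l \<otimes> ?x)"
        using A_unique(2)[of "?x \<otimes> \<phi> ?a l" "v' \<otimes> (l \<otimes> ?x)" ?a ?a] ax(1,2) pl l(1) V_in[OF v'(1)] by simp
      \<comment> \<open>The inner component \<open>?x\<close> of \<open>f y\<close> itself commutes
        with \<open>l\<close> modulo \<open>V\<close> and can therefore be removed, leaving only the
        effect of \<open>\<phi> ?a\<close>.\<close>
      obtain u where u: "u \<in> V" "l \<otimes> ?x = u \<otimes> (?x \<otimes> l)" using V_comm[OF l(1) ax(2)] by blast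
      have uv: "v' \<otimes> u \<in> V" using V_mult v'(1) u(1) by blast
      have uvM: "v' \<in> carrier M" "u \<in> carrier M" using v'(1) u(1) V_in by auto
      have "?x \<otimes> \<phi> ?a l = (v' \<otimes> u) \<otimes> (?x \<otimes> l)"
        unfolding eq1 u(2) using uvM ax(2) l(1) by (simp add: M.m_assoc)
      then have "inv ?x \<otimes> (?x \<otimes> \<phi> ?a l) = inv ?x \<otimes> ((v' \<otimes> u) \<otimes> (?x \<otimes> l))" by simp
      moreover have "inv ?x \<otimes> (?x \<otimes> \<phi> ?a l) = \<phi> ?a l"
        using ax(2) pl by (simp add: M.m_assoc[symmetric])
      ultimately have "\<phi> ?a l = (inv ?x \<otimes> (v' \<otimes> u) \<otimes> inv (inv ?x)) \<otimes> l"
        using ax(2) uvM l(1) by (simp add: M.m_assoc)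
      moreover have "inv ?x \<otimes> (v' \<otimes> u) \<otimes> inv (inv ?x) \<in> V"
        using V_conj[OF _ uv, of "inv ?x"] ax(2) by simp
      moreover have "z \<otimes> l \<otimes> inv l = z" if "z \<in> V" for z
        using l(1) V_in[OF that] by (simp add: M.m_assoc)
      ultimately have "\<phi> ?a l \<otimes> inv l \<in> V" by metis
      then show "l \<in> Fix ?a" using l(1) unfolding Fix_def by blast
    qed
    moreover have "L \<noteq> {}" unfolding L_def K_def using k.hom_one M.one_closed by blast
    ultimately have "order G * card L < order M" using card_Fix[OF ax(1) na] by blast
    with \<open>order M \<le> order G * card K\<close> cardL show False by simp
  qed
  then have "f y \<in> inn N" if "y \<in> carrier M" for y
    using f_inner[OF that] dec[OF f_in(2)[OF that]] that unfolding inn_eq by (metis imageI)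
  then have sub: "H \<subseteq> inn N" using f_bij(1) by blast
  have "inj_on \<iota> (carrier M)" using \<iota>_inj by (rule inj_onI)
  then have "card (inn N) = card (carrier M)" unfolding inn_eq by (rule card_image)
  moreover have "card H = card (carrier M)" using card_image[OF f_bij(2)] f_bij(1) by simp
  moreover have "finite (inn N)" unfolding inn_eq using fin_M by blast
  ultimately show ?thesis using card_subset_eq[OF _ sub] by simp
qed

end

section \<open>Supersolvability\<close>

text \<open>A series with cyclic factors described by a generator of each step instead of quotient
  groups. In this form it is easily extended at the top and carried along isomorphisms.\<close>

inductive cyclic_series :: "('g, 'h) monoid_scheme \<Rightarrow> 'g set \<Rightarrow> bool" for G (structure) where
  base: "cyclic_series G {\<one>}"
| step: "cyclic_series G K \<Longrightarrow> K' \<lhd> G \<Longrightarrow> K \<subseteq> K' \<Longrightarrow> a \<in> K' \<Longrightarrow>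
    \<forall>x\<in>K'. \<exists>h\<in>K. \<exists>k::nat. x = h \<otimes> a [^] k \<Longrightarrow> cyclic_series G K'"

text \<open>Modulo \<open>K\<close> every element of \<open>K'\<close> is a power of
  \<open>a\<close>, so the coset of \<open>a\<close> generates the quotient.\<close>

lemma (in group) cyclic_quotient:
  assumes K: "K \<lhd> G" and K': "K' \<lhd> G" and sub: "K \<subseteq> K'" and a: "a \<in> K'"
    and gen: "\<forall>x\<in>K'. \<exists>h\<in>K. \<exists>k::nat. x = h \<otimes> a [^] k"
  shows "cyclic_group (subgroup_generated G K' Mod K)"
proof -
  let ?Q = "G\<lparr>carrier := K'\<rparr>"
  have sK': "subgroup K' G" using K' by (rule normal_imp_subgroup)
  have "generate G (carrier G \<inter> K') = K'"
    using subgroup.carrier_subgroup_generated_subgroup[OF sK'] by (simp add: carrier_subgroup_generated)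
  then have eq: "subgroup_generated G K' = ?Q" by (simp add: subgroup_generated_def)
  have nK: "K \<lhd> ?Q" by (rule normal_restrict_supergroup[OF sK' K sub])
  interpret nK: normal K ?Q by (rule nK)
  interpret Q: group "?Q Mod K" by (rule nK.factorgroup_is_group)
  let ?x = "K #>\<^bsub>?Q\<^esub> a"
  have x: "?x \<in> carrier (?Q Mod K)" using a unfolding carrier_FactGroup by auto
  have "carrier (?Q Mod K) = range (\<lambda>n::int. ?x [^]\<^bsub>?Q Mod K\<^esub> n)"
  proof (intro equalityI subsetI)
    fix z assume "z \<in> carrier (?Q Mod K)"
    then obtain y where y: "y \<in> K'" "z = K #>\<^bsub>?Q\<^esub> y" unfolding carrier_FactGroup by auto
    then obtain h k where hk: "h \<in> K" "y = h \<otimes> a [^] (k::nat)" using gen by blast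
    have hK': "h \<in> carrier ?Q" using hk(1) sub by auto
    have ak: "a [^]\<^bsub>?Q\<^esub> k = a [^] k" by (simp add: nat_pow_consistent[symmetric])
    have akc: "a [^]\<^bsub>?Q\<^esub> k \<in> carrier ?Q" using nK.nat_pow_closed a by simp
    have "z = K #>\<^bsub>?Q\<^esub> (h \<otimes>\<^bsub>?Q\<^esub> a [^]\<^bsub>?Q\<^esub> k)" using y hk ak by simp
    also have "\<dots> = K #>\<^bsub>?Q\<^esub> h #>\<^bsub>?Q\<^esub> (a [^]\<^bsub>?Q\<^esub> k)"
      using nK.coset_mult_assoc[OF nK.subset hK' akc] by simp
    also have "K #>\<^bsub>?Q\<^esub> h = K" by (rule nK.coset_join2[OF hK' nK.subgroup_axioms hk(1)])
    also have "K #>\<^bsub>?Q\<^esub> (a [^]\<^bsub>?Q\<^esub> k) = ?x [^]\<^bsub>?Q Mod K\<^esub> k"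
      using nK.FactGroup_pow[of a k] a by simp
    also have "\<dots> = ?x [^]\<^bsub>?Q Mod K\<^esub> int k" by (simp add: int_pow_int)
    finally show "z \<in> range (\<lambda>n::int. ?x [^]\<^bsub>?Q Mod K\<^esub> n)" by blast
  next
    fix z assume "z \<in> range (\<lambda>n::int. ?x [^]\<^bsub>?Q Mod K\<^esub> n)"
    then show "z \<in> carrier (?Q Mod K)" using Q.int_pow_closed[OF x] by blast
  qed
  then show ?thesis unfolding eq Q.cyclic_group using x by blast
qed

lemma (in group) cyclic_series_chain:
  assumes "cyclic_series G K"
  shows "\<exists>(n::nat) H. H 0 = {\<one>} \<and> H n = K \<and> (\<forall>i\<le>n. H i \<lhd> G) \<and>
    (\<forall>i<n. H i \<subseteq> H (Suc i) \<and> cyclic_group (subgroup_generated G (H (Suc i)) Mod H i))"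
  using assms
proof induction
  case base
  show ?case by (rule exI[of _ 0], rule exI[of _ "\<lambda>_. {\<one>}"]) (simp add: one_is_normal)
next
  case (step K K' a)
  then obtain n H where H: "H 0 = {\<one>}" "H n = K" "\<And>i. i \<le> n \<Longrightarrow> H i \<lhd> G"
      "\<And>i. i < n \<Longrightarrow> H i \<subseteq> H (Suc i) \<and> cyclic_group (subgroup_generated G (H (Suc i)) Mod H i)"
    by blast
  have cyc: "cyclic_group (subgroup_generated G K' Mod K)"
    using cyclic_quotient[of K K' a] H(2) H(3)[of n] step.hyps by blast
  define H' where "H' i = (if i \<le> n then H i else K')" for i
  have "H' 0 = {\<one>}" "H' (Suc n) = K'" using H(1) by (simp_all add: H'_def)
  moreover have "\<forall>i\<le>Suc n. H' i \<lhd> G" using H(3) step.hyps(2) by (simp add: H'_def)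
  moreover have "H' i \<subseteq> H' (Suc i) \<and> cyclic_group (subgroup_generated G (H' (Suc i)) Mod H' i)" if "i < Suc n" for i
  proof (cases "i = n")
    case True
    then show ?thesis using H(2) cyc step.hyps(3) by (simp add: H'_def)
  next
    case False
    then show ?thesis using H(4)[of i] that by (simp add: H'_def)
  qed
  ultimately show ?case by blast
qed

lemma (in group) cyclic_series_supersolvable:
  assumes "cyclic_series G (carrier G)" shows "supersolvable G"
  unfolding supersolvable_def using cyclic_series_chain[OF assms] .

lemma cyclic_series_image:
  assumes "group M" "group N" "b \<in> iso M N" "cyclic_series M K"
  shows "cyclic_series N (b ` K)"
  using assms(4)
proof induction
  case base
  have "b \<one>\<^bsub>M\<^esub> = \<one>\<^bsub>N\<^esub>" using assms hom_one by (auto simp: iso_def)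
  then show ?case using cyclic_series.base[of N] by simp
next
  case (step K K' a)
  interpret h: group_hom M N b
    using assms by (simp add: group_hom_def group_hom_axioms_def iso_def)
  have K'M: "K' \<subseteq> carrier M" using step.hyps(2) by (metis normal_imp_subgroup subgroup.subset)
  show ?case
  proof (rule cyclic_series.step[OF step.IH])
    have "b ` carrier M = carrier N" using assms(3) by (simp add: iso_def bij_betw_def)
    then show "b ` K' \<lhd> N"
      using normal.surj_hom_normal_subgroup[OF step.hyps(2) h.group_hom_axioms] by blast
    show "b ` K \<subseteq> b ` K'" "b a \<in> b ` K'" using step.hyps by blast+
    show "\<forall>x\<in>b ` K'. \<exists>h\<in>b ` K. \<exists>k::nat. x = h \<otimes>\<^bsub>N\<^esub> b a [^]\<^bsub>N\<^esub> k"
    proof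
      fix x assume "x \<in> b ` K'"
      then obtain y where y: "y \<in> K'" "x = b y" by blast
      obtain h k where hk: "h \<in> K" "y = h \<otimes>\<^bsub>M\<^esub> a [^]\<^bsub>M\<^esub> (k::nat)" using step.hyps(5) y(1) by blast
      have "h \<in> carrier M" "a \<in> carrier M" using hk(1) step.hyps(3,4) K'M by blast+
      then have "x = b h \<otimes>\<^bsub>N\<^esub> b a [^]\<^bsub>N\<^esub> k" unfolding y(2) hk(2) by (simp add: h.hom_nat_pow)
      then show "\<exists>h\<in>b ` K. \<exists>k::nat. x = h \<otimes>\<^bsub>N\<^esub> b a [^]\<^bsub>N\<^esub> k" using hk(1) by blast
    qed
  qed
qed

text \<open>In a finite group the inverse of \<open>x\<close> is the power
  \<open>x [^] (order G - 1)\<close>, so closure under products gives inverses.\<close>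

lemma (in group) finite_submonoid_subgroup:
  assumes fin: "finite (carrier G)" and H: "H \<subseteq> carrier G" "\<one> \<in> H"
    and mult: "\<And>x y. x \<in> H \<Longrightarrow> y \<in> H \<Longrightarrow> x \<otimes> y \<in> H"
  shows "subgroup H G"
proof (rule subgroupI)
  fix x assume x: "x \<in> H"
  then have xc: "x \<in> carrier G" using H by blast
  have pow: "x [^] k \<in> H" for k :: nat by (induction k) (use H x mult in auto)
  have "order G > 0" using fin by (simp add: order_gt_0_iff_finite)
  then have "x [^] (order G - 1) \<otimes> x = \<one>"
    using pow_order_eq_1[OF xc] by (metis Suc_diff_1 nat_pow_Suc)
  then have "inv x = x [^] (order G - 1)" using xc by (intro inv_equality) simp_all
  then show "inv x \<in> H" using pow by simp
qed (use H mult in auto)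

lemma (in group) finite_submonoid_normal:
  assumes "finite (carrier G)" "H \<subseteq> carrier G" "\<one> \<in> H"
    and "\<And>x y. x \<in> H \<Longrightarrow> y \<in> H \<Longrightarrow> x \<otimes> y \<in> H"
    and "\<And>x y. x \<in> carrier G \<Longrightarrow> y \<in> H \<Longrightarrow> x \<otimes> y \<otimes> inv x \<in> H"
  shows "H \<lhd> G"
  by (rule normal_invI[OF finite_submonoid_subgroup]) (use assms in auto)

section \<open>A normal series of N with cyclic factors\<close>

context coloured_group
begin

text \<open>The torus is abelian, so conjugation leaves the torus components alone. On the
  \<open>u\<close>-part of an element of \<open>V\<close> it acts by the torus weights, since U is
  abelian as well.\<close>

lemma conj_parts:
  assumes x: "(w1, u1, t1, s1) \<in> carrier N" and y: "(w, u, t, s) \<in> carrier N"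
  shows "\<exists>w'\<in>Wc. \<exists>u'\<in>Uc. (w1, u1, t1, s1) \<bullet> (w, u, t, s) \<bullet> inv\<^bsub>N\<^esub> (w1, u1, t1, s1) = (w', u', t, s) \<and>
    (t = ones \<longrightarrow> u' = (\<lambda>g. t1 g * u g))"
proof -
  define z where "z = (w1, u1, t1, s1) \<bullet> (w, u, t, s) \<bullet> inv\<^bsub>N\<^esub> (w1, u1, t1, s1)"
  have zc: "z \<in> carrier N"
    unfolding z_def by (intro N.m_closed N.inv_closed x y)
  obtain w' u' t' s' where z: "z = (w', u', t', s')" by (cases z)
  have mem: "w' \<in> Wc" "u' \<in> Uc" "t' \<in> Tc" "s' \<in> Tc" using zc unfolding z by auto
  have mem1: "w1 \<in> Wc" "u1 \<in> Uc" "t1 \<in> Tc" "s1 \<in> Tc" "w \<in> Wc" "u \<in> Uc" "t \<in> Tc" "s \<in> Tc" using x y by auto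
  have "(w1, u1, t1, s1) \<bullet> (w, u, t, s) = z \<bullet> (w1, u1, t1, s1)"
    using N.commute_conj_eq[OF x y zc] z_def by blast
  then have e: "(\<lambda>g. u1 g + t1 g * u g) = (\<lambda>g. u' g + t' g * u1 g)"
      "(\<lambda>g. t1 g * t g) = (\<lambda>g. t' g * t1 g)" "(\<lambda>g. s1 g * s g) = (\<lambda>g. s' g * s1 g)"
    unfolding z mult_N by simp_all
  have "t g = t' g" for g
    using fun_cong[OF e(2), of g] F_mult_cancel[of "t g" "t' g" "t1 g"] mem mem1 TcD by (simp add: mult.commute)
  then have t: "t' = t" by auto
  have "s g = s' g" for g
    using fun_cong[OF e(3), of g] F_mult_cancel[of "s g" "s' g" "s1 g"] mem mem1 TcD by (simp add: mult.commute)
  then have s: "s' = s" by auto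
  have "u' = (\<lambda>g. t1 g * u g)" if "t = ones"
  proof
    fix g show "u' g = t1 g * u g"
      using fun_cong[OF e(1), of g] UcD(1)[OF mem1(2), of g] unfolding t that by (simp add: add.commute)
  qed
  then show ?thesis using mem z t s unfolding z_def by blast
qed

text \<open>One index per basis vector: the identified indices with \<open>j = 0\<close> are
  represented by \<open>g = \<one>\<close>.\<close>

definition labels :: "('a \<times> 'a \<times> nat) set" where
  "labels = {(h, g, j). h \<in> C \<and> g \<in> C \<and> j \<le> m g h \<and> (j = 0 \<longrightarrow> g = \<one>)}"

text \<open>The unipotent part moves vectors only towards larger \<open>j\<close>, so a normal
  subgroup spanned by basis vectors has to follow the chains upwards. From \<open>j = 0\<close> the
  chains of all \<open>g'\<close> start, hence the exception.\<close>

definition upper :: "('a \<times> 'a \<times> nat) set \<Rightarrow> bool" where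
  "upper S \<longleftrightarrow> S \<subseteq> labels \<and> (\<forall>h g j g' j'. (h, g, j) \<in> S \<and> (h, g', j') \<in> labels \<and>
     j < j' \<and> (j = 0 \<or> g' = g) \<longrightarrow> (h, g', j') \<in> S)"

lemma upperD:
  "upper S \<Longrightarrow> (h, g, j) \<in> S \<Longrightarrow> (h, g', j') \<in> labels \<Longrightarrow> j < j' \<Longrightarrow> j = 0 \<or> g' = g \<Longrightarrow> (h, g', j') \<in> S"
  unfolding upper_def by blast

text \<open>The three layers of the series: \<open>KW\<close> grows inside W, \<open>KU\<close>
  contains W and grows in U, and \<open>KT\<close> contains \<open>V\<close> and grows in the
  torus.\<close>

definition KW where "KW S = {iW w | w. w \<in> Wc \<and> (\<forall>i\<in>labels. w i \<noteq> 0 \<longrightarrow> i \<in> S)}"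
definition KU where "KU A = {(w, u, ones :: 'a \<Rightarrow> 'k, ones :: 'a \<Rightarrow> 'k) | w u. w \<in> Wc \<and> u \<in> Uc \<and> (\<forall>g. u g \<noteq> 0 \<longrightarrow> g \<in> A)}"
definition KT where "KT A B = {(w, u, t, s) \<in> carrier N. (\<forall>g. t g \<noteq> e \<longrightarrow> g \<in> A) \<and> (\<forall>g. s g \<noteq> e \<longrightarrow> g \<in> B)}"

lemma label_support:
  assumes w: "w \<in> Wc" and nz: "w (h, g, j) \<noteq> 0"
  shows "(h, if j = 0 then \<one> else g, j) \<in> labels \<and> w (h, if j = 0 then \<one> else g, j) \<noteq> 0"
  using WcD(2)[OF w nz] WcD(3)[OF w, of g h] nz by (auto simp: labels_def)

lemma KW_normal:
  assumes S: "upper S" shows "KW S \<lhd> N"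
proof (rule N.finite_submonoid_normal[OF finite_N])
  show "KW S \<subseteq> carrier N" unfolding KW_def by auto
  show "\<one>\<^bsub>N\<^esub> \<in> KW S" unfolding KW_def iW_zero[symmetric] using Wc_zero by blast
  show "x \<bullet> y \<in> KW S" if xy: "x \<in> KW S" "y \<in> KW S" for x y
  proof -
    obtain w w' where *: "x = iW w" "y = iW w'" "w \<in> Wc" "w' \<in> Wc"
        "\<And>i. i \<in> labels \<Longrightarrow> w i \<noteq> 0 \<Longrightarrow> i \<in> S" "\<And>i. i \<in> labels \<Longrightarrow> w' i \<noteq> 0 \<Longrightarrow> i \<in> S"
      using xy unfolding KW_def by blast
    have "w i + w' i \<noteq> 0 \<Longrightarrow> w i \<noteq> 0 \<or> w' i \<noteq> 0" for i by auto
    then have "\<forall>i\<in>labels. w i + w' i \<noteq> 0 \<longrightarrow> i \<in> S" using *(5,6) by blast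
    moreover have "x \<bullet> y = iW (\<lambda>i. w i + w' i)" using * by (simp add: iW_mult)
    moreover have "(\<lambda>i. w i + w' i) \<in> Wc" using * by simp
    ultimately show ?thesis unfolding KW_def by blast
  qed
  show "x \<bullet> y \<bullet> inv\<^bsub>N\<^esub> x \<in> KW S" if x: "x \<in> carrier N" and y: "y \<in> KW S" for x y
  proof -
    obtain w where w: "y = iW w" "w \<in> Wc" "\<And>i. i \<in> labels \<Longrightarrow> w i \<noteq> 0 \<Longrightarrow> i \<in> S"
      using y unfolding KW_def by blast
    obtain w1 u t s where xe: "x = (w1, u, t, s)" by (cases x)
    have mem: "w1 \<in> Wc" "u \<in> Uc" "t \<in> Tc" "s \<in> Tc" using x unfolding xe by auto
    let ?w = "act u t s w"
    have "x \<bullet> y = iW ?w \<bullet> x"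
      unfolding xe w(1) iW_def using mem w(2) by (simp add: UcD TcD add.commute)
    then have conj: "x \<bullet> y \<bullet> inv\<^bsub>N\<^esub> x = iW ?w"
      using N.commute_conj_eq[OF x, of y "iW ?w"] w(1,2) by simp
    have "(h, g, j) \<in> S" if l: "(h, g, j) \<in> labels" and nz: "?w (h, g, j) \<noteq> 0" for h g j
    proof -
      \<comment> \<open>A coordinate of the transformed vector depends only on coordinates at or
        below it in the same chain, so the upward closure of \<open>S\<close> covers it.\<close>
      have "\<exists>i\<le>j. w (h, g, i) \<noteq> 0"
      proof (rule ccontr)
        assume "\<not> ?thesis"
        then have "?w (h, g, j) = 0" by (simp add: act_apply)
        with nz show False by simp
      qed
      then obtain i where i: "i \<le> j" "w (h, g, i) \<noteq> 0" by blast
      have inS: "(h, if i = 0 then \<one> else g, i) \<in> S"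
        using label_support[OF w(2) i(2)] w(3) by blast
      show ?thesis
      proof (cases "i = j")
        case True
        then show ?thesis using inS l by (auto simp: labels_def split: if_splits)
      next
        case False
        then have "i < j" using i(1) by simp
        then show ?thesis by (rule upperD[OF S inS l]) simp
      qed
    qed
    then show ?thesis unfolding conj KW_def using w(2) by fastforce
  qed
qed

lemma KU_normal: "KU A \<lhd> N"
proof (rule N.finite_submonoid_normal[OF finite_N])
  show "KU A \<subseteq> carrier N" unfolding KU_def by auto
  show "\<one>\<^bsub>N\<^esub> \<in> KU A" unfolding KU_def one_N by auto
  show "x \<bullet> y \<in> KU A" if xy: "x \<in> KU A" "y \<in> KU A" for x y
  proof -
    obtain w u w' u' where *: "x = (w, u, ones, ones)" "y = (w', u', ones, ones)" "w \<in> Wc" "u \<in> Uc" "w' \<in> Wc" "u' \<in> Uc"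
        "\<And>g. u g \<noteq> 0 \<Longrightarrow> g \<in> A" "\<And>g. u' g \<noteq> 0 \<Longrightarrow> g \<in> A"
      using xy unfolding KU_def by blast
    have "u g + e * u' g \<noteq> 0 \<Longrightarrow> u g \<noteq> 0 \<or> u' g \<noteq> 0" for g by auto
    then have "\<forall>g. u g + e * u' g \<noteq> 0 \<longrightarrow> g \<in> A" using * by blast
    moreover have "x \<bullet> y = (\<lambda>i. w i + act u ones ones w' i, \<lambda>g. u g + e * u' g, ones, ones)"
      unfolding * by (simp add: idem)
    moreover have "(\<lambda>i. w i + act u ones ones w' i) \<in> Wc" "(\<lambda>g. u g + e * u' g) \<in> Uc" using * by simp_all
    ultimately show ?thesis unfolding KU_def by blast
  qed
  show "x \<bullet> y \<bullet> inv\<^bsub>N\<^esub> x \<in> KU A" if x: "x \<in> carrier N" and yA: "y \<in> KU A" for x y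
  proof -
    obtain w u where y: "y = (w, u, ones, ones)" "w \<in> Wc" "u \<in> Uc" "\<And>g. u g \<noteq> 0 \<Longrightarrow> g \<in> A"
      using yA unfolding KU_def by blast
    obtain w1 u1 t1 s1 where xe: "x = (w1, u1, t1, s1)" by (cases x)
    have "(w, u, ones, ones) \<in> carrier N" using y by simp
    from conj_parts[OF x[unfolded xe] this] obtain w' u' where
        "w' \<in> Wc" "u' \<in> Uc" "x \<bullet> y \<bullet> inv\<^bsub>N\<^esub> x = (w', u', ones, ones)" "u' = (\<lambda>g. t1 g * u g)"
      unfolding xe y(1) by auto
    moreover have "g \<in> A" if "t1 g * u g \<noteq> 0" for g using y(4)[of g] that by (cases "u g = 0") auto
    ultimately show ?thesis unfolding KU_def by blast
  qed
qed

lemma KT_normal: "KT A B \<lhd> N"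
proof (rule N.finite_submonoid_normal[OF finite_N])
  show "KT A B \<subseteq> carrier N" unfolding KT_def by blast
  show "\<one>\<^bsub>N\<^esub> \<in> KT A B" unfolding KT_def one_N by simp
  show "x \<bullet> y \<in> KT A B" if xy: "x \<in> KT A B" "y \<in> KT A B" for x y
  proof -
    obtain w u t s where xe: "x = (w, u, t, s)" by (cases x)
    obtain w' u' t' s' where ye: "y = (w', u', t', s')" by (cases y)
    have *: "(w, u, t, s) \<in> carrier N" "(w', u', t', s') \<in> carrier N"
        "\<And>g. t g \<noteq> e \<Longrightarrow> g \<in> A" "\<And>g. t' g \<noteq> e \<Longrightarrow> g \<in> A" "\<And>g. s g \<noteq> e \<Longrightarrow> g \<in> B" "\<And>g. s' g \<noteq> e \<Longrightarrow> g \<in> B"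
      using xy unfolding KT_def xe ye by auto
    have "x \<bullet> y \<in> carrier N" unfolding xe ye by (rule N.m_closed[OF *(1,2)])
    moreover have "g \<in> A" if "t g * t' g \<noteq> e" for g
      using *(3)[of g] *(4)[of g] that by (cases "t g = e"; cases "t' g = e") (auto simp: idem)
    moreover have "g \<in> B" if "s g * s' g \<noteq> e" for g
      using *(5)[of g] *(6)[of g] that by (cases "s g = e"; cases "s' g = e") (auto simp: idem)
    ultimately show ?thesis unfolding KT_def xe ye by simp
  qed
  show "x \<bullet> y \<bullet> inv\<^bsub>N\<^esub> x \<in> KT A B" if x: "x \<in> carrier N" and y: "y \<in> KT A B" for x y
  proof -
    obtain w1 u1 t1 s1 where xe: "x = (w1, u1, t1, s1)" by (cases x)
    obtain w u t s where ye: "y = (w, u, t, s)" by (cases y)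
    have *: "(w, u, t, s) \<in> carrier N" "\<And>g. t g \<noteq> e \<Longrightarrow> g \<in> A" "\<And>g. s g \<noteq> e \<Longrightarrow> g \<in> B"
      using y unfolding KT_def ye by auto
    obtain w' u' where "w' \<in> Wc" "u' \<in> Uc" "x \<bullet> y \<bullet> inv\<^bsub>N\<^esub> x = (w', u', t, s)"
      using conj_parts[OF x[unfolded xe] *(1)] unfolding xe ye by blast
    then show ?thesis unfolding KT_def using * by simp
  qed
qed

lemma finite_labels: "finite labels"
proof (rule finite_subset)
  show "labels \<subseteq> C \<times> C \<times> {..<p}"
  proof (rule subsetI)
    fix i assume "i \<in> labels"
    then obtain h g j where i: "i = (h, g, j)" "h \<in> C" "g \<in> C" "j \<le> m g h" unfolding labels_def by blast
    then show "i \<in> C \<times> C \<times> {..<p}" using m_less_p[of g h] by simp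
  qed
qed (use fin_G in simp)

text \<open>The series is built from the chain ends downwards: removing a label with smallest
  \<open>j\<close> from an upper set leaves an upper set, and the removed basis vector generates the
  factor.\<close>

lemma cyclic_series_KW: "upper S \<Longrightarrow> cyclic_series N (KW S)"
proof (induction "card S" arbitrary: S)
  case 0
  have "finite S" using 0(2) finite_labels unfolding upper_def by (meson finite_subset)
  then have S: "S = {}" using 0 by simp
  have "w = zeros" if "w \<in> Wc" "\<forall>i\<in>labels. w i \<noteq> 0 \<longrightarrow> i \<in> S" for w
  proof (rule ext, rule ccontr)
    fix i assume nz: "w i \<noteq> 0"
    obtain h g j where i: "i = (h, g, j)" by (cases i)
    show False using label_support[OF that(1), of h g j] nz that(2) unfolding i S by blast
  qed
  then have "KW S \<subseteq> {\<one>\<^bsub>N\<^esub>}" unfolding KW_def iW_zero[symmetric] by blast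
  moreover have "\<one>\<^bsub>N\<^esub> \<in> KW S" unfolding KW_def iW_zero[symmetric] using Wc_zero by blast
  ultimately have "KW S = {\<one>\<^bsub>N\<^esub>}" by blast
  then show ?case using cyclic_series.base[of N] by simp
next
  case (Suc n)
  have fin: "finite S" using Suc(3) finite_labels unfolding upper_def by (meson finite_subset)
  have "S \<noteq> {}" using Suc(2) by auto
  \<comment> \<open>Minimality of \<open>j\<close> ensures that no remaining label forces
    \<open>i0\<close> back into the set, as only labels with strictly larger \<open>j\<close> are
    forced.\<close>
  then obtain i0 where i0: "i0 \<in> S" "\<And>i. i \<in> S \<Longrightarrow> snd (snd i0) \<le> snd (snd i)"
    using ex_min_if_finite[of "(\<lambda>i. snd (snd i)) ` S"] fin by (metis (no_types, lifting) finite_imageI image_iff image_is_empty linorder_not_less)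
  obtain h g j where ie: "i0 = (h, g, j)" by (cases i0)
  have lab: "(h, g, j) \<in> labels" using i0(1) Suc(3) unfolding ie upper_def by blast
  then have hgj: "h \<in> C" "g \<in> C" "j \<le> m g h" "j = 0 \<longrightarrow> g = \<one>" unfolding labels_def by auto
  let ?S = "S - {i0}"
  have upS: "upper ?S"
    unfolding upper_def
  proof (intro conjI allI impI)
    show "?S \<subseteq> labels" using Suc(3) unfolding upper_def by blast
    fix h1 g1 j1 g1' j1' assume *: "(h1, g1, j1) \<in> ?S \<and> (h1, g1', j1') \<in> labels \<and> j1 < j1' \<and> (j1 = 0 \<or> g1' = g1)"
    then have "(h1, g1', j1') \<in> S" using Suc(3) unfolding upper_def by blast
    moreover have "j \<le> j1" using i0(2)[of "(h1, g1, j1)"] * unfolding ie by simp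
    then have "(h1, g1', j1') \<noteq> i0" using * unfolding ie by auto
    ultimately show "(h1, g1', j1') \<in> ?S" by blast
  qed
  have "card ?S = n" using Suc(2) i0(1) fin by simp
  then have ser: "cyclic_series N (KW ?S)" using Suc(1) upS by blast
  let ?b = "basis_vec h g j"
  show ?case
  proof (rule cyclic_series.step[OF ser KW_normal[OF Suc(3)]])
    show "KW ?S \<subseteq> KW S" unfolding KW_def by blast
    have b_lab: "i = i0" if "i \<in> labels" "?b a i \<noteq> 0" for i a
    proof -
      obtain h' g' j' where i: "i = (h', g', j')" by (cases i)
      show ?thesis using that hgj unfolding i ie labels_def basis_vec_def by (auto split: if_splits)
    qed
    have bW: "?b a \<in> Wc" if "a \<in> F" for a using hgj that by simp
    have "\<forall>i\<in>labels. ?b e i \<noteq> 0 \<longrightarrow> i \<in> S" using b_lab i0(1) by blast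
    then show "iW (?b e) \<in> KW S" unfolding KW_def using bW[OF F_intros(2)] by blast
    show "\<forall>x\<in>KW S. \<exists>y\<in>KW ?S. \<exists>k::nat. x = y \<bullet> iW (?b e) [^]\<^bsub>N\<^esub> k"
    proof
      fix x assume "x \<in> KW S"
      then obtain w where w: "x = iW w" "w \<in> Wc" "\<And>i. i \<in> labels \<Longrightarrow> w i \<noteq> 0 \<Longrightarrow> i \<in> S"
        unfolding KW_def by blast
      have aF: "w i0 \<in> F" by (rule WcD(1)[OF w(2)])
      obtain k where k: "w i0 = of_nat k * e" using F_of_nat[OF aF] by blast
      let ?w = "\<lambda>i. w i + - ?b (w i0) i"
      have wW: "?w \<in> Wc" by (rule Wc_add[OF w(2) Wc_uminus[OF bW[OF aF]]])
      have "i \<in> ?S" if l: "i \<in> labels" and nz: "?w i \<noteq> 0" for i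
      proof (cases "i = i0")
        case True
        then have "?w i = 0" unfolding ie by (simp add: basis_vec_apply)
        with nz show ?thesis by simp
      next
        case False
        then have "?b (w i0) i = 0" using b_lab l by blast
        then show ?thesis using w(3)[OF l] nz False by simp
      qed
      then have y: "iW ?w \<in> KW ?S" unfolding KW_def using wW by blast
      have "iW (?b e) [^]\<^bsub>N\<^esub> k = iW (?b (w i0))"
        using pow_iW[OF bW[OF F_intros(2)]] k by (simp add: basis_vec_scale)
      then have "iW ?w \<bullet> iW (?b e) [^]\<^bsub>N\<^esub> k = x"
        using iW_mult[OF bW[OF aF], of ?w] w(1) by simp
      then show "\<exists>y\<in>KW ?S. \<exists>k::nat. x = y \<bullet> iW (?b e) [^]\<^bsub>N\<^esub> k"
        by (intro bexI[OF _ y] exI[of _ k]) (rule sym)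
    qed
  qed
qed

text \<open>The power of the new generator is split off on the right; its W-part is zero there, so
  \<open>w\<close> is left unchanged. The induction starts from the whole of W.\<close>

lemma cyclic_series_KU:
  assumes "finite A" "A \<subseteq> C" shows "cyclic_series N (KU A)"
  using assms
proof (induction A rule: finite_induct)
  case empty
  have "upper labels" unfolding upper_def by blast
  moreover have "KU {} = KW labels"
  proof -
    have "u = zeros" if "\<forall>g. u g \<noteq> 0 \<longrightarrow> g \<in> {}" for u :: "'a \<Rightarrow> 'k" using that by auto
    then show ?thesis unfolding KU_def KW_def iW_def by auto
  qed
  ultimately show ?case using cyclic_series_KW by simp
next
  case (insert g A)
  then have g: "g \<in> C" and IH: "cyclic_series N (KU A)" by auto
  show ?case
  proof (rule cyclic_series.step[OF IH KU_normal])
    show "KU A \<subseteq> KU (insert g A)" unfolding KU_def by blast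
    show "xel g \<in> KU (insert g A)"
      unfolding KU_def iU_def using unit_vec_in[OF g F_intros(2)] by (auto simp: unit_vec_def)
    show "\<forall>x\<in>KU (insert g A). \<exists>y\<in>KU A. \<exists>k::nat. x = y \<bullet> xel g [^]\<^bsub>N\<^esub> k"
    proof
      fix x assume "x \<in> KU (insert g A)"
      then obtain w u where x: "x = (w, u, ones, ones)" "w \<in> Wc" "u \<in> Uc" "\<And>h. u h \<noteq> 0 \<Longrightarrow> h \<in> insert g A"
        unfolding KU_def by blast
      obtain k where k: "u g = of_nat k * e" using F_of_nat[OF UcD(1)[OF x(3)]] by blast
      let ?u = "\<lambda>h. if h = g then 0 else u h"
      have uU: "?u \<in> Uc" by (rule UcI) (simp_all add: UcD x(3))
      have "\<forall>h. ?u h \<noteq> 0 \<longrightarrow> h \<in> A" using x(4) by auto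
      then have y: "(w, ?u, ones, ones) \<in> KU A" unfolding KU_def using x(2) uU by blast
      have "xel g [^]\<^bsub>N\<^esub> k = iU (unit_vec g (u g))"
        using g k by (simp add: pow_iU unit_vec_scale)
      then have "(w, ?u, ones, ones) \<bullet> xel g [^]\<^bsub>N\<^esub> k = x"
        unfolding x(1) by (auto simp: iU_def unit_vec_def fun_eq_iff UcD x(3) idem)
      then show "\<exists>y\<in>KU A. \<exists>k::nat. x = y \<bullet> xel g [^]\<^bsub>N\<^esub> k"
        by (intro bexI[OF _ y] exI[of _ k]) (rule sym)
    qed
  qed
qed

lemma V_eq: "V = KU C" "V = KT {} {}"
  unfolding V_def KU_def KT_def using UcD(2) by (auto simp: fun_eq_iff)

text \<open>Positive exponents only, as the zeroth power of the entries would be \<open>1\<close>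
  instead of \<open>e\<close>. \<open>zeta\<close> likewise represents every nonzero element by a
  positive exponent.\<close>

lemma pow_iT:
  fixes k :: nat
  assumes "t \<in> Tc" "s \<in> Tc" "k > 0"
  shows "iT t s [^]\<^bsub>N\<^esub> k = iT (\<lambda>g. t g ^ k) (\<lambda>g. s g ^ k)"
  using assms(3)
proof (induction k rule: nat_induct_non_zero)
  case 1
  have "iT t s [^]\<^bsub>N\<^esub> (1::nat) = iT t s" by (rule N.nat_pow_eone) (use assms in simp)
  then show ?case by simp
next
  case (Suc k)
  then show ?case by (simp add: iT_mult mult.commute)
qed

lemma Tc_reset: "t \<in> Tc \<Longrightarrow> (\<lambda>h. if h = g then e else t h) \<in> Tc"
  by (rule TcI) (simp_all add: TcD)

lemma cyclic_series_KT1: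
  assumes "finite A" "A \<subseteq> C" shows "cyclic_series N (KT A {})"
  using assms
proof (induction A rule: finite_induct)
  case empty
  show ?case using cyclic_series_KU[OF fin_G order_refl] V_eq by simp
next
  case (insert g A)
  then have g: "g \<in> C" and IH: "cyclic_series N (KT A {})" by auto
  have at: "at_coord g zeta \<in> Tc" using g zeta by simp
  let ?a = "iT (at_coord g zeta) ones"
  show ?case
  proof (rule cyclic_series.step[OF IH KT_normal])
    show "KT A {} \<subseteq> KT (insert g A) {}" unfolding KT_def by blast
    show "?a \<in> KT (insert g A) {}" using at unfolding KT_def iT_def by (auto simp: at_coord_def)
    show "\<forall>x\<in>KT (insert g A) {}. \<exists>y\<in>KT A {}. \<exists>k::nat. x = y \<bullet> ?a [^]\<^bsub>N\<^esub> k"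
    proof
      fix x assume x: "x \<in> KT (insert g A) {}"
      obtain w u t s where xe: "x = (w, u, t, s)" by (cases x)
      have *: "w \<in> Wc" "u \<in> Uc" "t \<in> Tc" "s \<in> Tc" "\<And>h. t h \<noteq> e \<Longrightarrow> h \<in> insert g A" "\<And>h. s h = e"
        using x unfolding KT_def xe by auto
      obtain k where k: "k > 0" "t g = zeta ^ k" using zeta(4)[OF TcD(1,2)[OF *(3)]] by blast
      let ?t = "\<lambda>h. if h = g then e else t h"
      have y: "(w, u, ?t, s) \<in> KT A {}" unfolding KT_def using * Tc_reset[OF *(3)] by auto
      have "?a [^]\<^bsub>N\<^esub> k = iT (\<lambda>h. at_coord g zeta h ^ k) ones" using pow_iT[OF at Tc_one k(1)] k(1) by simp
      moreover have "?t h * at_coord g zeta h ^ k = t h" for h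
        using k TcD(1)[OF *(3), of h] by (auto simp: at_coord_def)
      ultimately have "(w, u, ?t, s) \<bullet> ?a [^]\<^bsub>N\<^esub> k = x"
        using *(4) unfolding xe by (simp add: iT_def TcD)
      then show "\<exists>y\<in>KT A {}. \<exists>k::nat. x = y \<bullet> ?a [^]\<^bsub>N\<^esub> k"
        by (intro bexI[OF _ y] exI[of _ k]) (rule sym)
    qed
  qed
qed

lemma cyclic_series_KT2:
  assumes "finite B" "B \<subseteq> C" shows "cyclic_series N (KT C B)"
  using assms
proof (induction B rule: finite_induct)
  case empty
  show ?case by (rule cyclic_series_KT1[OF fin_G order_refl])
next
  case (insert g B)
  then have g: "g \<in> C" and IH: "cyclic_series N (KT C B)" by auto
  have at: "at_coord g zeta \<in> Tc" using g zeta by simp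
  let ?a = "iT ones (at_coord g zeta)"
  show ?case
  proof (rule cyclic_series.step[OF IH KT_normal])
    show "KT C B \<subseteq> KT C (insert g B)" unfolding KT_def by blast
    show "?a \<in> KT C (insert g B)" using at unfolding KT_def iT_def by (auto simp: at_coord_def)
    show "\<forall>x\<in>KT C (insert g B). \<exists>y\<in>KT C B. \<exists>k::nat. x = y \<bullet> ?a [^]\<^bsub>N\<^esub> k"
    proof
      fix x assume x: "x \<in> KT C (insert g B)"
      obtain w u t s where xe: "x = (w, u, t, s)" by (cases x)
      have *: "w \<in> Wc" "u \<in> Uc" "t \<in> Tc" "s \<in> Tc" "\<And>h. s h \<noteq> e \<Longrightarrow> h \<in> insert g B" "\<And>h. t h \<noteq> e \<Longrightarrow> h \<in> C"
        using x unfolding KT_def xe by auto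
      obtain k where k: "k > 0" "s g = zeta ^ k" using zeta(4)[OF TcD(1,2)[OF *(4)]] by blast
      let ?s = "\<lambda>h. if h = g then e else s h"
      have y: "(w, u, t, ?s) \<in> KT C B" unfolding KT_def using * Tc_reset[OF *(4)] by auto
      have "?a [^]\<^bsub>N\<^esub> k = iT ones (\<lambda>h. at_coord g zeta h ^ k)" using pow_iT[OF Tc_one at k(1)] k(1) by simp
      moreover have "?s h * at_coord g zeta h ^ k = s h" for h
        using k TcD(1)[OF *(4), of h] by (auto simp: at_coord_def)
      ultimately have "(w, u, t, ?s) \<bullet> ?a [^]\<^bsub>N\<^esub> k = x"
        using *(3) unfolding xe by (simp add: iT_def TcD)
      then show "\<exists>y\<in>KT C B. \<exists>k::nat. x = y \<bullet> ?a [^]\<^bsub>N\<^esub> k"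
        by (intro bexI[OF _ y] exI[of _ k]) (rule sym)
    qed
  qed
qed

lemma cyclic_series_N: "cyclic_series N (carrier N)"
proof -
  have "g \<in> C" if "t \<in> Tc" "t g \<noteq> e" for t g using TcD(3) that by blast
  then have "KT C C = carrier N" unfolding KT_def by auto
  then show ?thesis using cyclic_series_KT2[OF fin_G order_refl] by simp
qed

text \<open>The quotient of \<open>N\<close> by \<open>V\<close> is the torus, which is
  abelian.\<close>

lemma V_commutator_N:
  assumes "x \<in> carrier N" "y \<in> carrier N"
  shows "\<exists>v\<in>V. x \<bullet> y = v \<bullet> (y \<bullet> x)"
proof -
  obtain w1 u1 t1 s1 where xe: "x = (w1, u1, t1, s1)" by (cases x)
  obtain w2 u2 t2 s2 where ye: "y = (w2, u2, t2, s2)" by (cases y)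
  have m1: "t1 \<in> Tc" "s1 \<in> Tc" "t2 \<in> Tc" "s2 \<in> Tc" using assms unfolding xe ye by auto
  define z where "z = x \<bullet> y \<bullet> inv\<^bsub>N\<^esub> (y \<bullet> x)"
  have zc: "z \<in> carrier N" unfolding z_def using assms by simp
  have eq: "z \<bullet> (y \<bullet> x) = x \<bullet> y"
    using assms N.m_assoc[of "x \<bullet> y" "inv\<^bsub>N\<^esub> (y \<bullet> x)" "y \<bullet> x"]
    unfolding z_def by (simp del: N.inv_mult_group)
  obtain w u t s where ze: "z = (w, u, t, s)" by (cases z)
  have mem: "w \<in> Wc" "u \<in> Uc" "t \<in> Tc" "s \<in> Tc" using zc unfolding ze by auto
  have e: "(\<lambda>g. t g * (t2 g * t1 g)) = (\<lambda>g. t1 g * t2 g)" "(\<lambda>g. s g * (s2 g * s1 g)) = (\<lambda>g. s1 g * s2 g)"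
    using eq unfolding ze xe ye by simp_all
  have cancel: "a = e" if "a \<in> F" "b \<in> F" "b \<noteq> 0" "a * b = b" for a b
    using F_mult_cancel[of a e b] that by (simp add: mult.commute)
  have "t g = e" for g
  proof (rule cancel)
    show "t g \<in> F" "t2 g * t1 g \<in> F" "t2 g * t1 g \<noteq> 0"
      using TcD(1)[OF mem(3)] TcD(1,2)[OF Tc_mult[OF m1(3) m1(1)], of g] by simp_all
    show "t g * (t2 g * t1 g) = t2 g * t1 g" using fun_cong[OF e(1), of g] by (simp add: mult.commute)
  qed
  moreover have "s g = e" for g
  proof (rule cancel)
    show "s g \<in> F" "s2 g * s1 g \<in> F" "s2 g * s1 g \<noteq> 0"
      using TcD(1)[OF mem(4)] TcD(1,2)[OF Tc_mult[OF m1(4) m1(2)], of g] by simp_all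
    show "s g * (s2 g * s1 g) = s2 g * s1 g" using fun_cong[OF e(2), of g] by (simp add: mult.commute)
  qed
  ultimately have "z \<in> V" using mem unfolding ze by (auto simp: fun_eq_iff)
  then show ?thesis using eq by metis
qed

text \<open>The torus elements with a single free entry, placed at \<open>\<one>\<close>, form a set
  of \<open>p - 1\<close> members. A nontrivial translation moves this coordinate away, so the
  quotient of two different members is not fixed modulo \<open>V\<close>.\<close>

lemma Phi_moved:
  assumes a: "a \<in> C" "a \<noteq> \<one>"
  shows "\<exists>D\<subseteq>carrier N. order G < card D \<and> (\<forall>d\<in>D. \<forall>d'\<in>D. d \<noteq> d' \<longrightarrow>
    Phi a (inv\<^bsub>N\<^esub> d \<bullet> d') \<bullet> inv\<^bsub>N\<^esub> (inv\<^bsub>N\<^esub> d \<bullet> d') \<notin> V)"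
proof -
  define f where "f l = iT (at_coord \<one> l) ones" for l
  let ?D = "f ` (F - {0})"
  have f_in: "f l \<in> carrier N" if "l \<in> F - {0}" for l using that by (simp add: f_def)
  have "inj_on f (F - {0})"
  proof (rule inj_onI)
    fix l l' assume "f l = f l'"
    then have "at_coord \<one> l \<one> = at_coord \<one> l' \<one>" by (simp add: f_def)
    then show "l = l'" by (simp add: at_coord_def)
  qed
  then have "card ?D = p - 1" by (simp add: card_image card_F)
  then have "order G < card ?D" using p_large by (simp add: order_def)
  moreover have "Phi a (inv\<^bsub>N\<^esub> d \<bullet> d') \<bullet> inv\<^bsub>N\<^esub> (inv\<^bsub>N\<^esub> d \<bullet> d') \<notin> V"
    if d: "d \<in> ?D" "d' \<in> ?D" "d \<noteq> d'" for d d'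
  proof
    obtain l l' where l: "l \<in> F - {0}" "l' \<in> F - {0}" "d = f l" "d' = f l'" using d by blast
    have ne: "l \<noteq> l'" using d(3) l by blast
    let ?x = "inv\<^bsub>N\<^esub> d \<bullet> d'"
    assume zV: "Phi a ?x \<bullet> inv\<^bsub>N\<^esub> ?x \<in> V"
    have dc: "d \<in> carrier N" "d' \<in> carrier N" using l f_in by auto
    then have xc: "?x \<in> carrier N" by simp
    obtain w u t s where xe: "?x = (w, u, t, s)" by (cases ?x)
    have t: "t \<in> Tc" using xc unfolding xe by simp
    have "d \<bullet> ?x = d'" using dc by (simp add: N.m_assoc[symmetric])
    then have tl: "(\<lambda>g. at_coord \<one> l g * t g) = at_coord \<one> l'"
      unfolding xe unfolding l f_def iT_def by simp
    obtain wz uz where z: "Phi a ?x \<bullet> inv\<^bsub>N\<^esub> ?x = (wz, uz, ones, ones)"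
      using zV by (cases "Phi a ?x \<bullet> inv\<^bsub>N\<^esub> ?x") auto
    have "Phi a ?x = (Phi a ?x \<bullet> inv\<^bsub>N\<^esub> ?x) \<bullet> ?x"
      using Phi_in[OF a(1) xc] xc by (simp add: N.m_assoc del: N.inv_mult_group)
    then have "Phi a (w, u, t, s) = (wz, uz, ones, ones) \<bullet> (w, u, t, s)" unfolding z unfolding xe .
    then have "shift_F e a t = (\<lambda>g. e * t g)" using xc unfolding xe by (simp add: Phi_apply)
    \<comment> \<open>At the coordinate \<open>\<one>\<close> the shifted element shows the entry at
      \<open>inv a\<close>, which is trivial because \<open>inv a \<noteq> \<one>\<close>. So the
      entry at \<open>\<one>\<close> is trivial too, contradicting
      \<open>l \<noteq> l'\<close>.\<close>
    then have "shift_F e a t \<one> = e * t \<one>" by (rule fun_cong)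
    then have "t (inv a) = t \<one>" using a t by (simp add: shift_F_def TcD)
    moreover have "inv a \<noteq> \<one>" using a by simp
    then have "e * t (inv a) = e" using fun_cong[OF tl, of "inv a"] by (simp add: at_coord_def)
    ultimately have "t \<one> = e" using t by (simp add: TcD)
    then have "l = l'" using fun_cong[OF tl, of \<one>] l by (simp add: at_coord_def)
    with ne show False by simp
  qed
  moreover have "?D \<subseteq> carrier N" using f_in by blast
  ultimately show ?thesis by blast
qed

lemma split_automorphisms:
  fixes N' :: "('n, 'y) monoid_scheme"
  assumes N': "group N'" and b: "b \<in> iso N N'"
  shows "split_automorphisms N N' G b Phi V (p ^ 2)"
proof (intro split_automorphisms.intro split_automorphisms_axioms.intro)
  show "coprime (p ^ 2) (order G)"
  proof -
    have "\<not> p dvd order G"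
      using p_large G.order_gt_0_iff_finite fin_G by (auto simp: order_def dest: dvd_imp_le)
    then show ?thesis using prime_imp_coprime[OF prime_p] by simp
  qed
  show "V \<lhd> N" unfolding V_eq(1) by (rule KU_normal)
  show "x \<in> V \<longleftrightarrow> x [^]\<^bsub>N\<^esub> (p ^ 2) = \<one>\<^bsub>N\<^esub>" if "x \<in> carrier N" for x
    by (rule V_iff_pow[OF that])
  show "\<exists>v\<in>V. x \<bullet> y = v \<bullet> (y \<bullet> x)" if "x \<in> carrier N" "y \<in> carrier N" for x y
    by (rule V_commutator_N[OF that])
  show "\<exists>a\<in>C. \<exists>x\<in>carrier N. \<forall>y\<in>carrier N. x \<bullet> \<alpha> y \<bullet> inv\<^bsub>N\<^esub> x = Phi a y" if "\<alpha> \<in> iso N N" for \<alpha>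
    by (rule aut_classification[OF that])
  show "Phi (a \<otimes> a') x = Phi a (Phi a' x)" if "a \<in> C" "a' \<in> C" "x \<in> carrier N" for a a' x
    by (rule Phi_comp[OF that])
  show "Phi a \<in> iso N N" if "a \<in> C" for a
    by (rule Phi_iso[OF that])
  show "\<exists>D\<subseteq>carrier N. order G < card D \<and> (\<forall>d\<in>D. \<forall>d'\<in>D. d \<noteq> d' \<longrightarrow>
      Phi a (inv\<^bsub>N\<^esub> d \<bullet> d') \<bullet> inv\<^bsub>N\<^esub> (inv\<^bsub>N\<^esub> d \<bullet> d') \<notin> V)" if "a \<in> C" "a \<noteq> \<one>" for a
    by (rule Phi_moved[OF that])
qed (rule group_N N' b G.is_group finite_N fin_G center_N)+

end

theorem theorem4p2:
  fixes G :: "('a, 'b) monoid_scheme"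
  assumes "group G" and "finite (carrier G)"
  shows "\<exists>N :: nat monoid. group N \<and> finite (carrier N) \<and>
    G \<cong> OutGroup N \<and>
    center N = {\<one>\<^bsub>N\<^esub>} \<and>
    (\<forall>H. subgroup H (AutoGroup N) \<and> (AutoGroup N)\<lparr>carrier := H\<rparr> \<cong> N \<longrightarrow> H = inn N) \<and>
    (\<exists>s. s \<in> hom (OutGroup N) (AutoGroup N) \<and>
         (\<forall>C \<in> carrier (OutGroup N). out_quot N (s C) = C)) \<and>
    supersolvable N"
proof -
  let ?n = "card (carrier G)"
  obtain p where p: "Factorial_Ring.prime p" "p > ?n + 4" using bigger_prime by blast
  obtain f where f: "bij_betw f (carrier G) {0..<?n}"
    using ex_bij_betw_finite_nat[OF assms(2)] by blast
  interpret K: prime_corner "residues_unit p" p by (rule prime_corner_residues_unit[OF p(1)])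
  \<comment> \<open>\<open>f\<close> numbers the elements from 0 to \<open>?n - 1\<close>, so the
    colours fill the range from 2 to \<open>?n + 1\<close> required by the locale.\<close>
  interpret K: coloured_group "residues_unit p" p G "\<lambda>x. f x + 2"
  proof (intro coloured_group.intro coloured_group_axioms.intro)
    show "inj_on (\<lambda>x. f x + 2) (carrier G)" using f by (simp add: bij_betw_def inj_on_def)
    show "f x + 2 \<le> Suc ?n" if "x \<in> carrier G" for x
      using bij_betwE[OF f] that by fastforce
  qed (use assms p K.prime_corner_axioms in auto)
  obtain b :: "_ \<Rightarrow> nat" where b: "inj_on b (carrier K.N)"
    using finite_imp_inj_to_nat_seg[OF K.finite_N] by blast
  define b' where "b' = inv_into (carrier K.N) b"
  \<comment> \<open>The group is copied to the natural numbers along the injection \<open>b\<close>.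
    The structure \<open>R\<close> has all of \<open>nat\<close> as carrier and is not itself shown
    to be a group; restricting it to the image of \<open>b\<close> gives the group
    \<open>N\<close>.\<close>
  define R where "R = \<lparr>carrier = UNIV :: nat set, monoid.mult = \<lambda>x y. b (b' x \<otimes>\<^bsub>K.N\<^esub> b' y), one = b \<one>\<^bsub>K.N\<^esub>\<rparr>"
  have b_hom: "b \<in> hom K.N R"
    unfolding hom_def R_def b'_def using b by (simp add: inv_into_f_f)
  define N where "N = R\<lparr>carrier := b ` carrier K.N, one := b \<one>\<^bsub>K.N\<^esub>\<rparr>"
  have gN: "group N" unfolding N_def by (rule K.N.hom_imp_img_group[OF b_hom])
  have b_iso: "b \<in> iso K.N N"
    using b b_hom unfolding iso_def N_def by (auto simp: hom_def bij_betw_def)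
  interpret S: split_automorphisms K.N N G b K.Phi K.V "p ^ 2"
    by (rule K.split_automorphisms[OF gN b_iso])
  have fin: "finite (carrier N)" unfolding N_def using K.finite_N by simp
  have "cyclic_series N (b ` carrier K.N)"
    by (rule cyclic_series_image[OF K.group_N gN b_iso K.cyclic_series_N])
  then have "cyclic_series N (carrier N)" unfolding N_def by simp
  then have "supersolvable N" by (rule group.cyclic_series_supersolvable[OF gN])
  then show ?thesis
    using gN fin S.G_iso_Out S.center_N S.inn_unique S.section_exists by blast
qed

end
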